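(* Let $S:[0,1)\to[0,1)$ be an interval exchange transformation of periodic type on $M$ intervals, ergodic with respect to Lebesgue measure, and let $0\le\theta_2<\theta_1$ be its two largest Lyapunov exponents. Let $f:[0,1)\to\mathbb{Z}$ be of bounded variation, and assume that the skew product $T(y,g)=(S(y),g+f(y))$ on $[0,1)\times\mathbb{Z}$ is ergodic with respect to the product $\mu$ of Lebesgue measure and counting measure. Then the skew product is $\omega$-recurrent for $$\omega(n)=(\log n)^M\, n^{\theta_2/\theta_1-1}.$$
   Context: Interval exchange transformations (IETs): given a finite alphabet $\mathcal{A}$ with $M$ symbols, an irreducible pair of bijections $\pi=(\pi_0,\pi_1)$, $\pi_\varepsilon:\mathcal{A}\to\{1,\ldots,M\}$, and lengths $(\lambda_a)_{a\in\mathcal{A}}$, $\lambda_a>0$, the IET divides $[0,\sum\lambda_a)$ into half-open intervals of lengths $\lambda_a$ in the order $\pi_0$ and rearranges them by translations into the order $\pi_1$. Rauzy induction: let $\pi_0(a_0)=M$, $\pi_1(a_1)=M$; if $\lambda_{a_0}\ne\lambda_{a_1}$, the induced map $S^{(1)}$ is the first return map of $S=S^{(0)}$ to $[0,\sum\lambda_a-\min(\lambda_{a_0},\lambda_{a_1}))$, which is again an IET on $M$ intervals, with length vector $\lambda^{(1)}$ given by $\lambda=\Theta(S)\lambda^{(1)}$, where $\Theta(S)=I+E_{ab}$, $E_{ab}$ is the elementary matrix with a single entry $1$ in position $(a,b)$, and $a,b$ are the symbols among $a_0,a_1$ with the larger and the smaller length respectively. Iterating (assuming all iterates are defined) gives $S^{(k)}$.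 The IET $S$ is of periodic type if there is $p>0$ with $\Theta(S^{(k+p)})=\Theta(S^{(k)})$ for all $k\ge 0$ and the matrix $\Theta^{(p)}=\Theta(S)\Theta(S^{(1)})\cdots\Theta(S^{(p-1)})$ has strictly positive entries. Its Lyapunov exponents are the logarithms of the absolute values of the eigenvalues of $\Theta^{(p)}$, counted with multiplicity; $\theta_1$ is the largest (the logarithm of the Perron-Frobenius eigenvalue) and $\theta_2$ the second largest, with $0\le\theta_2<\theta_1$ (only the ratio $\theta_2/\theta_1$ is used). $\omega$-recurrence: for $\omega$ positive, nonincreasing and regularly varying ($\omega(kx)\asymp\omega(x)$ for every $k\in\mathbb{R}^+$), a set $A$ with $0<\mu(A)<\infty$ and a point $x$, put $\zeta(x)=\sum_i\chi_A(T^ix)\,\omega(i)$; if $\omega$ is positive and nonincreasing only for large $n$, the sum is started at such an index, which does not affect divergence. When $T$ is conservative and ergodic, $\zeta$ is either finite almost everywhere or infinite almost everywhere, independently of the choice of $A$ of positive finite measure. The system is called $\omega$-recurrent if $\zeta(x)=\infty$ for $\mu$-almost every $x$. *)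

theory Defs
  imports
    "HOL-Analysis.Analysis"
    "HOL-Library.Landau_Symbols"
    "HOL-Computational_Algebra.Polynomial"
begin

text \<open>
  The alphabet is the finite type \<^typ>\<open>'a\<close>, so the number \<open>M\<close> of intervals is \<open>CARD('a)\<close>.
  The positions \<open>pi0\<close> and \<open>pi1\<close> take values in \<open>{1..M}\<close>.
\<close>

record 'a iet_data =
  pi0 :: "'a \<Rightarrow> nat"
  pi1 :: "'a \<Rightarrow> nat"
  lam :: "real ^ 'a"

definition iet_valid :: "'a::finite iet_data \<Rightarrow> bool" where
  "iet_valid D \<longleftrightarrow>
     bij_betw (pi0 D) UNIV {1..CARD('a)} \<and>
     bij_betw (pi1 D) UNIV {1..CARD('a)} \<and>
     (\<forall>k\<in>{1..<CARD('a)}. {a. pi0 D a \<le> k} \<noteq> {a. pi1 D a \<le> k}) \<and>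
     (\<forall>a. 0 < lam D $ a)"

definition total_length :: "'a::finite iet_data \<Rightarrow> real" where
  "total_length D = (\<Sum>a\<in>UNIV. lam D $ a)"

definition left_end :: "('a::finite \<Rightarrow> nat) \<Rightarrow> real ^ 'a \<Rightarrow> 'a \<Rightarrow> real" where
  "left_end \<pi> l a = (\<Sum>b | \<pi> b < \<pi> a. l $ b)"

definition subinterval :: "('a::finite \<Rightarrow> nat) \<Rightarrow> real ^ 'a \<Rightarrow> 'a \<Rightarrow> real set" where
  "subinterval \<pi> l a = {left_end \<pi> l a ..< left_end \<pi> l a + l $ a}"

text \<open>Only the values on \<open>{0..<total_length D}\<close> are meaningful.\<close>

definition iet :: "'a::finite iet_data \<Rightarrow> real \<Rightarrow> real" where
  "iet D x = (let a = (THE a. x \<in> subinterval (pi0 D) (lam D) a)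
     in x - left_end (pi0 D) (lam D) a + left_end (pi1 D) (lam D) a)"

definition last_symbol :: "('a::finite \<Rightarrow> nat) \<Rightarrow> 'a" where
  "last_symbol \<pi> = (THE a. \<pi> a = CARD('a))"

definition rauzy_defined :: "'a::finite iet_data \<Rightarrow> bool" where
  "rauzy_defined D \<longleftrightarrow> lam D $ last_symbol (pi0 D) \<noteq> lam D $ last_symbol (pi1 D)"

definition winner :: "'a::finite iet_data \<Rightarrow> 'a" where
  "winner D = (if lam D $ last_symbol (pi0 D) > lam D $ last_symbol (pi1 D)
     then last_symbol (pi0 D) else last_symbol (pi1 D))"

definition loser :: "'a::finite iet_data \<Rightarrow> 'a" where
  "loser D = (if lam D $ last_symbol (pi0 D) > lam D $ last_symbol (pi1 D)
     then last_symbol (pi1 D) else last_symbol (pi0 D))"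

definition Theta :: "'a::finite iet_data \<Rightarrow> real ^ 'a ^ 'a" where
  "Theta D = mat 1 + (\<chi> i j. if i = winner D \<and> j = loser D then 1 else 0)"

text \<open>Moves the last symbol of a row to the position immediately after the symbol \<open>w\<close>.\<close>

definition move_last :: "'a::finite \<Rightarrow> ('a \<Rightarrow> nat) \<Rightarrow> 'a \<Rightarrow> nat" where
  "move_last w \<pi> c =
     (if \<pi> c \<le> \<pi> w then \<pi> c else if \<pi> c = CARD('a) then \<pi> w + 1 else \<pi> c + 1)"

text \<open>
  The standard labelling of the induced map. That the result is the first return map, with
  lengths determined by \<^const>\<open>Theta\<close>, is shown in \<open>Theta_rauzy\<close> and \<open>iet_rauzy_first_return\<close>
  below. (The map alone does not determine the labelling, for instance when lengths coincide,
  so the permutations are given explicitly.)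
\<close>

definition rauzy :: "'a::finite iet_data \<Rightarrow> 'a iet_data" where
  "rauzy D = \<lparr>
     pi0 = (if winner D = last_symbol (pi0 D) then pi0 D else move_last (winner D) (pi0 D)),
     pi1 = (if winner D = last_symbol (pi0 D) then move_last (winner D) (pi1 D) else pi1 D),
     lam = (\<chi> c. if c = winner D then lam D $ c - lam D $ loser D else lam D $ c)\<rparr>"

definition first_return :: "('b \<Rightarrow> 'b) \<Rightarrow> 'b set \<Rightarrow> 'b \<Rightarrow> 'b" where
  "first_return T J x = (T ^^ (LEAST n. 0 < n \<and> (T ^^ n) x \<in> J)) x"

lemma pos_bij:
  fixes \<pi> :: "'a::finite \<Rightarrow> nat"
  assumes "bij_betw \<pi> UNIV {1..CARD('a)}"
  shows "inj \<pi>" "1 \<le> \<pi> a" "\<pi> a \<le> CARD('a)"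
  using assms by (auto simp: bij_betw_def)

lemma pos_surj:
  fixes \<pi> :: "'a::finite \<Rightarrow> nat"
  assumes "bij_betw \<pi> UNIV {1..CARD('a)}" "1 \<le> k" "k \<le> CARD('a)"
  obtains b where "\<pi> b = k"
proof -
  have "k \<in> range \<pi>" using assms by (simp add: bij_betw_def)
  then show ?thesis using that by (auto elim: rangeE)
qed

lemma pos_last_symbol:
  fixes \<pi> :: "'a::finite \<Rightarrow> nat"
  assumes "bij_betw \<pi> UNIV {1..CARD('a)}"
  shows "\<pi> a = CARD('a) \<longleftrightarrow> a = last_symbol \<pi>"
proof -
  have M: "1 \<le> CARD('a)" by (simp add: Suc_leI)
  obtain b where b: "\<pi> b = CARD('a)"
    using pos_surj[OF assms M order_refl] .
  have u: "c = b" if "\<pi> c = CARD('a)" for c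
    using that b inj_eq[OF pos_bij(1)[OF assms], of c b] by simp
  have "last_symbol \<pi> = b" unfolding last_symbol_def by (rule the_equality, rule b, rule u)
  then show ?thesis using b u[of a] by blast
qed

lemma left_end_le:
  fixes \<pi> :: "'a::finite \<Rightarrow> nat"
  assumes "\<And>b. 0 < l $ b" "\<pi> a < \<pi> c"
  shows "left_end \<pi> l a + l $ a \<le> left_end \<pi> l c"
proof -
  have "left_end \<pi> l a + l $ a = (\<Sum>b\<in>insert a {b. \<pi> b < \<pi> a}. l $ b)"
    unfolding left_end_def by simp
  also have "\<dots> \<le> (\<Sum>b | \<pi> b < \<pi> c. l $ b)"
    by (rule sum_mono2) (use assms in \<open>auto intro: less_imp_le\<close>)
  finally show ?thesis unfolding left_end_def .
qed

lemma left_end_Suc: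
  fixes \<pi> :: "'a::finite \<Rightarrow> nat"
  assumes "inj \<pi>" "\<pi> c = Suc (\<pi> a)"
  shows "left_end \<pi> l c = left_end \<pi> l a + l $ a"
proof -
  have "{b. \<pi> b < \<pi> c} = insert a {b. \<pi> b < \<pi> a}"
    using assms by (auto simp: less_Suc_eq dest: injD)
  then show ?thesis unfolding left_end_def by simp
qed

lemma left_end_last:
  fixes \<pi> :: "'a::finite \<Rightarrow> nat"
  assumes "bij_betw \<pi> UNIV {1..CARD('a)}"
  shows "left_end \<pi> l (last_symbol \<pi>) + l $ last_symbol \<pi> = (\<Sum>a\<in>UNIV. l $ a)"
proof -
  let ?z = "last_symbol \<pi>"
  have z: "\<pi> ?z = CARD('a)" using pos_last_symbol[OF assms] by blast
  have "\<pi> b < \<pi> ?z \<longleftrightarrow> b \<noteq> ?z" for b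
    unfolding z using pos_last_symbol[OF assms, of b] pos_bij(3)[OF assms, of b] by (cases "b = ?z") auto
  then have "{b. \<pi> b < \<pi> ?z} = UNIV - {?z}" by blast
  then have "left_end \<pi> l ?z = (\<Sum>b\<in>UNIV - {?z}. l $ b)" unfolding left_end_def by (simp only:)
  moreover have "(\<Sum>a\<in>UNIV. l $ a) = l $ ?z + (\<Sum>b\<in>UNIV - {?z}. l $ b)"
    by (rule sum.remove) auto
  ultimately show ?thesis by linarith
qed

lemma subinterval_subset:
  fixes \<pi> :: "'a::finite \<Rightarrow> nat"
  assumes "\<And>b. 0 < l $ b"
  shows "subinterval \<pi> l a \<subseteq> {0..<\<Sum>a\<in>UNIV. l $ a}"
proof -
  have "0 \<le> left_end \<pi> l a" unfolding left_end_def
    by (rule sum_nonneg) (use assms in \<open>auto intro: less_imp_le\<close>)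
  moreover have "left_end \<pi> l a + l $ a = (\<Sum>b\<in>insert a {b. \<pi> b < \<pi> a}. l $ b)"
    unfolding left_end_def by simp
  moreover have "\<dots> \<le> (\<Sum>b\<in>UNIV. l $ b)"
    by (rule sum_mono2) (use assms in \<open>auto intro: less_imp_le\<close>)
  ultimately show ?thesis unfolding subinterval_def by auto
qed

lemma subinterval_unique:
  fixes \<pi> :: "'a::finite \<Rightarrow> nat"
  assumes "inj \<pi>" "\<And>b. 0 < l $ b" "x \<in> subinterval \<pi> l a" "x \<in> subinterval \<pi> l c"
  shows "a = c"
proof (rule ccontr)
  assume "a \<noteq> c"
  then consider "\<pi> a < \<pi> c" | "\<pi> c < \<pi> a"
    using inj_eq[OF assms(1), of a c] by linarith
  then show False
    using left_end_le[OF assms(2), of \<pi> a c] left_end_le[OF assms(2), of \<pi> c a] assms(3,4)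
    unfolding subinterval_def by cases auto
qed

lemma subinterval_cover:
  fixes \<pi> :: "'a::finite \<Rightarrow> nat"
  assumes bij: "bij_betw \<pi> UNIV {1..CARD('a)}"
    and x: "0 \<le> x" "x < (\<Sum>a\<in>UNIV. l $ a)"
  obtains a where "x \<in> subinterval \<pi> l a"
proof -
  let ?P = "\<lambda>k. \<exists>a. \<pi> a = k \<and> left_end \<pi> l a \<le> x"
  have "1 \<le> CARD('a)" by (simp add: Suc_leI)
  then obtain f where f: "\<pi> f = 1" using pos_surj[OF bij order_refl] by blast
  have "\<not> \<pi> b < \<pi> f" for b using pos_bij(2)[OF bij, of b] f by simp
  then have "left_end \<pi> l f = 0" unfolding left_end_def by simp
  then have P1: "?P 1" using f x by auto
  have bd: "\<And>k. ?P k \<Longrightarrow> k \<le> CARD('a)" using pos_bij(3)[OF bij] by blast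
  obtain k where k: "?P k" "\<And>j. ?P j \<Longrightarrow> j \<le> k"
    using Greatest_le_nat[of ?P _ "CARD('a)"] GreatestI_nat[of ?P 1 "CARD('a)"] P1 bd by blast
  obtain a where a: "\<pi> a = k" "left_end \<pi> l a \<le> x" using k(1) by blast
  have "x < left_end \<pi> l a + l $ a"
  proof (cases "k = CARD('a)")
    case True
    then show ?thesis using left_end_last[OF bij, of l] pos_last_symbol[OF bij, of a] a x by simp
  next
    case False
    then have "1 \<le> Suc k" "Suc k \<le> CARD('a)" using bd[OF k(1)] by auto
    then obtain c where c: "\<pi> c = Suc k" using pos_surj[OF bij] by blast
    then have "\<not> left_end \<pi> l c \<le> x" using k(2)[of "Suc k"] by auto
    then show ?thesis using left_end_Suc[OF pos_bij(1)[OF bij], of c a l] c a by simp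
  qed
  with a that show ?thesis unfolding subinterval_def by auto
qed

lemma iet_eq:
  assumes "iet_valid D" "x \<in> subinterval (pi0 D) (lam D) a"
  shows "iet D x = x - left_end (pi0 D) (lam D) a + left_end (pi1 D) (lam D) a"
proof -
  have "inj (pi0 D)" and pos: "\<And>b. 0 < lam D $ b"
    using assms(1) pos_bij(1)[of "pi0 D"] unfolding iet_valid_def by auto
  from subinterval_unique[OF this] have "(THE a. x \<in> subinterval (pi0 D) (lam D) a) = a"
    using assms(2) by (intro the_equality) auto
  then show ?thesis unfolding iet_def by simp
qed

lemma iet_range:
  fixes D :: "'a::finite iet_data"
  assumes D: "iet_valid D" and x: "x \<in> {0..<total_length D}"
  shows "iet D x \<in> {0..<total_length D}"
proof -
  have bij: "bij_betw (pi0 D) UNIV {1..CARD('a)}" and pos: "\<And>b. 0 < lam D $ b"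
    using D unfolding iet_valid_def by auto
  obtain a where a: "x \<in> subinterval (pi0 D) (lam D) a"
    using subinterval_cover[OF bij, of x "lam D"] x unfolding total_length_def by auto
  have "iet D x \<in> subinterval (pi1 D) (lam D) a"
    using iet_eq[OF D a] a unfolding subinterval_def by auto
  moreover have "subinterval (pi1 D) (lam D) a \<subseteq> {0..<total_length D}"
    unfolding total_length_def by (rule subinterval_subset) (rule pos)
  ultimately show ?thesis by (rule rev_subsetD)
qed

lemma Theta_rauzy:
  assumes "rauzy_defined D"
  shows "lam D = Theta D *v lam (rauzy D)"
proof -
  have wl: "winner D \<noteq> loser D"
    using assms unfolding rauzy_defined_def winner_def loser_def by auto
  have "(Theta D *v lam (rauzy D)) $ i = lam D $ i" for i
  proof -
    let ?l = "lam (rauzy D)"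
    have "(Theta D *v ?l) $ i = (\<Sum>j\<in>UNIV. Theta D $ i $ j * ?l $ j)"
      by (simp add: matrix_vector_mult_def)
    also have "\<dots> = (\<Sum>j\<in>UNIV. (if j = i then ?l $ j else 0) +
        (if j = loser D then (if i = winner D then ?l $ j else 0) else 0))"
      by (rule sum.cong) (auto simp: Theta_def mat_def)
    also have "\<dots> = ?l $ i + (if i = winner D then ?l $ loser D else 0)"
      by (simp add: sum.distrib)
    finally show ?thesis using wl unfolding rauzy_def by auto
  qed
  then show ?thesis by (simp add: vec_eq_iff)
qed

lemma left_end_fixed:
  fixes \<pi> :: "'a::finite \<Rightarrow> nat"
  assumes "bij_betw \<pi> UNIV {1..CARD('a)}"
  shows "left_end \<pi> (\<chi> c. if c = last_symbol \<pi> then v c else l $ c) a = left_end \<pi> l a"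
proof -
  have "\<not> \<pi> (last_symbol \<pi>) < \<pi> a"
    using pos_last_symbol[OF assms, of "last_symbol \<pi>"] pos_bij(3)[OF assms, of a] by simp
  then show ?thesis unfolding left_end_def by (intro sum.cong) auto
qed

lemma left_end_move_last:
  fixes \<pi> :: "'a::finite \<Rightarrow> nat" and l :: "real ^ 'a"
  assumes bij: "bij_betw \<pi> UNIV {1..CARD('a)}" and w: "w \<noteq> last_symbol \<pi>"
  defines "z \<equiv> last_symbol \<pi>"
  defines "l' \<equiv> (\<chi> c. if c = w then l $ c - l $ z else l $ c)"
  shows "c \<noteq> z \<Longrightarrow> left_end (move_last w \<pi>) l' c = left_end \<pi> l c"
    and "left_end (move_last w \<pi>) l' z = left_end \<pi> l w + l $ w - l $ z"
proof -
  have zM: "\<pi> a = CARD('a) \<longleftrightarrow> a = z" for a unfolding z_def by (rule pos_last_symbol[OF bij])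
  have le: "\<pi> a \<le> CARD('a)" for a using pos_bij(3)[OF bij] .
  have inj: "\<pi> a = \<pi> b \<longleftrightarrow> a = b" for a b using pos_bij(1)[OF bij] by (auto dest: injD)
  have wz: "w \<noteq> z" using w z_def by simp
  have zw: "\<pi> w < \<pi> z" using zM[of z] zM[of w] le[of w] wz by simp
  have mz: "move_last w \<pi> z = Suc (\<pi> w)"
    using zM[of z] zw unfolding move_last_def by simp
  have mo: "move_last w \<pi> a = (if \<pi> a \<le> \<pi> w then \<pi> a else Suc (\<pi> a))" if "a \<noteq> z" for a
    using that zM[of a] unfolding move_last_def by simp
  show "left_end (move_last w \<pi>) l' z = left_end \<pi> l w + l $ w - l $ z"
  proof -
    have "move_last w \<pi> b < move_last w \<pi> z \<longleftrightarrow> b = w \<or> \<pi> b < \<pi> w" for b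
    proof (cases "b = z")
      case True
      then show ?thesis using mz wz zw by simp
    next
      case False
      then show ?thesis using mz mo[OF False] inj[of b w] by (auto simp: order.strict_iff_order)
    qed
    then have "{b. move_last w \<pi> b < move_last w \<pi> z} = insert w {b. \<pi> b < \<pi> w}" by blast
    then have "left_end (move_last w \<pi>) l' z = l' $ w + (\<Sum>b | \<pi> b < \<pi> w. l' $ b)"
      unfolding left_end_def by simp
    also have "(\<Sum>b | \<pi> b < \<pi> w. l' $ b) = left_end \<pi> l w"
      unfolding left_end_def by (rule sum.cong) (auto simp: l'_def)
    finally show ?thesis by (simp add: l'_def)
  qed
  show "left_end (move_last w \<pi>) l' c = left_end \<pi> l c" if cz: "c \<noteq> z"
  proof (cases "\<pi> c \<le> \<pi> w")
    case True
    have mc: "move_last w \<pi> c = \<pi> c" using mo[OF cz] True by simp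
    have "move_last w \<pi> b < move_last w \<pi> c \<longleftrightarrow> \<pi> b < \<pi> c" for b
    proof (cases "b = z")
      case True
      then show ?thesis using mz mc zw \<open>\<pi> c \<le> \<pi> w\<close> by simp
    next
      case False
      then show ?thesis using mo[OF False] mc \<open>\<pi> c \<le> \<pi> w\<close> by simp
    qed
    then have "{b. move_last w \<pi> b < move_last w \<pi> c} = {b. \<pi> b < \<pi> c}" by blast
    moreover have "(\<Sum>b | \<pi> b < \<pi> c. l' $ b) = (\<Sum>b | \<pi> b < \<pi> c. l $ b)"
      by (rule sum.cong) (use True in \<open>auto simp: l'_def\<close>)
    ultimately show ?thesis unfolding left_end_def by simp
  next
    case False
    have cM: "\<pi> c < \<pi> z" using zM[of c] zM[of z] le[of c] cz by simp
    have "move_last w \<pi> b < move_last w \<pi> c \<longleftrightarrow> b = z \<or> \<pi> b < \<pi> c" for b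
    proof (cases "b = z")
      case True
      then show ?thesis using mz mo[OF cz] False by simp
    next
      case bz: False
      then show ?thesis using mo[OF bz] mo[OF cz] False by auto
    qed
    then have "{b. move_last w \<pi> b < move_last w \<pi> c} = insert z {b. \<pi> b < \<pi> c}" by blast
    then have "left_end (move_last w \<pi>) l' c = l' $ z + (\<Sum>b | \<pi> b < \<pi> c. l' $ b)"
      unfolding left_end_def using cM by simp
    also have "(\<Sum>b | \<pi> b < \<pi> c. l' $ b) =
        (\<Sum>b | \<pi> b < \<pi> c. l $ b - (if b = w then l $ z else 0))"
      by (rule sum.cong) (auto simp: l'_def)
    also have "\<dots> = left_end \<pi> l c - l $ z"
      unfolding left_end_def using False by (simp add: sum_subtractf)
    finally show ?thesis using wz by (simp add: l'_def)
  qed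
qed

lemma move_last_bij:
  fixes \<pi> :: "'a::finite \<Rightarrow> nat"
  assumes bij: "bij_betw \<pi> UNIV {1..CARD('a)}" and w: "w \<noteq> last_symbol \<pi>"
  shows "bij_betw (move_last w \<pi>) UNIV {1..CARD('a)}"
proof -
  define z where "z = last_symbol \<pi>"
  have zM: "\<pi> a = CARD('a) \<longleftrightarrow> a = z" for a unfolding z_def by (rule pos_last_symbol[OF bij])
  have le: "1 \<le> \<pi> a" "\<pi> a \<le> CARD('a)" for a using pos_bij[OF bij] by auto
  have inj: "\<pi> a = \<pi> b \<Longrightarrow> a = b" for a b using pos_bij(1)[OF bij] by (auto dest: injD)
  have zw: "\<pi> w < CARD('a)" using zM[of w] le[of w] w z_def by (simp add: le_less)
  have "inj (move_last w \<pi>)"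
  proof (rule injI)
    fix a b assume "move_last w \<pi> a = move_last w \<pi> b"
    then have "\<pi> a = \<pi> b" unfolding move_last_def by (auto split: if_splits)
    then show "a = b" by (rule inj)
  qed
  moreover have "move_last w \<pi> a \<in> {1..CARD('a)}" for a
    using le[of a] zw unfolding move_last_def by auto
  ultimately show ?thesis
    by (metis bij_betw_def card_image card_subset_eq card_atLeastAtMost diff_Suc_1
        finite_atLeastAtMost image_subsetI)
qed

lemma first_return_1:
  assumes "T x \<in> J"
  shows "first_return T J x = T x"
proof -
  have "(LEAST n. 0 < n \<and> (T ^^ n) x \<in> J) = 1"
    by (rule Least_equality) (use assms in auto)
  then show ?thesis unfolding first_return_def by simp
qed

lemma first_return_2:
  assumes "T x \<notin> J" "T (T x) \<in> J"
  shows "first_return T J x = T (T x)"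
proof -
  have "(LEAST n. 0 < n \<and> (T ^^ n) x \<in> J) = 2"
  proof (rule Least_equality)
    show "0 < (2::nat) \<and> (T ^^ 2) x \<in> J" using assms by (simp add: numeral_2_eq_2)
    fix n assume n: "0 < n \<and> (T ^^ n) x \<in> J"
    then have "n \<noteq> 1" using assms by auto
    with n show "2 \<le> n" by simp
  qed
  then show ?thesis unfolding first_return_def by (simp add: numeral_2_eq_2)
qed

theorem iet_rauzy_first_return:
  assumes D: "iet_valid D" "rauzy_defined D"
    and x: "x \<in> {0..<total_length (rauzy D)}"
  shows "iet (rauzy D) x = first_return (iet D) {0..<total_length (rauzy D)} x"
    and "total_length (rauzy D) = total_length D
      - min (lam D $ last_symbol (pi0 D)) (lam D $ last_symbol (pi1 D))"
proof -
  define w l where "w = winner D" and "l = loser D"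
  define L L' where "L = lam D" and "L' = lam (rauzy D)"
  define J where "J = {0..<total_length (rauzy D)}"
  let ?p = "pi0 D" and ?q = "pi1 D"
  let ?p' = "pi0 (rauzy D)" and ?q' = "pi1 (rauzy D)"
  have bp: "bij_betw ?p UNIV {1..CARD('a)}" and bq: "bij_betw ?q UNIV {1..CARD('a)}"
    and pos: "\<And>b. 0 < L $ b" using D(1) unfolding iet_valid_def L_def by auto
  have wl: "w \<noteq> l" and Lwl: "L $ l < L $ w"
    using D(2) unfolding rauzy_defined_def w_def l_def winner_def loser_def L_def by auto
  have L': "L' = (\<chi> c. if c = w then L $ c - L $ l else L $ c)"
    unfolding L'_def w_def l_def L_def rauzy_def by simp
  have pos': "0 < L' $ b" for b using pos Lwl unfolding L' by simp
  have min: "min (L $ last_symbol ?p) (L $ last_symbol ?q) = L $ l"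
    unfolding L_def l_def loser_def by auto
  have "total_length (rauzy D) = (\<Sum>c\<in>UNIV. L $ c - (if c = w then L $ l else 0))"
    unfolding total_length_def L'_def[symmetric] by (rule sum.cong) (auto simp: L')
  then have tot: "total_length (rauzy D) = total_length D - L $ l"
    unfolding total_length_def L_def by (simp add: sum_subtractf)
  then show "total_length (rauzy D) = total_length D
      - min (lam D $ last_symbol (pi0 D)) (lam D $ last_symbol (pi1 D))"
    using min unfolding L_def by simp
  note ieq = iet_eq[OF D(1), folded L_def]
  have last: "left_end \<pi> L (last_symbol \<pi>) = total_length D - L $ last_symbol \<pi>"
    if "bij_betw \<pi> UNIV {1..CARD('a)}" for \<pi>
    using left_end_last[OF that, of L] unfolding total_length_def L_def by simp
  have ne: "last_symbol ?p \<noteq> last_symbol ?q"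
    using D(2) unfolding rauzy_defined_def by auto
  have bp': "bij_betw ?p' UNIV {1..CARD('a)}" and bq': "bij_betw ?q' UNIV {1..CARD('a)}"
    using move_last_bij[OF bp, of w] move_last_bij[OF bq, of w] bp bq ne
    unfolding rauzy_def w_def winner_def by auto
  obtain a where a: "x \<in> subinterval ?p' L' a"
    using subinterval_cover[OF bp', of x L'] x unfolding total_length_def L'_def by auto
  have "(THE a. x \<in> subinterval ?p' L' a) = a"
    using a subinterval_unique[OF pos_bij(1)[OF bp'] pos', of x] by blast
  then have T': "iet (rauzy D) x = x - left_end ?p' L' a + left_end ?q' L' a"
    unfolding iet_def L'_def by simp
  have "iet (rauzy D) x \<in> subinterval ?q' L' a"
    using T' a unfolding subinterval_def by auto
  then have T'J: "iet (rauzy D) x \<in> J"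
    using subinterval_subset[of L' ?q' a, OF pos'] unfolding J_def total_length_def L'_def by auto
  have La: "L' $ a \<le> L $ a" using pos[of l] unfolding L' by simp
  have "iet (rauzy D) x = first_return (iet D) J x"
  proof (cases "w = last_symbol ?p")
    case True
    then have lq: "l = last_symbol ?q" and wq: "w \<noteq> last_symbol ?q"
      using D(2) unfolding w_def l_def winner_def loser_def rauzy_defined_def
      by (auto split: if_splits)
    have p': "?p' = ?p" and q': "?q' = move_last w ?q"
      using True unfolding w_def rauzy_def by auto
    have Lp: "left_end ?p' L' c = left_end ?p L c" for c
      using left_end_fixed[OF bp, of "\<lambda>c. L $ c - L $ l" L c] True p' L' by simp
    note Lq = left_end_move_last[OF bq wq, where l = L, folded lq, folded L', folded q']
    have xa: "x \<in> subinterval ?p L a" using a Lp La unfolding subinterval_def by auto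
    show ?thesis
    proof (cases "a = l")
      case False
      then have "iet D x = iet (rauzy D) x" using ieq[OF xa] T' Lp Lq(1) by simp
      then show ?thesis using first_return_1 T'J by metis
    next
      case True
      have Tx: "iet D x = x - left_end ?p L l + (total_length D - L $ l)"
        using ieq[OF xa] last[OF bq] True lq by simp
      then have "iet D x \<notin> J" using xa True tot unfolding J_def subinterval_def by auto
      moreover have "iet D x \<in> subinterval ?p L w"
        using Tx xa True last[OF bp] \<open>w = last_symbol ?p\<close> Lwl unfolding subinterval_def by auto
      from ieq[OF this] have "iet D (iet D x) = iet (rauzy D) x"
        using Tx T' Lp Lq(2) True last[OF bp] \<open>w = last_symbol ?p\<close> by simp
      ultimately show ?thesis using first_return_2 T'J by metis
    qed
  next
    case False
    then have lp: "l = last_symbol ?p" and wp: "w \<noteq> last_symbol ?p" and wq: "w = last_symbol ?q"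
      using D(2) unfolding w_def l_def winner_def loser_def rauzy_defined_def
      by (auto split: if_splits)
    have q': "?q' = ?q" and p': "?p' = move_last w ?p"
      using False unfolding w_def rauzy_def by auto
    have Lq: "left_end ?q' L' c = left_end ?q L c" for c
      using left_end_fixed[OF bq, of "\<lambda>c. L $ c - L $ l" L c] wq q' L' by simp
    note Lp = left_end_move_last[OF bp wp, where l = L, folded lp, folded L', folded p']
    show ?thesis
    proof (cases "a = l")
      case False
      then have xa: "x \<in> subinterval ?p L a" using a Lp(1) La unfolding subinterval_def by auto
      then have "iet D x = iet (rauzy D) x" using ieq[OF xa] T' Lq Lp(1) False by simp
      then show ?thesis using first_return_1 T'J by metis
    next
      case True
      have L'l: "L' $ l = L $ l" using wl unfolding L' by simp
      have xw: "x \<in> subinterval ?p L w"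
        using a True Lp(2) L'l Lwl unfolding subinterval_def by auto
      have Tx: "iet D x = x - left_end ?p L w + (total_length D - L $ w)"
        using ieq[OF xw] last[OF bq] wq by simp
      have "iet D x \<notin> J"
        using Tx a True Lp(2) L'l tot unfolding J_def subinterval_def by auto
      moreover have "iet D x \<in> subinterval ?p L l"
        using Tx a True Lp(2) L'l last[OF bp] lp unfolding subinterval_def by auto
      from ieq[OF this] have "iet D (iet D x) = iet (rauzy D) x"
        using Tx T' Lq Lp(2) True last[OF bp] lp by simp
      ultimately show ?thesis using first_return_2 T'J by metis
    qed
  qed
  then show "iet (rauzy D) x = first_return (iet D) {0..<total_length (rauzy D)} x"
    unfolding J_def .
qed

primrec Theta_prod :: "'a::finite iet_data \<Rightarrow> nat \<Rightarrow> real ^ 'a ^ 'a" where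
  "Theta_prod D 0 = mat 1"
| "Theta_prod D (Suc n) = Theta_prod D n ** Theta ((rauzy ^^ n) D)"

text \<open>
  Periodic type with period \<open>p\<close>. The exponents below scale with the choice of \<open>p\<close>, their
  ratios do not depend on it.
\<close>

definition periodic_type :: "'a::finite iet_data \<Rightarrow> nat \<Rightarrow> bool" where
  "periodic_type D p \<longleftrightarrow>
     0 < p \<and>
     (\<forall>k. rauzy_defined ((rauzy ^^ k) D)) \<and>
     (\<forall>k. Theta ((rauzy ^^ (k + p)) D) = Theta ((rauzy ^^ k) D)) \<and>
     (\<forall>i j. 0 < Theta_prod D p $ i $ j)"

definition charpoly :: "complex ^ 'n ^ 'n \<Rightarrow> complex poly" where
  "charpoly A = det (\<chi> i j. (if i = j then [:0, 1:] else 0) - [:A $ i $ j:])"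

definition eigenvalues :: "real ^ 'n ^ 'n \<Rightarrow> complex multiset" where
  "eigenvalues A = proots (charpoly (\<chi> i j. complex_of_real (A $ i $ j)))"

text \<open>
  In nonincreasing order, so \<open>\<theta>\<^sub>1\<close> and \<open>\<theta>\<^sub>2\<close> are the entries with index 0 and 1. The matrices
  \<^const>\<open>Theta_prod\<close> have determinant 1, so the logarithm is never taken at 0.
\<close>

definition lyapunov_exponents :: "'a::finite iet_data \<Rightarrow> nat \<Rightarrow> real list" where
  "lyapunov_exponents D p =
     rev (sorted_list_of_multiset
       (image_mset (\<lambda>z. ln (cmod z)) (eigenvalues (Theta_prod D p))))"

definition bounded_variation_on :: "(real \<Rightarrow> real) \<Rightarrow> real set \<Rightarrow> bool" where
  "bounded_variation_on f I \<longleftrightarrow>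
     (\<exists>B. \<forall>xs. sorted xs \<and> set xs \<subseteq> I \<longrightarrow>
        (\<Sum>i<length xs - 1. \<bar>f (xs ! Suc i) - f (xs ! i)\<bar>) \<le> B)"

definition skew_product :: "('b \<Rightarrow> 'b) \<Rightarrow> ('b \<Rightarrow> int) \<Rightarrow> 'b \<times> int \<Rightarrow> 'b \<times> int" where
  "skew_product S f = (\<lambda>(y, g). (S y, g + f y))"

text \<open>
  Ergodicity includes preservation of the measure, which may be infinite.
\<close>

definition ergodic :: "'b measure \<Rightarrow> ('b \<Rightarrow> 'b) \<Rightarrow> bool" where
  "ergodic N T \<longleftrightarrow>
     T \<in> measurable N N \<and>
     (\<forall>A\<in>sets N. emeasure N (T -` A \<inter> space N) = emeasure N A) \<and>
     (\<forall>A\<in>sets N. T -` A \<inter> space N = A \<longrightarrow>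
        emeasure N A = 0 \<or> emeasure N (space N - A) = 0)"

definition weight_from :: "(real \<Rightarrow> real) \<Rightarrow> nat \<Rightarrow> bool" where
  "weight_from \<omega> m \<longleftrightarrow> (\<forall>x\<ge>real m. 0 < \<omega> x) \<and> antimono_on {real m..} \<omega>"

definition regularly_varying :: "(real \<Rightarrow> real) \<Rightarrow> bool" where
  "regularly_varying \<omega> \<longleftrightarrow> (\<forall>k>0. (\<lambda>x. \<omega> (k * x)) \<in> \<Theta>(\<omega>))"

text \<open>The sum \<open>\<zeta>\<close>, started at the index \<open>m\<close>.\<close>

definition zeta_sum :: "('b \<Rightarrow> 'b) \<Rightarrow> (real \<Rightarrow> real) \<Rightarrow> 'b set \<Rightarrow> nat \<Rightarrow> 'b \<Rightarrow> ennreal" where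
  "zeta_sum T \<omega> A m x =
     (\<Sum>i. indicator A ((T ^^ (m + i)) x) * ennreal (\<omega> (real (m + i))))"

definition omega_recurrent :: "'b measure \<Rightarrow> ('b \<Rightarrow> 'b) \<Rightarrow> (real \<Rightarrow> real) \<Rightarrow> bool" where
  "omega_recurrent N T \<omega> \<longleftrightarrow>
     (\<exists>m. weight_from \<omega> m) \<and> regularly_varying \<omega> \<and>
     (\<forall>A m. A \<in> sets N \<and> 0 < emeasure N A \<and> emeasure N A < \<infinity> \<and> weight_from \<omega> m \<longrightarrow>
        (AE x in N. zeta_sum T \<omega> A m x = \<infinity>))"

end

theory Submission
  imports Defs "HOL-Computational_Algebra.Fundamental_Theorem_Algebra"
begin

text \<open>
  The cocycle \<open>f\<close> has Birkhoff sums of length \<open>n\<close> bounded by a constant times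
  \<open>n * \<omega> n = (ln n)\<^sup>M * n powr (\<theta>2 / \<theta>1)\<close>, and a skew product whose cocycle obeys such a bound returns
  often enough to be \<open>\<omega>\<close>-recurrent.

  The bound (\<open>birkhoff_deviation\<close>) comes from Rauzy induction. For a function of bounded variation,
  the Birkhoff sum over a full Rauzy tower is constant up to an error that does not depend on the
  height of the tower (\<open>tower_sum_oscillation\<close>), so it is described by a vector indexed by the
  alphabet. Over one period this vector is multiplied by the transpose of the period matrix, up to a
  bounded error. The length vector is the Perron eigenvector of the period matrix
  (\<open>positive_sequences_proportional\<close>), and after subtraction of the mean the vectors are essentially
  orthogonal to it. On this hyperplane the \<open>j\<close>-th power of the transposed matrix grows at most like
  \<open>j ^ (M - 2) * exp (j * \<theta>2)\<close>, by the theorem of Cayley and Hamilton and by peeling off the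
  remaining eigenvalues one at a time (\<open>matrix_power_growth\<close>, \<open>exponents_and_growth\<close>). Adding up the
  bounded errors raises the power of \<open>j\<close> to \<open>M - 1\<close>. An arbitrary orbit segment of length \<open>n\<close> is
  decomposed into full towers by peeling its two ends, one Rauzy step after another; this takes a
  number of periods proportional to \<open>ln n\<close>, and the sum over the periods raises the power
  to \<open>M\<close> (\<open>birkhoff_sum_le_tower_bounds\<close>).

  The argument produces a mean \<open>c\<close> of the cocycle without integration, and \<open>c\<close> vanishes: otherwise
  the forward orbits of the skew product meet each level only finitely often, and the orbits through
  one half of the set of last visits to level \<open>0\<close> form an invariant set that contradicts ergodicity
  (\<open>not_eventually_nonzero\<close>).

  For recurrence (\<open>omega_recurrence\<close>), consider the times up to \<open>n\<close> at which an orbit of the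
  interval exchange is in a given set \<open>A\<close>. The number of values of the cocycle is at most of the order of
  \<open>n * \<omega> n\<close>, so by the pigeonhole principle most of these times are followed by at least a fixed
  multiple of \<open>1 / \<omega> n\<close> returns to \<open>A\<close> on the same level. Integrating, the points of \<open>A\<close> with that many returns up to time \<open>n\<close> have
  measure bounded below, and so has the upper limit of these sets. There the weighted sum of
  visits diverges: as \<open>\<omega>\<close> is nonincreasing, convergence would make the number of visits up to time
  \<open>n\<close> of smaller order than \<open>1 / \<omega> n\<close> (\<open>visits_negligible_if_weights_summable\<close>). The set of divergence is
  strictly invariant because consecutive weights are comparable, so by ergodicity it has full measure
  (\<open>zeta_infinite_AE\<close>).
\<close>

section \<open>Growth of matrix powers from the characteristic polynomial\<close>

text \<open>
  The vectors form a module over the polynomial ring when the indeterminate acts as the matrix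
  \<open>C\<close>; the definition is Horner's scheme for this action.
\<close>
definition poly_action :: "'a::comm_ring_1 ^ 'n ^ 'n \<Rightarrow> 'a poly \<Rightarrow> 'a ^ 'n \<Rightarrow> 'a ^ 'n" where
  "poly_action C q = fold_coeffs (\<lambda>a g w. a *s w + C *v g w) q (\<lambda>w. 0)"

lemma poly_action_0 [simp]: "poly_action C 0 w = 0"
  by (simp add: poly_action_def)

lemma poly_action_pCons [simp]:
  "poly_action C (pCons a q) w = a *s w + C *v poly_action C q w"
  by (cases "q = 0 \<and> a = 0") (auto simp: poly_action_def)

lemma poly_action_add: "poly_action C (q + r) w = poly_action C q w + poly_action C r w"
proof (induction q arbitrary: r)
  case (pCons a q)
  obtain b r' where r: "r = pCons b r'" by (metis pCons_cases)
  show ?case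
    by (simp add: r pCons.IH matrix_vector_right_distrib vector_sadd_rdistrib algebra_simps)
qed simp

lemma matrix_vector_scale: "C *v (a *s w) = a *s (C *v w)" for C :: "'a::comm_ring_1 ^ 'n ^ 'm"
  by (simp add: vec_eq_iff matrix_vector_mult_def sum_distrib_left mult.left_commute)

lemma poly_action_smult: "poly_action C (smult a q) w = a *s poly_action C q w"
  by (induction q)
    (simp_all add: vector_add_ldistrib matrix_vector_scale vector_smult_assoc mult.commute)

lemma poly_action_vec_add: "poly_action C q (v + w) = poly_action C q v + poly_action C q w"
  by (induction q) (simp_all add: matrix_vector_right_distrib algebra_simps)

lemma poly_action_vec_smult: "poly_action C q (a *s w) = a *s poly_action C q w"
  by (induction q)
    (simp_all add: vector_add_ldistrib matrix_vector_scale vector_smult_assoc mult.commute)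

lemma poly_action_vec_0 [simp]: "poly_action C q 0 = 0"
  by (induction q) simp_all

lemma poly_action_vec_sum:
  "poly_action C q (\<Sum>i\<in>I. w i) = (\<Sum>i\<in>I. poly_action C q (w i))"
  by (induction I rule: infinite_finite_induct) (simp_all add: poly_action_vec_add)

lemma poly_action_sum:
  "poly_action C (\<Sum>i\<in>I. q i) w = (\<Sum>i\<in>I. poly_action C (q i) w)"
  by (induction I rule: infinite_finite_induct) (simp_all add: poly_action_add)

lemma poly_action_mult: "poly_action C (q * r) w = poly_action C q (poly_action C r w)"
  by (induction q) (simp_all add: poly_action_add poly_action_smult)

lemma poly_action_1 [simp]: "poly_action C 1 w = w"
  by (simp add: one_pCons)

text \<open>
  The entries of the adjugate are the determinants in which one column is replaced by a unit
  vector. Expanding in that column, row \<open>k\<close> of the adjugate times column \<open>i\<close> of \<open>N\<close> is the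
  determinant of \<open>N\<close> with column \<open>k\<close> overwritten by column \<open>i\<close>, which has two equal columns
  unless \<open>i = k\<close>.
\<close>
lemma adjugate_exists:
  fixes N :: "'a::comm_ring_1 ^ 'n ^ 'n"
  shows "\<exists>adj. \<forall>k i. (\<Sum>j\<in>UNIV. adj k j * N $ j $ i) = (if k = i then det N else 0)"
proof -
  define Nt where "Nt = transpose N"
  define adj where "adj k j = det (\<chi> l. if l = k then axis j 1 else Nt $ l)" for k j
  have "(\<Sum>j\<in>UNIV. adj k j * N $ j $ i) = (if k = i then det N else 0)" for k i
  proof -
    have "(\<Sum>j\<in>UNIV. adj k j * N $ j $ i)
      = (\<Sum>j\<in>UNIV. det (\<chi> l. if l = k then Nt $ i $ j *s axis j 1 else Nt $ l))"
      by (simp add: adj_def det_row_mul Nt_def transpose_def mult.commute)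
    also have "\<dots> = det (\<chi> l. if l = k then (\<Sum>j\<in>UNIV. Nt $ i $ j *s axis j 1) else Nt $ l)"
      by (subst det_linear_row_sum) auto
    also have "(\<Sum>j\<in>UNIV. Nt $ i $ j *s axis j 1) = Nt $ i"
      by (simp add: vec_eq_iff axis_def if_distrib cong: if_cong)
    also have "det (\<chi> l. if l = k then Nt $ i else Nt $ l) = (if k = i then det N else 0)"
    proof (cases "k = i")
      case True
      then have "(\<chi> l. if l = k then Nt $ i else Nt $ l) = Nt" by (simp add: vec_eq_iff)
      with True show ?thesis by (simp add: Nt_def)
    next
      case False
      have "det (\<chi> l. if l = k then Nt $ i else Nt $ l) = 0"
        by (rule det_identical_rows[of k i]) (use False in \<open>auto simp: row_def vec_eq_iff\<close>)
      with False show ?thesis by simp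
    qed
    finally show ?thesis .
  qed
  then show ?thesis by blast
qed

text \<open>
  In the module of \<^const>\<open>poly_action\<close> the unit vectors solve a homogeneous linear system whose
  matrix over the polynomial ring is \<open>X - A\<close>. Multiplying with the adjugate shows that the
  determinant of the system annihilates each of them. With this ordering of indices the acting
  matrix is the transpose of \<open>A\<close>, and it is the transpose that drives the Birkhoff sums later on.
\<close>
lemma Cayley_Hamilton_transpose:
  fixes A :: "complex ^ 'n ^ 'n"
  shows "poly_action (transpose A) (charpoly A) w = 0"
proof -
  define N :: "complex poly ^ 'n ^ 'n"
    where "N = (\<chi> i j. (if i = j then [:0, 1:] else 0) - [:A $ i $ j:])"
  let ?P = "poly_action (transpose A)"
  obtain adj where adj: "\<And>k i. (\<Sum>j\<in>UNIV. adj k j * N $ j $ i) = (if k = i then det N else 0)"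
    using adjugate_exists[of N] by blast
  have col: "(\<Sum>i\<in>UNIV. ?P (N $ j $ i) (axis i 1)) = 0" for j
  proof -
    have "?P (N $ j $ i) (axis i 1) = (if j = i then transpose A *v axis i 1 else 0) - A $ j $ i *s axis i 1"
      for i
      by (simp add: N_def vec_eq_iff)
    then have "(\<Sum>i\<in>UNIV. ?P (N $ j $ i) (axis i 1))
       = transpose A *v axis j 1 - (\<Sum>i\<in>UNIV. A $ j $ i *s axis i 1)"
      by (simp add: sum_subtractf)
    also have "\<dots> = 0"
      by (simp add: vec_eq_iff matrix_vector_mult_def transpose_def axis_def if_distrib cong: if_cong)
    finally show ?thesis .
  qed
  have ax: "?P (det N) (axis k 1) = 0" for k
  proof -
    have "?P (det N) (axis k 1) = (\<Sum>i\<in>UNIV. ?P (if k = i then det N else 0) (axis i 1))"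
      by (simp add: if_distrib[of "\<lambda>q. ?P q _"] cong: if_cong)
    also have "\<dots> = (\<Sum>i\<in>UNIV. \<Sum>j\<in>UNIV. ?P (adj k j) (?P (N $ j $ i) (axis i 1)))"
      by (simp add: adj[symmetric] poly_action_sum poly_action_mult)
    also have "\<dots> = (\<Sum>j\<in>UNIV. ?P (adj k j) (\<Sum>i\<in>UNIV. ?P (N $ j $ i) (axis i 1)))"
      by (subst sum.swap) (simp add: poly_action_vec_sum)
    also have "\<dots> = 0" by (simp add: col)
    finally show ?thesis .
  qed
  have "w = (\<Sum>k\<in>UNIV. w $ k *s axis k 1)"
    by (simp add: vec_eq_iff axis_def if_distrib cong: if_cong)
  then have "?P (det N) w = (\<Sum>k\<in>UNIV. w $ k *s ?P (det N) (axis k 1))"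
    by (metis (no_types, lifting) poly_action_vec_sum poly_action_vec_smult sum.cong)
  also have "det N = charpoly A" by (simp add: charpoly_def N_def)
  finally show ?thesis using ax by (simp add: charpoly_def N_def)
qed

lemma degree_charpoly_le: "degree (charpoly (A :: complex ^ 'n ^ 'n)) \<le> CARD('n)"
proof -
  have "degree (of_int (sign s) * (\<Prod>i\<in>UNIV. (if i = s i then [:0, 1:] else 0) - [:A $ i $ s i:]))
      \<le> CARD('n)" for s :: "'n \<Rightarrow> 'n"
  proof -
    let ?q = "\<lambda>i. (if i = s i then [:0, 1:] else 0) - [:A $ i $ s i:]"
    have d1: "degree (?q i) \<le> 1" for i
      by (rule degree_diff_le) auto
    have "degree (of_int (sign s) * (\<Prod>i\<in>UNIV. ?q i)) \<le> degree (\<Prod>i\<in>UNIV. ?q i)"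
      using degree_mult_le[of "of_int (sign s)" "\<Prod>i\<in>UNIV. ?q i"] by simp
    also have "\<dots> \<le> (\<Sum>i\<in>(UNIV::'n set). degree (?q i))"
      by (rule degree_prod_sum_le[THEN order_trans]) (simp_all add: o_def)
    also have "\<dots> \<le> (\<Sum>i\<in>(UNIV::'n set). 1)" by (rule sum_mono) (rule d1)
    finally show ?thesis by simp
  qed
  then show ?thesis
    unfolding charpoly_def det_def by (intro degree_sum_le) (auto simp: finite_permutations)
qed

lemma charpoly_eval:
  "poly (charpoly A) x = det (\<chi> i j. (if i = j then x else 0) - A $ i $ j)"
proof -
  have "poly ((if i = j then [:0, 1:] else 0) - [:A $ i $ j:]) x = (if i = j then x else 0) - A $ i $ j"
    for i j by simp
  then show ?thesis unfolding charpoly_def det_def by (simp add: poly_sum poly_prod)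
qed

lemma charpoly_root_left_eigenvector:
  fixes A :: "complex ^ 'n ^ 'n"
  assumes "poly (charpoly A) \<mu> = 0"
  obtains z where "z \<noteq> 0" "transpose A *v z = \<mu> *s z"
proof -
  let ?N = "(\<chi> i j. (if i = j then \<mu> else 0) - A $ i $ j) :: complex ^ 'n ^ 'n"
  have "det (transpose ?N) = 0" using assms by (simp add: charpoly_eval)
  then have "\<not> invertible (transpose ?N)" by (simp add: invertible_det_nz)
  then obtain z where z: "transpose ?N *v z = 0" "z \<noteq> 0"
    using matrix_left_invertible_ker[of "transpose ?N"] invertible_left_inverse by blast
  have "transpose ?N *v z = \<mu> *s z - transpose A *v z"
    by (simp add: vec_eq_iff matrix_vector_mult_def transpose_def left_diff_distrib
        sum_subtractf if_distrib[of "\<lambda>x. x * _"] cong: if_cong)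
  with z that show ?thesis by simp
qed

text \<open>
  Peeling off one factor \<open>C - \<mu>\<close> expresses \<open>C ^^ j\<close> on \<open>w\<close> through the powers of \<open>\<mu>\<close> and the
  iterates of \<open>(C - \<mu>) w\<close>. Each factor of modulus at most \<open>r\<close> costs one summation, hence one
  power of \<open>j\<close>; the first factor gives the pure exponential.
\<close>

lemma matrix_power_growth:
  fixes C :: "complex ^ 'n ^ 'n"
  assumes r: "0 < r" and \<mu>: "\<And>x. x \<in> set \<mu>s \<Longrightarrow> cmod x \<le> r"
  shows "\<exists>K\<ge>0. \<forall>w j. poly_action C (\<Prod>x\<leftarrow>\<mu>s. [:-x, 1:]) w = 0 \<longrightarrow>
    norm (((*v) C ^^ j) w) \<le> K * real (Suc j) ^ (length \<mu>s - 1) * r ^ j * norm w"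
  using \<mu>
proof (induction \<mu>s)
  case Nil
  have "((*v) C ^^ j) 0 = 0" for j by (induction j) simp_all
  then show ?case by (intro exI[of _ 0]) auto
next
  case (Cons x \<mu>s)
  let ?Q = "\<Prod>x\<leftarrow>\<mu>s. [:-x, 1:]" and ?D = "\<lambda>w. C *v w - x *s w"
  obtain K where K: "K \<ge> 0" "\<And>w j. poly_action C ?Q w = 0 \<Longrightarrow>
      norm (((*v) C ^^ j) w) \<le> K * real (Suc j) ^ (length \<mu>s - 1) * r ^ j * norm w"
    using Cons by (metis list.set_intros(2))
  have xr: "cmod x \<le> r" using Cons by simp
  have nsm: "norm (c *s v) = cmod c * norm v" for c and v :: "complex ^ 'n"
    by (simp add: norm_vec_def norm_mult L2_set_right_distrib)
  have blC: "bounded_linear ((*v) C)" by simp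
  then obtain K1 where K1: "K1 \<ge> 0" "\<And>w. norm (C *v w) \<le> norm w * K1"
    using bounded_linear.nonneg_bounded by blast
  define K2 where "K2 = K1 + r"
  have K2: "norm (?D w) \<le> K2 * norm w" for w
    using norm_triangle_ineq4[of "C *v w" "x *s w"] K1(2)[of w] mult_right_mono[OF xr, of "norm w"]
    by (simp add: nsm K2_def algebra_simps)
  have K2_0: "K2 \<ge> 0" using K1 r by (simp add: K2_def)
  have step: "norm (((*v) C ^^ j) w) \<le> r ^ j * norm w
      + (\<Sum>i<j. r ^ (j - 1 - i) * norm (((*v) C ^^ i) (?D w)))" for j w
  proof (induction j)
    case (Suc j)
    have "((*v) C ^^ Suc j) w = ((*v) C ^^ j) (C *v w)" by (simp add: funpow_swap1)
    also have "C *v w = ?D w + x *s w" by simp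
    also have "((*v) C ^^ j) (?D w + x *s w) = ((*v) C ^^ j) (?D w) + x *s ((*v) C ^^ j) w"
      by (induction j) (simp_all add: matrix_vector_right_distrib matrix_vector_scale)
    finally have "norm (((*v) C ^^ Suc j) w)
        \<le> norm (((*v) C ^^ j) (?D w)) + cmod x * norm (((*v) C ^^ j) w)"
      by (metis norm_triangle_ineq nsm)
    also have "\<dots> \<le> norm (((*v) C ^^ j) (?D w)) + r * norm (((*v) C ^^ j) w)"
      using xr by (intro add_left_mono mult_right_mono) auto
    also have "\<dots> \<le> norm (((*v) C ^^ j) (?D w)) + r * (r ^ j * norm w
      + (\<Sum>i<j. r ^ (j - 1 - i) * norm (((*v) C ^^ i) (?D w))))"
      using r Suc.IH by (intro add_left_mono mult_left_mono) auto
    also have "\<dots> = r ^ Suc j * norm w + norm (((*v) C ^^ j) (?D w)) +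
        (\<Sum>i<j. r * r ^ (j - 1 - i) * norm (((*v) C ^^ i) (?D w)))"
      by (simp add: algebra_simps sum_distrib_left)
    also have "(\<Sum>i<j. r * r ^ (j - 1 - i) * norm (((*v) C ^^ i) (?D w)))
       = (\<Sum>i<j. r ^ (Suc j - 1 - i) * norm (((*v) C ^^ i) (?D w)))"
    proof (rule sum.cong[OF refl])
      fix i assume "i \<in> {..<j}"
      then have "Suc j - 1 - i = Suc (j - 1 - i)" by auto
      then show "r * r ^ (j - 1 - i) * norm (((*v) C ^^ i) (?D w))
        = r ^ (Suc j - 1 - i) * norm (((*v) C ^^ i) (?D w))" by (metis power_Suc)
    qed
    finally show ?case by simp
  qed simp
  define K' where "K' = 1 + K * K2 / r"
  have K'0: "K' \<ge> 0" using K K2_0 r by (simp add: K'_def)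
  have main: "norm (((*v) C ^^ j) w) \<le> K' * real (Suc j) ^ length \<mu>s * r ^ j * norm w"
    if w: "poly_action C (\<Prod>x\<leftarrow>x # \<mu>s. [:-x, 1:]) w = 0" for j w
  proof -
    have PD: "poly_action C [:-x, 1:] w = ?D w" by (simp add: vec_eq_iff)
    have D0: "poly_action C ?Q (?D w) = 0"
    proof -
      have "(\<Prod>x\<leftarrow>x # \<mu>s. [:-x, 1:]) = ?Q * [:-x, 1:]" by (simp add: mult.commute)
      then have "poly_action C ?Q (poly_action C [:-x, 1:] w) = 0"
        using w by (simp only: poly_action_mult)
      then show ?thesis by (simp only: PD)
    qed
    let ?d = "length \<mu>s - 1"
    have "(\<Sum>i<j. r ^ (j - 1 - i) * norm (((*v) C ^^ i) (?D w)))
       \<le> (\<Sum>i<j. K * K2 / r * real (Suc j) ^ ?d * r ^ j * norm w)"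
    proof (rule sum_mono)
      fix i assume "i \<in> {..<j}"
      then have ij: "i < j" by simp
      have "r ^ (j - 1 - i) * norm (((*v) C ^^ i) (?D w))
         \<le> r ^ (j - 1 - i) * (K * real (Suc i) ^ ?d * r ^ i * norm (?D w))"
        using r K(2)[OF D0, of i] by (intro mult_left_mono) auto
      also have "\<dots> \<le> r ^ (j - 1 - i) * (K * real (Suc j) ^ ?d * r ^ i * (K2 * norm w))"
        using r K ij K2 by (intro mult_left_mono mult_mono power_mono mult_nonneg_nonneg) auto
      also have "\<dots> = K * K2 * real (Suc j) ^ ?d * (r ^ (j - 1 - i) * r ^ i) * norm w"
        by simp
      also have "r ^ (j - 1 - i) * r ^ i = r ^ j / r"
      proof -
        have "r ^ j = r ^ (j - 1 - i) * r ^ i * r"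
          using ij by (simp flip: power_add power_Suc2)
        with r show ?thesis by simp
      qed
      finally show "r ^ (j - 1 - i) * norm (((*v) C ^^ i) (?D w))
         \<le> K * K2 / r * real (Suc j) ^ ?d * r ^ j * norm w" by (simp add: ac_simps)
    qed
    also have "\<dots> = K * K2 / r * (real j * real (Suc j) ^ ?d) * r ^ j * norm w" by simp
    finally have s: "(\<Sum>i<j. r ^ (j - 1 - i) * norm (((*v) C ^^ i) (?D w)))
       \<le> K * K2 / r * (real j * real (Suc j) ^ ?d) * r ^ j * norm w" .
    show ?thesis
    proof (cases \<mu>s)
      case Nil
      then have "?D w = 0" using D0 by simp
      moreover have "((*v) C ^^ i) 0 = 0" for i by (induction i) simp_all
      ultimately have "norm (((*v) C ^^ j) w) \<le> r ^ j * norm w" using step[of j w] by simp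
      also have "\<dots> \<le> K' * (r ^ j * norm w)"
        using K K2_0 r by (intro mult_right_mono[of 1 K', simplified]) (auto simp: K'_def)
      finally show ?thesis using Nil by simp
    next
      case (Cons y ys)
      have "real j * real (Suc j) ^ ?d \<le> real (Suc j) * real (Suc j) ^ ?d"
        by (intro mult_right_mono) auto
      also have "\<dots> = real (Suc j) ^ length \<mu>s" using Cons by simp
      finally have a: "real j * real (Suc j) ^ ?d \<le> real (Suc j) ^ length \<mu>s" .
      have b: "1 \<le> real (Suc j) ^ length \<mu>s" by (rule one_le_power) simp
      have "norm (((*v) C ^^ j) w) \<le> 1 * r ^ j * norm w
          + K * K2 / r * (real j * real (Suc j) ^ ?d) * r ^ j * norm w" using step[of j w] s by simp
      also have "\<dots> \<le> real (Suc j) ^ length \<mu>s * r ^ j * norm w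
          + K * K2 / r * real (Suc j) ^ length \<mu>s * r ^ j * norm w"
        using a b K K2_0 r by (intro add_mono mult_right_mono mult_left_mono) auto
      finally show ?thesis by (simp add: K'_def algebra_simps)
    qed
  qed
  show ?case using K'0 main by (intro exI[of _ K']) auto
qed

section \<open>Positive matrices\<close>

text \<open>
  The entrywise ratios of \<open>x j\<close> to \<open>y j\<close> are averages of the ratios at \<open>j + 1\<close>, with weights bounded
  below by a constant: having one positive preimage already makes the entries of \<open>y (j + 1)\<close>
  comparable. The oscillation of the ratios therefore shrinks by a fixed factor at each step
  downwards from \<open>j\<close> to \<open>0\<close>. As it stays bounded when \<open>j\<close> grows, it is zero at \<open>0\<close>.
\<close>
lemma positive_sequences_proportional:
  fixes A :: "real ^ 'n ^ 'n" and x y :: "nat \<Rightarrow> real ^ 'n"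
  assumes A: "\<And>i j. 0 < A $ i $ j"
    and x: "\<And>j a. 0 < x j $ a" "\<And>j. x j = A *v x (Suc j)"
    and y: "\<And>j a. 0 < y j $ a" "\<And>j. y j = A *v y (Suc j)"
  obtains c where "0 < c" "x 0 = c *s y 0"
proof -
  define \<alpha> where "\<alpha> = Min (range (\<lambda>(i, j). A $ i $ j))"
  define \<beta> where "\<beta> = Max (range (\<lambda>(i, j). A $ i $ j))"
  have "\<alpha> \<in> range (\<lambda>(i, j). A $ i $ j)" unfolding \<alpha>_def by (rule Min_in) auto
  then have \<alpha>0: "0 < \<alpha>" using A by auto
  have \<alpha>: "\<alpha> \<le> A $ i $ j" for i j
    unfolding \<alpha>_def by (rule Min_le) (auto intro: image_eqI[of _ _ "(i, j)"])
  have \<beta>: "A $ i $ j \<le> \<beta>" for i j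
    unfolding \<beta>_def by (rule Max_ge) (auto intro: image_eqI[of _ _ "(i, j)"])
  have \<beta>0: "0 < \<beta>" using A[of undefined undefined] \<beta>[of undefined undefined] by linarith
  define K where "K = \<beta> / \<alpha>"
  have K0: "0 < K" using \<alpha>0 \<beta>0 by (simp add: K_def)
  have comp: "z j $ a \<le> K * z j $ b"
    if z: "\<And>j a. 0 < z j $ a" "\<And>j. z j = A *v z (Suc j)" for z :: "nat \<Rightarrow> real ^ 'n" and j a b
  proof -
    have "z j $ a = (\<Sum>c\<in>UNIV. A $ a $ c * z (Suc j) $ c)"
      by (subst z(2)) (simp add: matrix_vector_mult_def)
    also have "\<dots> \<le> (\<Sum>c\<in>UNIV. \<beta> * z (Suc j) $ c)"
      by (intro sum_mono mult_right_mono \<beta> less_imp_le z(1))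
    also have "\<dots> = K * (\<Sum>c\<in>UNIV. \<alpha> * z (Suc j) $ c)"
      using \<alpha>0 by (simp add: K_def sum_distrib_left mult.assoc[symmetric])
    also have "\<dots> \<le> K * (\<Sum>c\<in>UNIV. A $ b $ c * z (Suc j) $ c)"
      using K0 by (intro mult_left_mono sum_mono mult_right_mono \<alpha>) (auto intro: less_imp_le z(1))
    also have "(\<Sum>c\<in>UNIV. A $ b $ c * z (Suc j) $ c) = z j $ b"
      by (subst (2) z(2)) (simp add: matrix_vector_mult_def)
    finally show ?thesis .
  qed
  note cx = comp[of x, OF x] and cy = comp[of y, OF y]
  define q where "q j a = x j $ a / y j $ a" for j a
  define m where "m j = Min (range (q j))" for j
  define M where "M j = Max (range (q j))" for j
  have q0: "0 < q j a" for j a using x(1) y(1) by (simp add: q_def)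
  have mq: "m j \<le> q j a" for j a unfolding m_def by (rule Min_le) auto
  have Mq: "q j a \<le> M j" for j a unfolding M_def by (rule Max_ge) auto
  have min: "\<exists>a. m j = q j a" for j
  proof -
    have "m j \<in> range (q j)" unfolding m_def by (rule Min_in) auto
    then show ?thesis by blast
  qed
  have max: "\<exists>a. M j = q j a" for j
  proof -
    have "M j \<in> range (q j)" unfolding M_def by (rule Max_in) auto
    then show ?thesis by blast
  qed
  define \<epsilon> where "\<epsilon> = \<alpha> / (\<beta> * real CARD('n) * K)"
  have \<epsilon>0: "0 < \<epsilon>" using \<alpha>0 \<beta>0 K0 by (simp add: \<epsilon>_def)
  define w where "w j a b = A $ a $ b * y (Suc j) $ b / y j $ a" for j a b
  have yj: "y j $ a = (\<Sum>c\<in>UNIV. A $ a $ c * y (Suc j) $ c)" for j a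
    by (subst y(2)) (simp add: matrix_vector_mult_def)
  have xj: "x j $ a = (\<Sum>c\<in>UNIV. A $ a $ c * x (Suc j) $ c)" for j a
    by (subst x(2)) (simp add: matrix_vector_mult_def)
  have w1: "(\<Sum>b\<in>UNIV. w j a b) = 1" for j a
    using y(1)[of j a] unfolding w_def sum_divide_distrib[symmetric] yj[symmetric] by simp
  have wq: "q j a = (\<Sum>b\<in>UNIV. w j a b * q (Suc j) b)" for j a
  proof -
    have "w j a b * q (Suc j) b = A $ a $ b * x (Suc j) $ b / y j $ a" for b
      using y(1)[of "Suc j" b] by (simp add: w_def q_def)
    then show ?thesis by (simp add: q_def sum_divide_distrib[symmetric] xj[symmetric])
  qed
  have w\<epsilon>: "\<epsilon> \<le> w j a b" for j a b
  proof -
    have "y j $ a \<le> (\<Sum>c\<in>(UNIV::'n set). \<beta> * (K * y (Suc j) $ b))"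
      unfolding yj[of j a] by (rule sum_mono, rule mult_mono[OF \<beta> cy])
        (use \<beta>0 y(1) in \<open>auto simp: less_imp_le\<close>)
    then have "y j $ a \<le> \<beta> * real CARD('n) * K * y (Suc j) $ b" by (simp add: mult_ac)
    then have "\<epsilon> * y j $ a \<le> \<epsilon> * (\<beta> * real CARD('n) * K * y (Suc j) $ b)"
      using \<epsilon>0 by (intro mult_left_mono) auto
    also have "\<dots> = \<alpha> * y (Suc j) $ b" using \<beta>0 K0 by (simp add: \<epsilon>_def)
    also have "\<dots> \<le> A $ a $ b * y (Suc j) $ b"
      by (intro mult_right_mono \<alpha> less_imp_le[OF y(1)])
    finally show ?thesis using y(1)[of j a] by (simp add: w_def pos_le_divide_eq)
  qed
  have w0: "0 \<le> w j a b" for j a b using w\<epsilon>[of j a b] \<epsilon>0 by linarith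
  have low: "m (Suc j) + \<epsilon> * (M (Suc j) - m (Suc j)) \<le> q j a" for j a
  proof -
    obtain b where b: "M (Suc j) = q (Suc j) b" using max by blast
    have "\<epsilon> * (M (Suc j) - m (Suc j)) \<le> w j a b * (q (Suc j) b - m (Suc j))"
      using w\<epsilon> mq[of "Suc j" b] unfolding b by (intro mult_right_mono) auto
    also have "\<dots> \<le> (\<Sum>b\<in>UNIV. w j a b * (q (Suc j) b - m (Suc j)))"
      using w0 mq by (intro member_le_sum) auto
    also have "\<dots> = q j a - m (Suc j)"
      by (simp add: right_diff_distrib sum_subtractf wq[symmetric] sum_distrib_right[symmetric] w1)
    finally show ?thesis by simp
  qed
  have up: "q j a \<le> M (Suc j)" for j a
  proof -
    have "q j a \<le> (\<Sum>b\<in>UNIV. w j a b * M (Suc j))"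
      unfolding wq[of j a] by (intro sum_mono mult_left_mono Mq w0)
    then show ?thesis by (simp add: sum_distrib_right[symmetric] w1)
  qed
  have osc: "M j - m j \<le> (1 - \<epsilon>) * (M (Suc j) - m (Suc j))" for j
  proof -
    obtain a b where "M j = q j a" "m j = q j b" using min max by metis
    then show ?thesis using low[of j b] up[of j a] by (simp add: algebra_simps)
  qed
  have osc0: "0 \<le> M j - m j" for j using mq[of j undefined] Mq[of j undefined] by linarith
  have mdec: "m (Suc j) \<le> m j" for j
  proof -
    obtain b where "m j = q j b" using min by blast
    then show ?thesis
      using low[of j b] mult_nonneg_nonneg[OF less_imp_le[OF \<epsilon>0] osc0[of "Suc j"]] by linarith
  qed
  have m0: "m j \<le> m 0" for j by (induction j) (use mdec order_trans in auto)
  have "(\<Sum>b\<in>(UNIV::'n set). \<epsilon>) \<le> (\<Sum>b\<in>UNIV. w 0 undefined b)" by (rule sum_mono) (rule w\<epsilon>)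
  then have "real CARD('n) * \<epsilon> \<le> 1" by (simp add: w1)
  moreover have "1 * \<epsilon> \<le> real CARD('n) * \<epsilon>"
    using \<epsilon>0 by (intro mult_right_mono) (auto simp: Suc_leI)
  ultimately have \<epsilon>1: "\<epsilon> \<le> 1" by linarith
  have MK: "M j \<le> K * K * m 0" for j
  proof -
    obtain a b where ab: "M j = q j a" "m j = q j b" using min max by metis
    have "q j a \<le> (K * x j $ b) / (y j $ b / K)"
      unfolding q_def using cx[of j a b] cy[of j b a] x(1) y(1) K0
      by (intro frac_le) (auto simp: field_simps less_imp_le)
    also have "\<dots> = K * K * q j b" by (simp add: q_def)
    also have "\<dots> \<le> K * K * m 0" using m0[of j] K0 ab by (intro mult_left_mono) auto
    finally show ?thesis using ab by simp
  qed
  have bd: "M 0 - m 0 \<le> (1 - \<epsilon>) ^ j * (M j - m j)" for j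
  proof (induction j)
    case (Suc j)
    have "(1 - \<epsilon>) ^ j * (M j - m j) \<le> (1 - \<epsilon>) ^ j * ((1 - \<epsilon>) * (M (Suc j) - m (Suc j)))"
      using \<epsilon>1 osc by (intro mult_left_mono) auto
    with Suc show ?case by (simp add: mult_ac)
  qed simp
  have m_pos: "0 < m j" for j using min[of j] q0 by metis
  have "M 0 - m 0 \<le> (1 - \<epsilon>) ^ j * (K * K * m 0)" for j
  proof -
    have "(1 - \<epsilon>) ^ j * (M j - m j) \<le> (1 - \<epsilon>) ^ j * (K * K * m 0)"
      using \<epsilon>1 MK[of j] m_pos[of j] by (intro mult_left_mono) auto
    with bd[of j] show ?thesis by linarith
  qed
  moreover have "(\<lambda>j. (1 - \<epsilon>) ^ j * (K * K * m 0)) \<longlonglongrightarrow> 0 * (K * K * m 0)"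
    using \<epsilon>0 \<epsilon>1 by (intro tendsto_mult LIMSEQ_realpow_zero tendsto_const) auto
  ultimately have "M 0 - m 0 \<le> 0 * (K * K * m 0)"
    by (intro LIMSEQ_le_const[of "\<lambda>j. (1 - \<epsilon>) ^ j * (K * K * m 0)"]) auto
  then have "M 0 \<le> m 0" by simp
  then have "q 0 a = m 0" for a using mq[of 0 a] Mq[of 0 a] by linarith
  then have "x 0 $ a = m 0 * y 0 $ a" for a
    using y(1)[of 0 a] by (simp add: q_def divide_eq_eq split: if_splits)
  then have "x 0 = m 0 *s y 0" by (simp add: vec_eq_iff)
  with that m_pos show thesis by blast
qed

definition complexify :: "real ^ 'n \<Rightarrow> complex ^ 'n" where
  "complexify w = (\<chi> i. complex_of_real (w $ i))"

lemma norm_complexify: "norm (complexify w) = norm w"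
  by (simp add: complexify_def norm_vec_def L2_set_def)

lemma complexify_funpow:
  fixes B :: "real ^ 'n ^ 'n"
  shows "((*v) (\<chi> i j. complex_of_real (B $ i $ j)) ^^ j) (complexify w) = complexify (((*v) B ^^ j) w)"
proof (induction j)
  case (Suc j)
  then show ?case by (simp add: complexify_def vec_eq_iff matrix_vector_mult_def)
qed simp

text \<open>
  A positive matrix with a positive eigenvector \<open>u\<close>. Weighting absolute values by \<open>u\<close> turns the
  triangle inequality for the transpose into an estimate of its whole spectrum by \<open>\<rho>\<close>, and equality
  in the triangle inequality shows that \<open>\<rho>\<close> has only one left eigenvector.
\<close>
locale perron =
  fixes A :: "real ^ 'n ^ 'n" and u :: "real ^ 'n" and \<rho> :: real
  assumes A: "\<And>i j. 0 < A $ i $ j" and u: "\<And>a. 0 < u $ a" and Au: "A *v u = \<rho> *s u"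
begin

definition Ac :: "complex ^ 'n ^ 'n" where "Ac = (\<chi> i j. complex_of_real (A $ i $ j))"

lemma Ac_transpose: "transpose Ac *v z = (\<chi> b. \<Sum>a\<in>UNIV. complex_of_real (A $ a $ b) * z $ a)"
  by (simp add: Ac_def transpose_def matrix_vector_mult_def)

lemma weighted_column_sum:
  "(\<Sum>b\<in>UNIV. u $ b * (\<Sum>a\<in>UNIV. A $ a $ b * t a)) = \<rho> * (\<Sum>a\<in>UNIV. u $ a * t a)"
proof -
  have "(\<Sum>b\<in>UNIV. u $ b * (\<Sum>a\<in>UNIV. A $ a $ b * t a))
    = (\<Sum>a\<in>UNIV. (A *v u) $ a * t a)"
    unfolding sum_distrib_left by (subst sum.swap)
      (simp add: matrix_vector_mult_def sum_distrib_left sum_distrib_right mult_ac)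
  then show ?thesis by (simp add: Au sum_distrib_left mult_ac)
qed

lemma eigenvalue_pos: "0 < \<rho>"
proof -
  have "0 < (A *v u) $ undefined"
    unfolding matrix_vector_mult_def by (simp add: sum_pos A u)
  then show ?thesis using u[of undefined] by (simp add: Au zero_less_mult_iff)
qed

lemma cmod_root_le:
  assumes "poly (charpoly Ac) \<mu> = 0"
  shows "cmod \<mu> \<le> \<rho>"
proof -
  obtain z where z: "z \<noteq> 0" "transpose Ac *v z = \<mu> *s z"
    using charpoly_root_left_eigenvector[OF assms] .
  have b: "cmod \<mu> * cmod (z $ b) \<le> (\<Sum>a\<in>UNIV. A $ a $ b * cmod (z $ a))" for b
  proof -
    have "\<mu> * z $ b = (\<Sum>a\<in>UNIV. complex_of_real (A $ a $ b) * z $ a)"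
      using arg_cong[OF z(2)[unfolded Ac_transpose], of "\<lambda>v. v $ b"] by simp
    then have "cmod \<mu> * cmod (z $ b) = cmod (\<Sum>a\<in>UNIV. complex_of_real (A $ a $ b) * z $ a)"
      by (metis norm_mult)
    also have "\<dots> \<le> (\<Sum>a\<in>UNIV. A $ a $ b * cmod (z $ a))"
      by (rule order_trans[OF norm_sum]) (simp add: norm_mult abs_of_pos A)
    finally show ?thesis .
  qed
  have "cmod \<mu> * (\<Sum>b\<in>UNIV. u $ b * cmod (z $ b))
     \<le> (\<Sum>b\<in>UNIV. u $ b * (\<Sum>a\<in>UNIV. A $ a $ b * cmod (z $ a)))"
    unfolding sum_distrib_left[of "cmod \<mu>"] mult.left_commute[of "cmod \<mu>"]
    by (intro sum_mono mult_left_mono b less_imp_le u)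
  also have "\<dots> = \<rho> * (\<Sum>b\<in>UNIV. u $ b * cmod (z $ b))" by (rule weighted_column_sum)
  finally have le: "cmod \<mu> * (\<Sum>b\<in>UNIV. u $ b * cmod (z $ b)) \<le> \<rho> * (\<Sum>b\<in>UNIV. u $ b * cmod (z $ b))" .
  obtain i where "z $ i \<noteq> 0" using z(1) by (auto simp: vec_eq_iff)
  then have "0 < (\<Sum>b\<in>UNIV. u $ b * cmod (z $ b))"
    using u by (intro sum_pos2[of _ i]) (auto simp: less_imp_le)
  with le show ?thesis by simp
qed

lemma root_eigenvalue: "poly (charpoly Ac) (complex_of_real \<rho>) = 0"
proof -
  let ?N = "(\<chi> i j. (if i = j then complex_of_real \<rho> else 0) - Ac $ i $ j) :: complex ^ 'n ^ 'n"
  have "(?N *v complexify u) $ i = complex_of_real (\<rho> * u $ i - (A *v u) $ i)" for i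
    by (simp add: Ac_def complexify_def matrix_vector_mult_def left_diff_distrib
        sum_subtractf if_distrib[of "\<lambda>x. x * _"] cong: if_cong)
  then have "?N *v complexify u = 0" by (simp add: Au vec_eq_iff)
  moreover have "complexify u \<noteq> 0"
    using u[of undefined] by (auto simp: complexify_def vec_eq_iff intro!: exI[of _ undefined])
  ultimately have "\<not> invertible ?N"
    using matrix_left_invertible_ker[of ?N] invertible_left_inverse by blast
  then show ?thesis by (simp add: charpoly_eval invertible_det_nz)
qed

text \<open>
  Summing \<open>\<rho> \<bar>x b\<bar> \<le> (\<Sum>a. A a b \<bar>x a\<bar>)\<close> against \<open>u\<close> gives an equality, so the triangle
  inequality is sharp in every coordinate. As all entries of \<open>A\<close> are positive, the entries of \<open>x\<close>
  then have a common sign, which is incompatible with orthogonality to \<open>u\<close> unless \<open>x = 0\<close>.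
\<close>
lemma real_left_eigenvector_zero:
  fixes x :: "'n \<Rightarrow> real"
  assumes x: "\<And>b. (\<Sum>a\<in>UNIV. A $ a $ b * x a) = \<rho> * x b" and ux: "(\<Sum>a\<in>UNIV. u $ a * x a) = 0"
  shows "x a = 0"
proof -
  define s where "s b = (\<Sum>a\<in>UNIV. A $ a $ b * \<bar>x a\<bar>)" for b
  have le: "\<rho> * \<bar>x b\<bar> \<le> s b" for b
  proof -
    have "\<rho> * \<bar>x b\<bar> = \<bar>\<Sum>a\<in>UNIV. A $ a $ b * x a\<bar>"
      unfolding x using eigenvalue_pos by (simp add: abs_mult)
    also have "\<dots> \<le> s b"
      unfolding s_def by (rule order_trans[OF sum_abs]) (simp add: abs_mult abs_of_pos A)
    finally show ?thesis .
  qed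
  have "(\<Sum>b\<in>UNIV. u $ b * (s b - \<rho> * \<bar>x b\<bar>)) = 0"
    using weighted_column_sum[of "\<lambda>a. \<bar>x a\<bar>"]
    by (simp add: s_def right_diff_distrib sum_subtractf sum_distrib_left mult_ac)
  then have "\<forall>b\<in>UNIV. u $ b * (s b - \<rho> * \<bar>x b\<bar>) = 0"
    using le u by (subst (asm) sum_nonneg_eq_0_iff) (auto simp: less_imp_le)
  then have eq: "s b = \<rho> * \<bar>x b\<bar>" for b using u[of b] by (metis eq_iff_diff_eq_0 less_irrefl mult_eq_0_iff UNIV_I)
  have sgn: "(\<forall>a. 0 \<le> \<sigma> * x a) \<Longrightarrow> x a = 0" if \<sigma>: "\<sigma> = 1 \<or> \<sigma> = -1" for \<sigma> :: real
  proof -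
    assume "\<forall>a. 0 \<le> \<sigma> * x a"
    moreover have "(\<Sum>a\<in>UNIV. u $ a * (\<sigma> * x a)) = \<sigma> * (\<Sum>a\<in>UNIV. u $ a * x a)"
      by (simp add: sum_distrib_left mult_ac)
    ultimately have "\<forall>a\<in>UNIV. u $ a * (\<sigma> * x a) = 0"
      using ux u by (subst sum_nonneg_eq_0_iff[symmetric]) (auto simp: less_imp_le)
    then have "u $ a * (\<sigma> * x a) = 0" by blast
    then show ?thesis using u[of a] \<sigma> by auto
  qed
  let ?b = "undefined :: 'n"
  define \<sigma> :: real where "\<sigma> = (if 0 \<le> x ?b then 1 else -1)"
  have \<sigma>1: "\<sigma> = 1 \<or> \<sigma> = -1" by (simp add: \<sigma>_def)
  have "(\<Sum>a\<in>UNIV. A $ a $ ?b * (\<bar>x a\<bar> - \<sigma> * x a)) = s ?b - \<sigma> * (\<rho> * x ?b)"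
    by (simp add: s_def right_diff_distrib sum_subtractf x[symmetric] sum_distrib_left mult.left_commute)
  also have "\<dots> = 0" by (simp add: eq \<sigma>_def)
  finally have "\<forall>a\<in>UNIV. A $ a $ ?b * (\<bar>x a\<bar> - \<sigma> * x a) = 0"
    using A \<sigma>1 by (subst (asm) sum_nonneg_eq_0_iff) (auto simp: less_imp_le)
  then have "\<bar>x a\<bar> = \<sigma> * x a" for a using A[of a ?b] by (metis eq_iff_diff_eq_0 less_irrefl mult_eq_0_iff UNIV_I)
  then have "\<forall>a. 0 \<le> \<sigma> * x a" by (metis abs_ge_zero)
  then show ?thesis using sgn \<sigma>1 by blast
qed

lemma left_eigenvector_zero:
  assumes z: "transpose Ac *v z = complex_of_real \<rho> *s z"
    and uz: "(\<Sum>a\<in>UNIV. complex_of_real (u $ a) * z $ a) = 0"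
  shows "z = 0"
proof -
  have c: "(\<Sum>a\<in>UNIV. complex_of_real (A $ a $ b) * z $ a) = complex_of_real \<rho> * z $ b" for b
    using arg_cong[OF z[unfolded Ac_transpose], of "\<lambda>v. v $ b"] by simp
  have "Re (z $ a) = 0" for a
    using real_left_eigenvector_zero[of "\<lambda>a. Re (z $ a)" a]
      arg_cong[OF c, of Re] arg_cong[OF uz, of Re] by simp
  moreover have "Im (z $ a) = 0" for a
    using real_left_eigenvector_zero[of "\<lambda>a. Im (z $ a)" a]
      arg_cong[OF c, of Im] arg_cong[OF uz, of Im] by simp
  ultimately show ?thesis by (simp add: vec_eq_iff complex_eq_iff)
qed

lemma poly_action_orthogonal:
  assumes "(\<Sum>a\<in>UNIV. complex_of_real (u $ a) * w $ a) = 0"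
  shows "(\<Sum>a\<in>UNIV. complex_of_real (u $ a) * poly_action (transpose Ac) q w $ a) = 0"
proof (induction q)
  case (pCons c q)
  let ?v = "poly_action (transpose Ac) q w"
  have "(\<Sum>b\<in>UNIV. complex_of_real (u $ b) * (transpose Ac *v ?v) $ b)
     = (\<Sum>a\<in>UNIV. complex_of_real ((A *v u) $ a) * ?v $ a)"
    unfolding Ac_transpose vec_lambda_beta sum_distrib_left by (subst sum.swap)
      (simp add: matrix_vector_mult_def sum_distrib_left sum_distrib_right mult_ac)
  also have "\<dots> = complex_of_real \<rho> * (\<Sum>a\<in>UNIV. complex_of_real (u $ a) * ?v $ a)"
    by (simp add: Au sum_distrib_left mult_ac)
  also have "\<dots> = 0" using pCons.IH by simp
  finally have 1: "(\<Sum>b\<in>UNIV. complex_of_real (u $ b) * (transpose Ac *v ?v) $ b) = 0" .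
  have "(\<Sum>a\<in>UNIV. complex_of_real (u $ a) * (c * w $ a))
      = c * (\<Sum>a\<in>UNIV. complex_of_real (u $ a) * w $ a)"
    by (simp add: sum_distrib_left mult_ac)
  then show ?case using 1 assms by (simp add: distrib_left sum.distrib)
qed simp

lemma charpoly_nonzero: "charpoly Ac \<noteq> 0"
proof
  assume "charpoly Ac = 0"
  then have "cmod (complex_of_real (\<rho> + 1)) \<le> \<rho>" by (intro cmod_root_le) simp
  then show False using eigenvalue_pos by simp
qed

lemma eigenvalues_Ac: "eigenvalues A = proots (charpoly Ac)"
  by (simp add: eigenvalues_def Ac_def)

lemma eigenvalue_in: "complex_of_real \<rho> \<in># eigenvalues A"
  using root_eigenvalue charpoly_nonzero by (simp add: eigenvalues_Ac)

text \<open>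
  On the hyperplane orthogonal to \<open>u\<close> the factor belonging to \<open>\<rho>\<close> can be cancelled from the
  characteristic polynomial: what the remaining factors produce from such a vector is a left
  eigenvector for \<open>\<rho>\<close> that is still orthogonal to \<open>u\<close>, hence zero. At most \<open>CARD('n) - 1\<close>
  factors remain, which makes the power of \<open>j\<close> at most \<open>CARD('n) - 2\<close>.
\<close>
theorem orthogonal_growth:
  assumes r: "0 < r" and gap: "\<And>\<mu>. \<mu> \<in># eigenvalues A - {#complex_of_real \<rho>#} \<Longrightarrow> cmod \<mu> \<le> r"
  shows "\<exists>K\<ge>0. \<forall>w j. (\<Sum>a\<in>UNIV. u $ a * w $ a) = 0 \<longrightarrow>
    norm (((*v) (transpose A) ^^ j) w) \<le> K * real (Suc j) ^ (CARD('n) - 2) * r ^ j * norm w"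
proof -
  obtain \<mu>s where \<mu>s: "mset \<mu>s = eigenvalues A - {#complex_of_real \<rho>#}" using ex_mset by blast
  let ?Q = "\<Prod>x\<leftarrow>\<mu>s. [:-x, 1:]"
  have eig: "eigenvalues A = add_mset (complex_of_real \<rho>) (mset \<mu>s)"
    using eigenvalue_in \<mu>s by simp
  define c where "c = lead_coeff (charpoly Ac)"
  have c0: "c \<noteq> 0" using charpoly_nonzero by (simp add: c_def)
  have fac: "charpoly Ac = smult c ([:-complex_of_real \<rho>, 1:] * ?Q)"
    using complex_poly_decompose_multiset[of "charpoly Ac"]
    by (simp add: c_def eigenvalues_Ac[symmetric] eig flip: mset_map prod_mset_prod_list)
  have "size (eigenvalues A) \<le> CARD('n)"
    using size_proots_le[of "charpoly Ac"] degree_charpoly_le[of Ac] by (simp add: eigenvalues_Ac)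
  then have len: "length \<mu>s - 1 \<le> CARD('n) - 2" using eig by simp
  have "cmod x \<le> r" if "x \<in> set \<mu>s" for x
    using gap that \<mu>s by (metis set_mset_mset)
  then obtain K where K: "K \<ge> 0" "\<And>w j. poly_action (transpose Ac) ?Q w = 0 \<Longrightarrow>
    norm (((*v) (transpose Ac) ^^ j) w) \<le> K * real (Suc j) ^ (length \<mu>s - 1) * r ^ j * norm w"
    using matrix_power_growth[OF r, of \<mu>s "transpose Ac"] by blast
  have "norm (((*v) (transpose A) ^^ j) w) \<le> K * real (Suc j) ^ (CARD('n) - 2) * r ^ j * norm w"
    if w: "(\<Sum>a\<in>UNIV. u $ a * w $ a) = 0" for w j
  proof -
    let ?w = "complexify w" and ?P = "poly_action (transpose Ac)"
    have uw: "(\<Sum>a\<in>UNIV. complex_of_real (u $ a) * ?w $ a) = 0"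
      using arg_cong[OF w, of complex_of_real] by (simp add: complexify_def)
    let ?z = "?P ?Q ?w"
    have "c *s ?P [:-complex_of_real \<rho>, 1:] ?z = 0"
      using Cayley_Hamilton_transpose[of Ac ?w] unfolding fac
      by (simp only: poly_action_smult poly_action_mult)
    then have "?P [:-complex_of_real \<rho>, 1:] ?z = 0" using c0 by (simp add: vec_eq_iff)
    then have "transpose Ac *v ?z = complex_of_real \<rho> *s ?z"
      by (simp add: vec_eq_iff)
    then have z0: "?z = 0" using left_eigenvector_zero poly_action_orthogonal[OF uw] by blast
    have "transpose Ac = (\<chi> i j. complex_of_real (transpose A $ i $ j))"
      by (simp add: Ac_def transpose_def)
    then have "norm (((*v) (transpose A) ^^ j) w) = norm (((*v) (transpose Ac) ^^ j) ?w)"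
      by (simp add: complexify_funpow norm_complexify)
    also have "\<dots> \<le> K * real (Suc j) ^ (length \<mu>s - 1) * r ^ j * norm ?w" by (rule K(2)[OF z0])
    also have "\<dots> \<le> K * real (Suc j) ^ (CARD('n) - 2) * r ^ j * norm ?w"
      using K(1) r len by (intro mult_right_mono mult_left_mono power_increasing) auto
    finally show ?thesis by (simp add: norm_complexify)
  qed
  with K(1) show ?thesis by blast
qed

text \<open>
  Zero eigenvalues enter the list of exponents as \<open>ln 0 = 0\<close>. They do no harm, because the first
  exponent is positive and the second one is at least \<open>0\<close>.
\<close>
theorem exponents_and_growth:
  assumes L: "L = rev (sorted_list_of_multiset (image_mset (\<lambda>z. ln (cmod z)) (eigenvalues A)))"
    and \<theta>: "0 \<le> L ! 1" "L ! 1 < L ! 0"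
  shows "\<rho> = exp (L ! 0)"
    and "\<exists>K\<ge>0. \<forall>w j. (\<Sum>a\<in>UNIV. u $ a * w $ a) = 0 \<longrightarrow>
      norm (((*v) (transpose A) ^^ j) w) \<le> K * real (Suc j) ^ (CARD('n) - 2) * exp (L ! 1) ^ j * norm w"
proof -
  have mL: "mset L = image_mset (\<lambda>z. ln (cmod z)) (eigenvalues A)" by (simp add: L)
  have sL: "sorted_wrt (\<ge>) L" by (simp add: L sorted_wrt_rev)
  have in_L: "ln \<rho> \<in> set L"
    using eigenvalue_in eigenvalue_pos mL by (force simp flip: set_mset_mset)
  then obtain l L' where L': "L = l # L'" by (cases L) auto
  have le0: "x \<le> L ! 0" if "x \<in> set L" for x
    using that sL L' by auto
  have "L ! 0 \<in> set L" using in_L by (cases L) auto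
  then obtain \<mu> where \<mu>: "\<mu> \<in># eigenvalues A" "L ! 0 = ln (cmod \<mu>)"
    using mL by (auto simp flip: set_mset_mset)
  have "\<mu> \<noteq> 0" using \<mu> \<theta> by auto
  moreover have "cmod \<mu> \<le> \<rho>" using \<mu>(1) charpoly_nonzero by (intro cmod_root_le) (simp add: eigenvalues_Ac)
  ultimately have "L ! 0 \<le> ln \<rho>" unfolding \<mu>(2) by (intro ln_mono) auto
  with le0[OF in_L] have L0: "L ! 0 = ln \<rho>" by simp
  then show "\<rho> = exp (L ! 0)" using eigenvalue_pos by simp
  define g where "g = (\<lambda>z. ln (cmod z))"
  have g\<rho>: "g (complex_of_real \<rho>) = ln \<rho>" using eigenvalue_pos by (simp add: g_def)
  have "add_mset (ln \<rho>) (mset L') = image_mset g (eigenvalues A)"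
    using mL L0 unfolding g_def by (simp add: L')
  also have "\<dots> = image_mset g (add_mset (complex_of_real \<rho>) (eigenvalues A - {#complex_of_real \<rho>#}))"
    using eigenvalue_in by simp
  also have "\<dots> = add_mset (ln \<rho>) (image_mset g (eigenvalues A - {#complex_of_real \<rho>#}))"
    by (simp only: image_mset_add_mset g\<rho>)
  finally have mL': "mset L' = image_mset (\<lambda>z. ln (cmod z)) (eigenvalues A - {#complex_of_real \<rho>#})"
    by (simp only: add_mset_add_mset_same_iff g_def)
  have sL': "sorted_wrt (\<ge>) L'" using sL L' by simp
  have gap: "cmod \<mu> \<le> exp (L ! 1)" if "\<mu> \<in># eigenvalues A - {#complex_of_real \<rho>#}" for \<mu>
  proof (cases "\<mu> = 0")
    case False
    have "ln (cmod \<mu>) \<in> set L'" using that mL' by (auto simp flip: set_mset_mset)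
    then have "ln (cmod \<mu>) \<le> L' ! 0" using sL' by (cases L') auto
    also have "L' ! 0 = L ! 1" by (simp add: L')
    finally have "exp (ln (cmod \<mu>)) \<le> exp (L ! 1)" by simp
    then show ?thesis using False by simp
  qed simp
  show "\<exists>K\<ge>0. \<forall>w j. (\<Sum>a\<in>UNIV. u $ a * w $ a) = 0 \<longrightarrow>
      norm (((*v) (transpose A) ^^ j) w) \<le> K * real (Suc j) ^ (CARD('n) - 2) * exp (L ! 1) ^ j * norm w"
    by (rule orthogonal_growth) (use gap in auto)
qed

end

section \<open>One Rauzy step\<close>

text \<open>
  The part of validity that determines the exchange map and that a Rauzy step preserves by construction.
\<close>
definition admissible :: "'a::finite iet_data \<Rightarrow> bool" where
  "admissible D \<longleftrightarrow>
     bij_betw (pi0 D) UNIV {1..CARD('a)} \<and>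
     bij_betw (pi1 D) UNIV {1..CARD('a)} \<and>
     (\<forall>a. 0 < lam D $ a)"

lemma iet_valid_imp_admissible: "iet_valid D \<Longrightarrow> admissible D"
  by (simp add: iet_valid_def admissible_def)

abbreviation exchanged :: "'a::finite iet_data \<Rightarrow> 'a \<Rightarrow> real set" where
  "exchanged D \<equiv> subinterval (pi0 D) (lam D)"

abbreviation base :: "'a::finite iet_data \<Rightarrow> real set" where
  "base D \<equiv> {0..<total_length D}"

lemma admissible_iet_eq:
  assumes "admissible D" "x \<in> exchanged D a"
  shows "iet D x = x - left_end (pi0 D) (lam D) a + left_end (pi1 D) (lam D) a"
proof -
  have "inj (pi0 D)" and pos: "\<And>b. 0 < lam D $ b"
    using assms(1) pos_bij(1)[of "pi0 D"] unfolding admissible_def by auto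
  from subinterval_unique[OF this] have "(THE a. x \<in> exchanged D a) = a"
    using assms(2) by (intro the_equality) auto
  then show ?thesis unfolding iet_def by simp
qed

lemma iet_in_image_interval:
  assumes "admissible D" "x \<in> exchanged D a"
  shows "iet D x \<in> subinterval (pi1 D) (lam D) a"
  using admissible_iet_eq[OF assms] assms(2) unfolding subinterval_def by auto

lemma exchanged_subset_base:
  assumes "admissible D"
  shows "exchanged D a \<subseteq> base D"
  using subinterval_subset[of "lam D" "pi0 D" a] assms
  unfolding admissible_def total_length_def by auto

lemma exchanged_disjoint:
  assumes "admissible D" "x \<in> exchanged D a" "x \<in> exchanged D b"
  shows "a = b"
  using subinterval_unique[of "pi0 D" "lam D" x a b] assms pos_bij(1)[of "pi0 D"]
  unfolding admissible_def by auto

lemma exchanged_cover: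
  assumes "admissible D" "x \<in> base D"
  obtains a where "x \<in> exchanged D a"
  using subinterval_cover[of "pi0 D" x "lam D"] assms
  unfolding admissible_def total_length_def by auto

lemma iet_maps_base:
  assumes "admissible D" "x \<in> base D"
  shows "iet D x \<in> base D"
proof -
  obtain a where a: "x \<in> exchanged D a" using exchanged_cover[OF assms] .
  have "subinterval (pi1 D) (lam D) a \<subseteq> base D"
    using assms(1) unfolding total_length_def admissible_def by (intro subinterval_subset) auto
  with iet_in_image_interval[OF assms(1) a] show ?thesis by blast
qed

locale rauzy_step =
  fixes D :: "'a::finite iet_data"
  assumes adm: "admissible D" and defd: "rauzy_defined D"
begin

abbreviation "w \<equiv> winner D"
abbreviation "l \<equiv> loser D"

lemma winner_loser: "w \<noteq> l" "lam D $ l < lam D $ w"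
  using defd unfolding rauzy_defined_def winner_def loser_def by auto

lemma bijs:
  "bij_betw (pi0 D) UNIV {1..CARD('a)}" "bij_betw (pi1 D) UNIV {1..CARD('a)}"
  and pos: "0 < lam D $ b"
  using adm unfolding admissible_def by auto

lemma lam_rauzy: "lam (rauzy D) = (\<chi> c. if c = w then lam D $ c - lam D $ l else lam D $ c)"
  unfolding rauzy_def by simp

lemma last_ne: "last_symbol (pi0 D) \<noteq> last_symbol (pi1 D)"
  using defd unfolding rauzy_defined_def by auto

lemma adm_rauzy: "admissible (rauzy D)"
proof -
  have "bij_betw (pi0 (rauzy D)) UNIV {1..CARD('a)}" "bij_betw (pi1 (rauzy D)) UNIV {1..CARD('a)}"
    using move_last_bij[OF bijs(1), of w] move_last_bij[OF bijs(2), of w] bijs last_ne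
    unfolding rauzy_def winner_def by auto
  then show ?thesis using winner_loser pos by (simp add: admissible_def lam_rauzy)
qed

lemma total_length_rauzy: "total_length (rauzy D) = total_length D - lam D $ l"
proof -
  have "total_length (rauzy D) = (\<Sum>c\<in>UNIV. lam D $ c - (if c = w then lam D $ l else 0))"
    unfolding total_length_def lam_rauzy by (rule sum.cong) auto
  then show ?thesis unfolding total_length_def by (simp add: sum_subtractf)
qed

lemma base_rauzy_subset: "base (rauzy D) \<subseteq> base D"
  using total_length_rauzy pos[of l] by auto

lemma last_interval:
  "bij_betw \<pi> UNIV {1..CARD('a)} \<Longrightarrow>
    left_end \<pi> (lam D) (last_symbol \<pi>) = total_length D - lam D $ last_symbol \<pi>"
  using left_end_last[of \<pi> "lam D"] unfolding total_length_def by simp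

text \<open>
  The winner is the last symbol of exactly one of the two rows, and these two cases are
  mirror images: the loser interval is cut off from the winner interval either before or after
  applying the map.
\<close>

lemma type_cases:
  obtains (top) "w = last_symbol (pi0 D)" "l = last_symbol (pi1 D)" "w \<noteq> last_symbol (pi1 D)"
      "pi0 (rauzy D) = pi0 D" "pi1 (rauzy D) = move_last w (pi1 D)"
      "\<And>c. left_end (pi0 (rauzy D)) (lam (rauzy D)) c = left_end (pi0 D) (lam D) c"
      "\<And>c. c \<noteq> l \<Longrightarrow> left_end (pi1 (rauzy D)) (lam (rauzy D)) c = left_end (pi1 D) (lam D) c"
      "left_end (pi1 (rauzy D)) (lam (rauzy D)) l
        = left_end (pi1 D) (lam D) w + lam D $ w - lam D $ l"
  | (bottom) "w = last_symbol (pi1 D)" "l = last_symbol (pi0 D)" "w \<noteq> last_symbol (pi0 D)"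
      "pi1 (rauzy D) = pi1 D" "pi0 (rauzy D) = move_last w (pi0 D)"
      "\<And>c. left_end (pi1 (rauzy D)) (lam (rauzy D)) c = left_end (pi1 D) (lam D) c"
      "\<And>c. c \<noteq> l \<Longrightarrow> left_end (pi0 (rauzy D)) (lam (rauzy D)) c = left_end (pi0 D) (lam D) c"
      "left_end (pi0 (rauzy D)) (lam (rauzy D)) l
        = left_end (pi0 D) (lam D) w + lam D $ w - lam D $ l"
proof (cases "w = last_symbol (pi0 D)")
  case True
  then have lq: "l = last_symbol (pi1 D)" and wq: "w \<noteq> last_symbol (pi1 D)"
    using defd unfolding winner_def loser_def rauzy_defined_def by (auto split: if_splits)
  have p': "pi0 (rauzy D) = pi0 D" and q': "pi1 (rauzy D) = move_last w (pi1 D)"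
    using True unfolding rauzy_def by auto
  have "left_end (pi0 (rauzy D)) (lam (rauzy D)) c = left_end (pi0 D) (lam D) c" for c
    using left_end_fixed[OF bijs(1), of "\<lambda>c. lam D $ c - lam D $ l" "lam D" c] True p' lam_rauzy by simp
  note 1 = this
  note 2 = left_end_move_last[OF bijs(2) wq, where l = "lam D", folded lq, folded lam_rauzy, folded q']
  show ?thesis by (rule top[OF True lq wq p' q' 1 2])
next
  case False
  then have lp: "l = last_symbol (pi0 D)" and wp: "w \<noteq> last_symbol (pi0 D)" and wq: "w = last_symbol (pi1 D)"
    using defd unfolding winner_def loser_def rauzy_defined_def by (auto split: if_splits)
  have q': "pi1 (rauzy D) = pi1 D" and p': "pi0 (rauzy D) = move_last w (pi0 D)"
    using False unfolding rauzy_def by auto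
  have "left_end (pi1 (rauzy D)) (lam (rauzy D)) c = left_end (pi1 D) (lam D) c" for c
    using left_end_fixed[OF bijs(2), of "\<lambda>c. lam D $ c - lam D $ l" "lam D" c] wq q' lam_rauzy by simp
  note 1 = this
  note 2 = left_end_move_last[OF bijs(1) wp, where l = "lam D", folded lp, folded lam_rauzy, folded p']
  show ?thesis by (rule bottom[OF wq lp wp q' p' 1 2])
qed

lemma stay:
  assumes "a \<noteq> l" "x \<in> exchanged (rauzy D) a"
  shows "x \<in> exchanged D a" "iet (rauzy D) x = iet D x"
proof -
  have le: "left_end (pi0 (rauzy D)) (lam (rauzy D)) a = left_end (pi0 D) (lam D) a"
    and le1: "left_end (pi1 (rauzy D)) (lam (rauzy D)) a = left_end (pi1 D) (lam D) a"
    by (cases rule: type_cases; use assms(1) in simp)+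
  have "lam (rauzy D) $ a \<le> lam D $ a" using pos[of l] by (simp add: lam_rauzy)
  with assms(2) show x: "x \<in> exchanged D a" by (auto simp: subinterval_def le)
  show "iet (rauzy D) x = iet D x"
    unfolding admissible_iet_eq[OF adm x] admissible_iet_eq[OF adm_rauzy assms(2)] le le1 ..
qed

text \<open>
  On the new loser interval the return takes two steps, one of them through the old loser interval
  and the other through the end of the old winner interval. That the latter piece lies to the right
  of the new winner interval is what keeps monotone functions under control in
  \<open>tower_sum_increments\<close> below.
\<close>
lemma two_steps:
  obtains s where
    "\<And>x. x \<in> exchanged (rauzy D) l \<Longrightarrow> iet D x = x + s"
    "\<And>x. x \<in> exchanged (rauzy D) l \<Longrightarrow> x + s \<in> base D - base (rauzy D)"
    "\<And>x. x \<in> exchanged (rauzy D) l \<Longrightarrow> iet (rauzy D) x = iet D (x + s)"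
    "(\<forall>x \<in> exchanged (rauzy D) l. x \<in> exchanged D l \<and> x + s \<in> exchanged D w
        \<and> (\<forall>z \<in> exchanged (rauzy D) w. z < x + s))
     \<or> (\<forall>x \<in> exchanged (rauzy D) l. x \<in> exchanged D w \<and> x + s \<in> exchanged D l
        \<and> (\<forall>z \<in> exchanged (rauzy D) w. z < x))"
proof (cases rule: type_cases)
  case top
  define s where "s = total_length D - lam D $ l - left_end (pi0 D) (lam D) l"
  have lw: "left_end (pi0 D) (lam D) w = total_length D - lam D $ w"
    using last_interval[OF bijs(1)] top(1) by simp
  have ll: "left_end (pi1 D) (lam D) l = total_length D - lam D $ l"
    using last_interval[OF bijs(2)] top(2) by simp
  have lam_l: "lam (rauzy D) $ l = lam D $ l" using winner_loser by (simp add: lam_rauzy)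
  have main: "x \<in> exchanged D l \<and> iet D x = x + s \<and> x + s \<in> exchanged D w
      \<and> x + s \<in> base D - base (rauzy D) \<and> iet (rauzy D) x = iet D (x + s)"
    if x: "x \<in> exchanged (rauzy D) l" for x
  proof -
    have xl: "x \<in> exchanged D l" using x by (auto simp: subinterval_def top(6) lam_l)
    have 1: "iet D x = x + s" by (simp add: admissible_iet_eq[OF adm xl] ll s_def)
    have 2: "x + s \<in> exchanged D w"
      using xl winner_loser lw by (auto simp: subinterval_def s_def)
    have 3: "x + s \<in> base D - base (rauzy D)"
      using subsetD[OF exchanged_subset_base[OF adm] 2] xl
      by (auto simp: subinterval_def s_def total_length_rauzy)
    have "iet (rauzy D) x = iet D (x + s)"
      using admissible_iet_eq[OF adm 2] admissible_iet_eq[OF adm_rauzy x]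
      by (simp add: top(6,8) s_def lw)
    with xl 1 2 3 show ?thesis by blast
  qed
  have right: "z < x + s" if "x \<in> exchanged (rauzy D) l" "z \<in> exchanged (rauzy D) w" for x z
  proof -
    have "z < total_length (rauzy D)" using subsetD[OF exchanged_subset_base[OF adm_rauzy] that(2)] by auto
    moreover have "x + s \<in> base D - base (rauzy D)" using main[OF that(1)] by blast
    ultimately show ?thesis by auto
  qed
  show ?thesis by (rule that[of s]) (use main right in auto)
next
  case bottom
  define s where "s = total_length D - lam D $ w - left_end (pi0 D) (lam D) w"
  have lw: "left_end (pi1 D) (lam D) w = total_length D - lam D $ w"
    using last_interval[OF bijs(2)] bottom(1) by simp
  have ll: "left_end (pi0 D) (lam D) l = total_length D - lam D $ l"
    using last_interval[OF bijs(1)] bottom(2) by simp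
  have lam_l: "lam (rauzy D) $ l = lam D $ l" using winner_loser by (simp add: lam_rauzy)
  have main: "x \<in> exchanged D w \<and> iet D x = x + s \<and> x + s \<in> exchanged D l
      \<and> x + s \<in> base D - base (rauzy D) \<and> iet (rauzy D) x = iet D (x + s)"
    if x: "x \<in> exchanged (rauzy D) l" for x
  proof -
    have xl: "x \<in> exchanged D w" using x winner_loser by (auto simp: subinterval_def bottom(8) lam_l)
    have 1: "iet D x = x + s" by (simp add: admissible_iet_eq[OF adm xl] lw s_def)
    have 2: "x + s \<in> exchanged D l"
      using x ll by (auto simp: subinterval_def s_def bottom(8) lam_l)
    have 3: "x + s \<in> base D - base (rauzy D)"
      using subsetD[OF exchanged_subset_base[OF adm] 2] 2 ll
      by (auto simp: subinterval_def total_length_rauzy)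
    have "iet (rauzy D) x = iet D (x + s)"
      using admissible_iet_eq[OF adm 2] admissible_iet_eq[OF adm_rauzy x]
      by (simp add: bottom(6,8) s_def ll)
    with xl 1 2 3 show ?thesis by blast
  qed
  have right: "z < x" if "x \<in> exchanged (rauzy D) l" "z \<in> exchanged (rauzy D) w" for x z
  proof -
    have lam_w: "lam (rauzy D) $ w = lam D $ w - lam D $ l" by (simp add: lam_rauzy)
    show ?thesis
      using that winner_loser(1) by (auto simp: subinterval_def bottom(7,8) lam_l lam_w)
  qed
  show ?thesis by (rule that[of s]) (use main right in auto)
qed

lemma two_steps_iet:
  assumes "x \<in> exchanged (rauzy D) l"
  shows "iet D x \<in> base D - base (rauzy D)" "iet (rauzy D) x = iet D (iet D x)"
  by (rule two_steps, use assms in metis)+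

text \<open>
  The removed part lies in the interval of the last symbol of the first row. The image of that
  interval ends before the last interval of the second row, which is no shorter than the removed part.
\<close>
lemma removed_part_returns:
  assumes x: "x \<in> base D - base (rauzy D)"
  shows "iet D x \<in> base (rauzy D)"
proof -
  have end_le: "left_end (pi1 D) (lam D) a + lam D $ a \<le> left_end (pi1 D) (lam D) (last_symbol (pi1 D))"
    if "a \<noteq> last_symbol (pi1 D)" for a
  proof (rule left_end_le)
    show "pi1 D a < pi1 D (last_symbol (pi1 D))"
      using that pos_last_symbol[OF bijs(2)] pos_bij(3)[OF bijs(2), of a] le_neq_implies_less by metis
  qed (rule pos)
  have ge0: "0 \<le> iet D x" using iet_maps_base[OF adm, of x] x by auto
  show ?thesis
  proof (cases rule: type_cases)
    case top
    have "x \<in> exchanged D w"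
      using x last_interval[OF bijs(1)] top(1) winner_loser by (auto simp: subinterval_def total_length_rauzy)
    from iet_in_image_interval[OF adm this] have "iet D x < left_end (pi1 D) (lam D) w + lam D $ w"
      by (simp add: subinterval_def)
    also have "\<dots> \<le> total_length D - lam D $ l"
      using end_le[OF top(3)] last_interval[OF bijs(2)] top(2) by simp
    finally show ?thesis using ge0 by (simp add: total_length_rauzy)
  next
    case bottom
    have "x \<in> exchanged D l"
      using x last_interval[OF bijs(1)] bottom(2) by (auto simp: subinterval_def total_length_rauzy)
    from iet_in_image_interval[OF adm this] have "iet D x < left_end (pi1 D) (lam D) l + lam D $ l"
      by (simp add: subinterval_def)
    also have "\<dots> \<le> total_length D - lam D $ w"
      using end_le[of l] last_interval[OF bijs(2)] bottom(1) winner_loser(1) by simp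
    finally show ?thesis using ge0 winner_loser by (simp add: total_length_rauzy)
  qed
qed

end

section \<open>Birkhoff sums over the Rauzy towers\<close>

definition birkhoff_sum :: "('b \<Rightarrow> 'b) \<Rightarrow> ('b \<Rightarrow> 'c::comm_monoid_add) \<Rightarrow> nat \<Rightarrow> 'b \<Rightarrow> 'c" where
  "birkhoff_sum S g n x = (\<Sum>i<n. g ((S ^^ i) x))"

lemma birkhoff_sum_0 [simp]: "birkhoff_sum S g 0 x = 0"
  by (simp add: birkhoff_sum_def)

lemma birkhoff_sum_Suc: "birkhoff_sum S g (Suc n) x = g x + birkhoff_sum S g n (S x)"
  unfolding birkhoff_sum_def sum.lessThan_Suc_shift
  by (simp add: funpow_Suc_right del: funpow.simps(2))

text \<open>
  A Birkhoff sum can be regrouped along the return blocks of length one or two to \<open>J'\<close>; at most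
  the first and the last point of the orbit segment are not covered by full blocks.
\<close>

lemma birkhoff_sum_inducing:
  fixes g h g' h' :: "'b \<Rightarrow> real"
  assumes sub: "J' \<subseteq> J" and RJ: "R \<subseteq> J'"
    and S: "\<And>x. x \<in> J \<Longrightarrow> S x \<in> J" and S'J: "\<And>x. x \<in> J' \<Longrightarrow> S' x \<in> J'"
    and one: "\<And>x. x \<in> J' - R \<Longrightarrow> S' x = S x" and two: "\<And>x. x \<in> R \<Longrightarrow> S' x = S (S x)"
    and ret: "\<And>x. x \<in> J - J' \<Longrightarrow> S x \<in> J'"
    and g': "\<And>x. x \<in> J' \<Longrightarrow> g' x = g x + (if x \<in> R then g (S x) else 0)"
    and h': "\<And>x. x \<in> J' \<Longrightarrow> h' x = h x + (if x \<in> R then h (S x) else 0)"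
    and gG: "\<And>x. x \<in> J \<Longrightarrow> \<bar>g x\<bar> \<le> G" and h0: "\<And>x. x \<in> J \<Longrightarrow> 0 \<le> h x" and G0: "0 \<le> G"
    and x: "x \<in> J"
  shows "\<exists>x'\<in>J'. \<exists>n'. \<bar>birkhoff_sum S g n x - birkhoff_sum S' g' n' x'\<bar> \<le> 2 * G
    \<and> birkhoff_sum S' h' n' x' \<le> birkhoff_sum S h n x"
proof -
  have A: "\<exists>n'. \<bar>birkhoff_sum S g n x - birkhoff_sum S' g' n' x\<bar> \<le> G
    \<and> birkhoff_sum S' h' n' x \<le> birkhoff_sum S h n x" if "x \<in> J'" for n x
    using that
  proof (induction n arbitrary: x rule: less_induct)
    case (less n)
    have xJ: "x \<in> J" using less.prems sub by blast
    show ?case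
    proof (cases n)
      case 0
      then show ?thesis using G0 by (intro exI[of _ 0]) simp
    next
      case (Suc m)
      show ?thesis
      proof (cases "x \<in> R")
        case False
        then have eq: "S' x = S x" using one less.prems by blast
        have "S x \<in> J'" using S'J[OF less.prems] eq by simp
        from less.IH[OF _ this, of m] Suc obtain n' where
          "\<bar>birkhoff_sum S g m (S x) - birkhoff_sum S' g' n' (S x)\<bar> \<le> G"
          "birkhoff_sum S' h' n' (S x) \<le> birkhoff_sum S h m (S x)" by auto
        then show ?thesis
          by (intro exI[of _ "Suc n'"]) (simp add: Suc birkhoff_sum_Suc eq False g'[OF less.prems] h'[OF less.prems])
      next
        case True
        note R = this
        then have eq: "S' x = S (S x)" using two by blast
        show ?thesis
        proof (cases m)
          case 0
          then show ?thesis using gG[OF xJ] h0[OF xJ]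
            by (intro exI[of _ 0]) (simp add: Suc birkhoff_sum_Suc)
        next
          case (Suc k)
          have "S (S x) \<in> J'" using S'J[OF less.prems] eq by simp
          from less.IH[OF _ this, of k] \<open>n = Suc m\<close> Suc obtain n' where
            "\<bar>birkhoff_sum S g k (S (S x)) - birkhoff_sum S' g' n' (S (S x))\<bar> \<le> G"
            "birkhoff_sum S' h' n' (S (S x)) \<le> birkhoff_sum S h k (S (S x))" by auto
          then show ?thesis
            by (intro exI[of _ "Suc n'"])
              (simp add: \<open>n = Suc m\<close> Suc birkhoff_sum_Suc eq R g'[OF less.prems] h'[OF less.prems])
        qed
      qed
    qed
  qed
  show ?thesis
  proof (cases "x \<in> J'")
    case True
    from A[OF this, of n] obtain n' where "\<bar>birkhoff_sum S g n x - birkhoff_sum S' g' n' x\<bar> \<le> G"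
      "birkhoff_sum S' h' n' x \<le> birkhoff_sum S h n x" by blast
    then show ?thesis using True G0 by (intro bexI[of _ x] exI[of _ n']) auto
  next
    case False
    then have Sx: "S x \<in> J'" using ret x by blast
    show ?thesis
    proof (cases n)
      case 0
      then show ?thesis using Sx G0 by (intro bexI[of _ "S x"] exI[of _ 0]) auto
    next
      case (Suc m)
      from A[OF Sx, of m] obtain n' where
        "\<bar>birkhoff_sum S g m (S x) - birkhoff_sum S' g' n' (S x)\<bar> \<le> G"
        "birkhoff_sum S' h' n' (S x) \<le> birkhoff_sum S h m (S x)" by blast
      then show ?thesis using Sx gG[OF x] h0[OF x]
        by (intro bexI[of _ "S x"] exI[of _ n']) (auto simp: Suc birkhoff_sum_Suc)
    qed
  qed
qed

text \<open>
  On the base of the \<open>k\<close>-th induced map this is the sum of \<open>g\<close> along the orbit under \<^term>\<open>iet D\<close>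
  until the return to that base. It is built up one Rauzy step at a time, so that no return times
  have to be mentioned.
\<close>
primrec tower_sum :: "'a::finite iet_data \<Rightarrow> (real \<Rightarrow> real) \<Rightarrow> nat \<Rightarrow> real \<Rightarrow> real" where
  "tower_sum D g 0 x = g x"
| "tower_sum D g (Suc k) x = tower_sum D g k x +
    (if x \<in> exchanged ((rauzy ^^ Suc k) D) (loser ((rauzy ^^ k) D))
     then tower_sum D g k (iet ((rauzy ^^ k) D) x) else 0)"

lemma tower_sum_linear:
  "tower_sum D (\<lambda>x. g x - c * h x) k x = tower_sum D g k x - c * tower_sum D h k x"
  by (induction k arbitrary: x) (simp_all add: algebra_simps)

locale rauzy_iterates =
  fixes D :: "'a::finite iet_data"
  assumes adm0: "admissible D" and all_defined: "\<And>k. rauzy_defined ((rauzy ^^ k) D)"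
begin

abbreviation "DD k \<equiv> (rauzy ^^ k) D"

lemma adm_DD: "admissible (DD k)"
proof (induction k)
  case (Suc k)
  interpret rauzy_step "DD k" by unfold_locales (use Suc all_defined in auto)
  show ?case using adm_rauzy by simp
qed (simp add: adm0)

lemma step: "rauzy_step (DD k)"
  by unfold_locales (use adm_DD all_defined in auto)

lemma tower_sum_loser:
  "x \<in> exchanged (DD (Suc k)) (loser (DD k)) \<Longrightarrow>
    tower_sum D g (Suc k) x = tower_sum D g k x + tower_sum D g k (iet (DD k) x)"
  by simp

lemma tower_sum_other:
  assumes "x \<in> exchanged (DD (Suc k)) a" "a \<noteq> loser (DD k)"
  shows "tower_sum D g (Suc k) x = tower_sum D g k x"
  using exchanged_disjoint[OF adm_DD[of "Suc k"] assms(1), of "loser (DD k)"] assms by auto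

text \<open>
  The return times to the base of the \<open>k\<close>-th induced map, interval by interval; see
  \<open>tower_sum_one\<close>.
\<close>
definition height :: "nat \<Rightarrow> real ^ 'a" where
  "height k = transpose (Theta_prod D k) *v (\<chi> a. 1)"

lemma transpose_Theta_mult:
  "(transpose (Theta D') *v v) $ b = v $ b + (if b = loser D' then v $ winner D' else 0)"
proof -
  have "(transpose (Theta D') *v v) $ b = (\<Sum>i\<in>UNIV. Theta D' $ i $ b * v $ i)"
    unfolding matrix_vector_mult_def by (simp add: transpose_def)
  also have "\<dots> = (\<Sum>i\<in>UNIV. (if i = b then v $ i else 0)
      + (if i = winner D' then (if b = loser D' then v $ i else 0) else 0))"
    by (rule sum.cong) (auto simp: Theta_def mat_def)
  finally show ?thesis by (simp add: sum.distrib)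
qed

lemma height_Suc: "height (Suc k) = transpose (Theta (DD k)) *v height k"
  by (simp add: height_def matrix_transpose_mul matrix_vector_mul_assoc del: transpose_matrix_vector)

lemma tower_sum_one:
  "x \<in> exchanged (DD k) a \<Longrightarrow> tower_sum D (\<lambda>_. 1) k x = height k $ a"
proof (induction k arbitrary: x a)
  case 0
  then show ?case by (simp add: height_def)
next
  case (Suc k)
  interpret rauzy_step "DD k" by (rule step)
  show ?case
  proof (cases "a = l")
    case False
    then have "x \<in> exchanged (DD k) a" using stay(1) Suc.prems by simp
    with Suc.IH[OF this] show ?thesis
      by (simp add: tower_sum_other[OF Suc.prems False] height_Suc transpose_Theta_mult False
          del: transpose_matrix_vector tower_sum.simps)
  next
    case True
    obtain s where s: "\<And>x. x \<in> exchanged (rauzy (DD k)) l \<Longrightarrow> iet (DD k) x = x + s"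
      "(\<forall>x \<in> exchanged (rauzy (DD k)) l. x \<in> exchanged (DD k) l \<and> x + s \<in> exchanged (DD k) w)
     \<or> (\<forall>x \<in> exchanged (rauzy (DD k)) l. x \<in> exchanged (DD k) w \<and> x + s \<in> exchanged (DD k) l)"
      by (rule two_steps) blast
    have x: "x \<in> exchanged (rauzy (DD k)) l" using Suc.prems True by simp
    have "tower_sum D (\<lambda>_. 1) k x + tower_sum D (\<lambda>_. 1) k (iet (DD k) x) = height k $ l + height k $ w"
      using s(2) Suc.IH x unfolding s(1)[OF x] by fastforce
    then show ?thesis
      using tower_sum_loser[of x k "\<lambda>_. 1"] Suc.prems True
      by (simp add: height_Suc transpose_Theta_mult del: transpose_matrix_vector tower_sum.simps)
  qed
qed

lemma tower_sum_dominated: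
  assumes dom: "\<And>x y. x \<in> base D \<Longrightarrow> y \<in> base D \<Longrightarrow> x \<le> y \<Longrightarrow> \<bar>g y - g x\<bar> \<le> \<phi> y - \<phi> x"
  shows "x \<in> exchanged (DD k) a \<Longrightarrow> y \<in> exchanged (DD k) a \<Longrightarrow> x \<le> y \<Longrightarrow>
    \<bar>tower_sum D g k y - tower_sum D g k x\<bar> \<le> tower_sum D \<phi> k y - tower_sum D \<phi> k x"
proof (induction k arbitrary: x y a)
  case 0
  then have "x \<in> exchanged D a" "y \<in> exchanged D a" by auto
  then have "x \<in> base D" "y \<in> base D" using exchanged_subset_base[OF adm0] by blast+
  then show ?case using dom[of x y] 0 by simp
next
  case (Suc k)
  interpret rauzy_step "DD k" by (rule step)
  show ?case
  proof (cases "a = l")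
    case False
    then have "x \<in> exchanged (DD k) a" "y \<in> exchanged (DD k) a" using stay(1) Suc.prems by auto
    from Suc.IH[OF this] show ?thesis
      using Suc.prems by (simp add: tower_sum_other[OF _ False] del: tower_sum.simps)
  next
    case True
    obtain s where s: "\<And>x. x \<in> exchanged (rauzy (DD k)) l \<Longrightarrow> iet (DD k) x = x + s"
      "(\<forall>x \<in> exchanged (rauzy (DD k)) l. x \<in> exchanged (DD k) l \<and> x + s \<in> exchanged (DD k) w)
     \<or> (\<forall>x \<in> exchanged (rauzy (DD k)) l. x \<in> exchanged (DD k) w \<and> x + s \<in> exchanged (DD k) l)"
      by (rule two_steps) blast
    have x: "x \<in> exchanged (rauzy (DD k)) l" "y \<in> exchanged (rauzy (DD k)) l" using Suc.prems True by auto
    have "\<bar>tower_sum D g k y - tower_sum D g k x\<bar> \<le> tower_sum D \<phi> k y - tower_sum D \<phi> k x"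
      "\<bar>tower_sum D g k (y + s) - tower_sum D g k (x + s)\<bar>
        \<le> tower_sum D \<phi> k (y + s) - tower_sum D \<phi> k (x + s)"
      using s(2) Suc.IH[of x _ y] Suc.IH[of "x + s" _ "y + s"] x Suc.prems by auto
    then show ?thesis
      using tower_sum_loser[of x k] tower_sum_loser[of y k] Suc.prems True s(1)[OF x(1)] s(1)[OF x(2)]
      by (simp del: tower_sum.simps)
  qed
qed

text \<open>
  The total increment over one interval per tower cannot grow from one level to the next: the piece
  of the winner tower that is stacked on the loser tower lies to the right of what remains of the
  winner tower, so by monotonicity the two increments are part of one increment over the old tower.
\<close>
lemma tower_sum_increments:
  assumes dom: "\<And>x y. x \<in> base D \<Longrightarrow> y \<in> base D \<Longrightarrow> x \<le> y \<Longrightarrow> \<bar>g y - g x\<bar> \<le> \<phi> y - \<phi> x"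
    and \<phi>V: "\<And>x. x \<in> base D \<Longrightarrow> 0 \<le> \<phi> x \<and> \<phi> x \<le> V"
  shows "(\<And>a. x a \<in> exchanged (DD k) a) \<Longrightarrow> (\<And>a. y a \<in> exchanged (DD k) a) \<Longrightarrow> (\<And>a. x a \<le> y a) \<Longrightarrow>
    (\<Sum>a\<in>UNIV. tower_sum D \<phi> k (y a) - tower_sum D \<phi> k (x a)) \<le> real CARD('a) * V"
proof (induction k arbitrary: x y)
  case 0
  have "(\<Sum>a\<in>UNIV. \<phi> (y a) - \<phi> (x a)) \<le> (\<Sum>a\<in>(UNIV::'a set). V)"
  proof (rule sum_mono)
    fix a
    have "x a \<in> exchanged D a" "y a \<in> exchanged D a" using 0(1,2)[of a] by auto
    then have "x a \<in> base D" "y a \<in> base D" using exchanged_subset_base[OF adm0] by blast+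
    then show "\<phi> (y a) - \<phi> (x a) \<le> V" using \<phi>V[of "x a"] \<phi>V[of "y a"] by auto
  qed
  then show ?case by simp
next
  case (Suc k)
  interpret rauzy_step "DD k" by (rule step)
  let ?T = "tower_sum D \<phi> k"
  obtain s where s: "\<And>x. x \<in> exchanged (rauzy (DD k)) l \<Longrightarrow> iet (DD k) x = x + s"
     "(\<forall>x \<in> exchanged (rauzy (DD k)) l. x \<in> exchanged (DD k) l \<and> x + s \<in> exchanged (DD k) w
        \<and> (\<forall>z \<in> exchanged (rauzy (DD k)) w. z < x + s))
     \<or> (\<forall>x \<in> exchanged (rauzy (DD k)) l. x \<in> exchanged (DD k) w \<and> x + s \<in> exchanged (DD k) l
        \<and> (\<forall>z \<in> exchanged (rauzy (DD k)) w. z < x))"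
    by (rule two_steps) blast
  have xy: "x a \<in> exchanged (rauzy (DD k)) a" "y a \<in> exchanged (rauzy (DD k)) a" for a
    using Suc.prems by auto
  \<comment> \<open>The piece of the winner tower and the piece of the loser tower that make up the new loser tower.\<close>
  obtain p q p' q' where pq: "p \<in> exchanged (DD k) w" "q \<in> exchanged (DD k) w"
    "p' \<in> exchanged (DD k) l" "q' \<in> exchanged (DD k) l" "p \<le> q" "p' \<le> q'" "y w < p"
    and sum: "tower_sum D \<phi> (Suc k) (y l) - tower_sum D \<phi> (Suc k) (x l) = (?T q - ?T p) + (?T q' - ?T p')"
  proof -
    have T: "tower_sum D \<phi> (Suc k) (y l) - tower_sum D \<phi> (Suc k) (x l)
        = ?T (y l) + ?T (y l + s) - (?T (x l) + ?T (x l + s))"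
      using tower_sum_loser[of "x l" k \<phi>] tower_sum_loser[of "y l" k \<phi>] Suc.prems(1)[of l] Suc.prems(2)[of l]
        s(1)[OF xy(1)] s(1)[OF xy(2)] by (simp del: tower_sum.simps)
    show thesis
      using s(2)
    proof
      assume a: "\<forall>x \<in> exchanged (rauzy (DD k)) l. x \<in> exchanged (DD k) l \<and> x + s \<in> exchanged (DD k) w
        \<and> (\<forall>z \<in> exchanged (rauzy (DD k)) w. z < x + s)"
      show thesis
        by (rule that[of "x l + s" "y l + s" "x l" "y l"])
          (use a xy[of l] xy[of w] Suc.prems(3)[of l] T in auto)
    next
      assume a: "\<forall>x \<in> exchanged (rauzy (DD k)) l. x \<in> exchanged (DD k) w \<and> x + s \<in> exchanged (DD k) l
        \<and> (\<forall>z \<in> exchanged (rauzy (DD k)) w. z < x)"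
      show thesis
        by (rule that[of "x l" "y l" "x l + s" "y l + s"])
          (use a xy[of l] xy[of w] Suc.prems(3)[of l] T in auto)
    qed
  qed
  have xw: "x w \<in> exchanged (DD k) w" "y w \<in> exchanged (DD k) w"
    using stay(1)[OF winner_loser(1)] xy by auto
  define x' where "x' a = (if a = l then p' else x a)" for a
  define y' where "y' a = (if a = l then q' else if a = w then q else y a)" for a
  have "x' a \<in> exchanged (DD k) a" "y' a \<in> exchanged (DD k) a" "x' a \<le> y' a" for a
    using stay(1)[of a "x a"] stay(1)[of a "y a"] xy pq Suc.prems(3)[of a]
    by (auto simp: x'_def y'_def)
  from Suc.IH[of x' y', OF this] have IH: "(\<Sum>a\<in>UNIV. ?T (y' a) - ?T (x' a)) \<le> real CARD('a) * V" .
  let ?T' = "tower_sum D \<phi> (Suc k)"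
  have ow: "?T' (y a) - ?T' (x a) = ?T (y a) - ?T (x a)" if "a \<noteq> l" for a
    using tower_sum_other[OF Suc.prems(1) that] tower_sum_other[OF Suc.prems(2) that] by (simp del: tower_sum.simps)
  have "?T (y w) \<le> ?T p"
    using tower_sum_dominated[OF dom xw(2) pq(1)] pq(7) by fastforce
  have split: "(\<Sum>a\<in>UNIV. F a) = F l + F w + (\<Sum>a\<in>UNIV - {l, w}. F a)" for F :: "'a \<Rightarrow> real"
    using sum.remove[of UNIV l F] sum.remove[of "UNIV - {l}" w F] winner_loser(1)
    by (simp add: Diff_insert2[symmetric] insert_commute)
  have "(\<Sum>a\<in>UNIV. ?T' (y a) - ?T' (x a)) \<le> (\<Sum>a\<in>UNIV. ?T (y' a) - ?T (x' a))"
  proof -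
    have "(\<Sum>a\<in>UNIV - {l, w}. ?T' (y a) - ?T' (x a)) = (\<Sum>a\<in>UNIV - {l, w}. ?T (y' a) - ?T (x' a))"
      by (rule sum.cong) (auto simp: ow x'_def y'_def simp del: tower_sum.simps)
    moreover have "?T' (y w) - ?T' (x w) + (?T q - ?T p) \<le> ?T (y' w) - ?T (x' w)"
      using ow[OF winner_loser(1)] \<open>?T (y w) \<le> ?T p\<close> winner_loser(1)
      by (simp add: x'_def y'_def del: tower_sum.simps)
    ultimately show ?thesis
      unfolding split[of "\<lambda>a. ?T' (y a) - ?T' (x a)"] split[of "\<lambda>a. ?T (y' a) - ?T (x' a)"] sum
      by (simp add: x'_def y'_def del: tower_sum.simps)
  qed
  with IH show ?case by linarith
qed

end

section \<open>Deviation of Birkhoff sums\<close>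

text \<open>
  The variation of \<open>g\<close> up to \<open>x\<close> serves as \<open>\<phi>\<close>. Dominating increments by those of a
  single monotone function is a form of bounded variation that passes to Birkhoff sums termwise.
\<close>
lemma bounded_variation_dominated:
  assumes "bounded_variation_on g {0..<1}"
  obtains \<phi> V where
    "\<And>x y. x \<in> {0..<1} \<Longrightarrow> y \<in> {0..<1} \<Longrightarrow> x \<le> y \<Longrightarrow> \<bar>g y - g x\<bar> \<le> \<phi> y - \<phi> x"
    "\<And>x. x \<in> {0..<1} \<Longrightarrow> 0 \<le> \<phi> x \<and> \<phi> x \<le> V"
proof -
  define var where "var xs = (\<Sum>i<length xs - 1. \<bar>g (xs ! Suc i) - g (xs ! i)\<bar>)" for xs
  obtain V where V: "\<And>xs. sorted xs \<Longrightarrow> set xs \<subseteq> {0..<1} \<Longrightarrow> var xs \<le> V"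
    using assms unfolding bounded_variation_on_def var_def by blast
  define Xs where "Xs x = {xs. sorted xs \<and> set xs \<subseteq> {0..x}}" for x :: real
  define \<phi> where "\<phi> x = Sup (var ` Xs x)" for x
  have ne: "[] \<in> Xs x" for x by (simp add: Xs_def)
  have var0: "0 \<le> var xs" for xs unfolding var_def by (rule sum_nonneg) simp
  have VX: "var xs \<le> V" if "xs \<in> Xs x" "x < 1" for xs x
    using that by (intro V) (auto simp: Xs_def)
  have bdd: "bdd_above (var ` Xs x)" if "x < 1" for x
    using VX[OF _ that] by (intro bdd_aboveI2)
  have dom: "\<bar>g y - g x\<bar> \<le> \<phi> y - \<phi> x" if "x \<in> {0..<1}" "y \<in> {0..<1}" "x \<le> y" for x y
  proof -
    have "var xs \<le> \<phi> y - \<bar>g y - g x\<bar>" if xs: "xs \<in> Xs x" for xs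
    proof -
      let ?ys = "xs @ [x, y]" and ?n = "length xs"
      have ys: "?ys \<in> Xs y" using xs \<open>x \<le> y\<close> \<open>x \<in> {0..<1}\<close> by (force simp: Xs_def sorted_append)
      have "var xs + \<bar>g y - g x\<bar> = (\<Sum>i\<in>{..<?n - 1} \<union> {?n}. \<bar>g (?ys ! Suc i) - g (?ys ! i)\<bar>)"
        unfolding var_def by (subst sum.union_disjoint) (auto simp: nth_append intro!: sum.cong)
      also have "\<dots> \<le> var ?ys"
        unfolding var_def by (rule sum_mono2) auto
      also have "\<dots> \<le> \<phi> y"
        unfolding \<phi>_def using ys bdd[of y] \<open>y \<in> {0..<1}\<close> by (intro cSup_upper) auto
      finally show ?thesis by simp
    qed
    then have "\<phi> x \<le> \<phi> y - \<bar>g y - g x\<bar>"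
      unfolding \<phi>_def[of x] using ne by (intro cSup_least) auto
    then show ?thesis by simp
  qed
  have "0 \<le> \<phi> x \<and> \<phi> x \<le> V" if "x \<in> {0..<1}" for x
  proof
    have "var [] \<le> \<phi> x" unfolding \<phi>_def using ne bdd[of x] that by (intro cSup_upper) auto
    then show "0 \<le> \<phi> x" using var0[of "[]"] by linarith
    show "\<phi> x \<le> V" unfolding \<phi>_def using ne VX[of _ x] that by (intro cSup_least) auto
  qed
  with dom show thesis by (rule that)
qed

text \<open>
  Inhomogeneous recursion: the error made at each step is propagated by the powers of \<open>B\<close>, so one
  more power of \<open>j\<close> is lost when \<open>1 \<le> r\<close>.
\<close>

lemma perturbed_iteration_growth:
  fixes z e :: "nat \<Rightarrow> real ^ 'n" and B :: "real ^ 'n ^ 'n"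
  assumes gr: "\<And>v m. v \<in> W \<Longrightarrow> norm (((*v) B ^^ m) v) \<le> K * real (Suc m) ^ q * r ^ m * norm v"
    and z0: "z 0 \<in> W" and e: "\<And>j. e j \<in> W" "\<And>j. norm (e j) \<le> E"
    and rec: "\<And>j. z (Suc j) = B *v z j + e j"
    and r: "1 \<le> r" and K: "0 \<le> K"
  shows "norm (z j) \<le> K * real (Suc j) ^ q * r ^ j * (norm (z 0) + real j * E)"
proof -
  have lin: "((*v) B ^^ m) (x + y) = ((*v) B ^^ m) x + ((*v) B ^^ m) y" for m x y
    by (induction m) (simp_all add: matrix_vector_right_distrib)
  have E: "0 \<le> E" using e(2)[of 0] norm_ge_zero order_trans by blast
  have "norm (((*v) B ^^ m) (z j))
      \<le> K * real (Suc (m + j)) ^ q * r ^ (m + j) * (norm (z 0) + real j * E)" for m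
  proof (induction j arbitrary: m)
    case 0
    then show ?case using gr[OF z0, of m] by simp
  next
    case (Suc j)
    have "((*v) B ^^ m) (z (Suc j)) = ((*v) B ^^ Suc m) (z j) + ((*v) B ^^ m) (e j)"
      by (simp add: rec lin funpow_Suc_right del: funpow.simps(2))
    then have "norm (((*v) B ^^ m) (z (Suc j)))
        \<le> norm (((*v) B ^^ Suc m) (z j)) + norm (((*v) B ^^ m) (e j))"
      by (metis norm_triangle_ineq)
    also have "\<dots> \<le> K * real (Suc (m + Suc j)) ^ q * r ^ (m + Suc j) * (norm (z 0) + real j * E)
        + K * real (Suc m) ^ q * r ^ m * norm (e j)"
      using Suc.IH[of "Suc m"] gr[OF e(1), of m j] by (intro add_mono) auto
    also have "K * real (Suc m) ^ q * r ^ m * norm (e j)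
        \<le> K * real (Suc (m + Suc j)) ^ q * r ^ (m + Suc j) * E"
      using K r E e(2) by (intro mult_mono power_mono power_increasing mult_nonneg_nonneg) auto
    finally show ?case by (simp add: algebra_simps)
  qed
  from this[of 0] show ?thesis by simp
qed

context rauzy_iterates
begin

lemma Theta_prod_DD:
  assumes "\<And>i. Theta (DD (i + k)) = Theta (DD i)"
  shows "Theta_prod (DD k) m = Theta_prod D m"
proof (induction m)
  case (Suc m)
  have "(rauzy ^^ m) (DD k) = DD (m + k)" by (simp add: funpow_add)
  then show ?case using Suc assms by simp
qed simp

lemma lam_DD: "lam (DD k) = Theta_prod (DD k) m *v lam (DD (k + m))"
proof (induction m)
  case (Suc m)
  have d: "(rauzy ^^ m) (DD k) = DD (k + m)" by (simp add: funpow_add add.commute[of k])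
  have "lam (DD (k + m)) = Theta (DD (k + m)) *v lam (DD (k + Suc m))"
    using Theta_rauzy[OF all_defined[of "k + m"]] by simp
  then show ?case using Suc d by (simp add: matrix_vector_mul_assoc)
qed simp

lemma left_end_exchanged: "left_end (pi0 (DD k)) (lam (DD k)) a \<in> exchanged (DD k) a"
  using adm_DD[of k] by (simp add: subinterval_def admissible_def)

lemma two_symbols: "2 \<le> CARD('a)"
proof -
  interpret rauzy_step D using step[of 0] by simp
  have "card {w, l} \<le> CARD('a)" by (rule card_mono) auto
  then show ?thesis using winner_loser(1) by simp
qed

text \<open>
  The floors of a tower are disjoint intervals, so the variation of a Birkhoff sum over the tower is
  bounded independently of the height: this is the source of all bounded errors below.
\<close>
lemma tower_sum_oscillation:
  assumes dom: "\<And>x y. x \<in> base D \<Longrightarrow> y \<in> base D \<Longrightarrow> x \<le> y \<Longrightarrow> \<bar>g y - g x\<bar> \<le> \<phi> y - \<phi> x"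
    and \<phi>V: "\<And>x. x \<in> base D \<Longrightarrow> 0 \<le> \<phi> x \<and> \<phi> x \<le> V"
    and xy: "x \<in> exchanged (DD k) a" "y \<in> exchanged (DD k) a"
  shows "\<bar>tower_sum D g k y - tower_sum D g k x\<bar> \<le> real CARD('a) * V"
proof -
  have *: "\<bar>tower_sum D g k y - tower_sum D g k x\<bar> \<le> real CARD('a) * V"
    if xy: "x \<in> exchanged (DD k) a" "y \<in> exchanged (DD k) a" "x \<le> y" for x y
  proof -
    let ?T = "tower_sum D \<phi> k" and ?e = "\<lambda>b. left_end (pi0 (DD k)) (lam (DD k)) b"
    let ?x = "\<lambda>b. if b = a then x else ?e b" and ?y = "\<lambda>b. if b = a then y else ?e b"
    have "(\<Sum>b\<in>UNIV. ?T (?y b) - ?T (?x b)) = (\<Sum>b\<in>UNIV. if b = a then ?T y - ?T x else 0)"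
      by (rule sum.cong) auto
    then have "?T y - ?T x = (\<Sum>b\<in>UNIV. ?T (?y b) - ?T (?x b))" by simp
    also have "\<dots> \<le> real CARD('a) * V"
      by (rule tower_sum_increments[OF dom \<phi>V]) (use xy left_end_exchanged in auto)
    finally show ?thesis using tower_sum_dominated[where g = g and \<phi> = \<phi>, OF dom xy] by linarith
  qed
  show ?thesis
  proof (cases "x \<le> y")
    case True
    then show ?thesis using * xy by blast
  next
    case False
    then show ?thesis using *[OF xy(2,1)] by (simp add: abs_minus_commute)
  qed
qed

text \<open>
  Up to a bounded error, sums over full towers depend only on the tower, and they are stacked in the
  same way as the towers themselves.
\<close>
lemma tower_values_step:
  assumes osc: "\<And>k a x y. x \<in> exchanged (DD k) a \<Longrightarrow> y \<in> exchanged (DD k) a \<Longrightarrow>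
      \<bar>tower_sum D g k y - tower_sum D g k x\<bar> \<le> V"
    and v: "\<And>k. v k = (\<chi> a. tower_sum D g k (left_end (pi0 (DD k)) (lam (DD k)) a))"
  shows "\<bar>v (Suc k) $ b - (transpose (Theta (DD k)) *v v k) $ b\<bar> \<le> 2 * V"
proof -
  interpret rauzy_step "DD k" by (rule step)
  let ?e = "left_end (pi0 (DD (Suc k))) (lam (DD (Suc k))) b"
  have vosc: "\<bar>tower_sum D g k x - v k $ a\<bar> \<le> V" if "x \<in> exchanged (DD k) a" for x a
    using osc[OF left_end_exchanged that] by (simp add: v)
  have V0: "0 \<le> V" using osc[OF left_end_exchanged left_end_exchanged, of k b] by simp
  have eb: "?e \<in> exchanged (DD (Suc k)) b" by (rule left_end_exchanged)
  have vS: "v (Suc k) $ b = tower_sum D g (Suc k) ?e" unfolding v by simp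
  show ?thesis
  proof (cases "b = l")
    case False
    have eb': "?e \<in> exchanged (DD k) b" using stay(1)[OF False] eb by simp
    show ?thesis
      using vosc[OF eb'] V0 unfolding vS tower_sum_other[OF eb False] transpose_Theta_mult
      by (simp add: False)
  next
    case True
    obtain s where s: "\<And>x. x \<in> exchanged (rauzy (DD k)) l \<Longrightarrow> iet (DD k) x = x + s"
      "(\<forall>x \<in> exchanged (rauzy (DD k)) l. x \<in> exchanged (DD k) l \<and> x + s \<in> exchanged (DD k) w)
     \<or> (\<forall>x \<in> exchanged (rauzy (DD k)) l. x \<in> exchanged (DD k) w \<and> x + s \<in> exchanged (DD k) l)"
      by (rule two_steps) blast
    have x: "?e \<in> exchanged (rauzy (DD k)) l" using eb True by simp
    have "\<bar>tower_sum D g k ?e + tower_sum D g k (iet (DD k) ?e) - (v k $ l + v k $ w)\<bar> \<le> 2 * V"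
      unfolding s(1)[OF x] using s(2)
    proof
      assume "\<forall>x \<in> exchanged (rauzy (DD k)) l. x \<in> exchanged (DD k) l \<and> x + s \<in> exchanged (DD k) w"
      then show "\<bar>tower_sum D g k ?e + tower_sum D g k (?e + s) - (v k $ l + v k $ w)\<bar> \<le> 2 * V"
        using x vosc[of ?e l] vosc[of "?e + s" w] by fastforce
    next
      assume "\<forall>x \<in> exchanged (rauzy (DD k)) l. x \<in> exchanged (DD k) w \<and> x + s \<in> exchanged (DD k) l"
      then show "\<bar>tower_sum D g k ?e + tower_sum D g k (?e + s) - (v k $ l + v k $ w)\<bar> \<le> 2 * V"
        using x vosc[of ?e w] vosc[of "?e + s" l] by fastforce
    qed
    moreover have "tower_sum D g (Suc k) ?e = tower_sum D g k ?e + tower_sum D g k (iet (DD k) ?e)"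
      using tower_sum_loser[of ?e k g] eb True by simp
    ultimately show ?thesis unfolding vS transpose_Theta_mult by (simp add: True)
  qed
qed

lemma tower_values_steps:
  assumes st: "\<And>k b. \<bar>v (Suc k) $ b - (transpose (Theta (DD k)) *v v k) $ b\<bar> \<le> 2 * V"
  shows "\<bar>v (k + m) $ b - (transpose (Theta_prod (DD k) m) *v v k) $ b\<bar> \<le> 2 * V * (2 ^ m - 1)"
proof (induction m arbitrary: b)
  case (Suc m)
  have d: "(rauzy ^^ m) (DD k) = DD (k + m)" by (simp add: funpow_add add.commute[of k])
  let ?Tt = "transpose (Theta (DD (k + m)))" and ?P = "transpose (Theta_prod (DD k) m) *v v k"
  have V0: "0 \<le> 2 * V * (2 ^ m - 1)" using Suc.IH[of b] abs_ge_zero order_trans by blast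
  have eq: "transpose (Theta_prod (DD k) (Suc m)) *v v k = ?Tt *v ?P"
    by (simp add: d matrix_transpose_mul matrix_vector_mul_assoc del: transpose_matrix_vector)
  have "\<bar>(?Tt *v v (k + m)) $ b - (?Tt *v ?P) $ b\<bar> \<le> 2 * (2 * V * (2 ^ m - 1))"
    unfolding transpose_Theta_mult
    using Suc.IH[of b] Suc.IH[of "winner (DD (k + m))"] V0 by (cases "b = loser (DD (k + m))") auto
  moreover have "\<bar>v (k + Suc m) $ b - (?Tt *v v (k + m)) $ b\<bar> \<le> 2 * V" using st[of "k + m" b] by simp
  ultimately have "\<bar>v (k + Suc m) $ b - (transpose (Theta_prod (DD k) (Suc m)) *v v k) $ b\<bar>
      \<le> 2 * V + 2 * (2 * V * (2 ^ m - 1))" unfolding eq by linarith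
  then show ?case by (simp add: algebra_simps)
qed simp

lemma height_nonneg: "0 \<le> height k $ b"
proof (induction k arbitrary: b)
  case 0
  then show ?case by (simp add: height_def)
next
  case (Suc k)
  then show ?case unfolding height_Suc transpose_Theta_mult by simp
qed

text \<open>
  Each Rauzy step moves at most two values, one at each end of the orbit segment, out of the sum over
  full blocks; the number of remaining blocks is limited by the length of the segment.
\<close>
lemma birkhoff_sum_tower_decomposition:
  assumes G: "\<And>k x. x \<in> base (DD k) \<Longrightarrow> \<bar>tower_sum D g k x\<bar> \<le> G k" "\<And>k. 0 \<le> G k"
    and x: "x \<in> base D"
  shows "\<exists>x'\<in>base (DD k). \<exists>n'.
    \<bar>birkhoff_sum (iet D) g n x - birkhoff_sum (iet (DD k)) (tower_sum D g k) n' x'\<bar> \<le> 2 * (\<Sum>i<k. G i)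
    \<and> birkhoff_sum (iet (DD k)) (tower_sum D (\<lambda>_. 1) k) n' x' \<le> real n"
proof (induction k)
  case 0
  have "tower_sum D g 0 = g" "tower_sum D (\<lambda>_. 1) 0 = (\<lambda>_. 1)" by auto
  then show ?case using x by (intro bexI[of _ x] exI[of _ n]) (auto simp: birkhoff_sum_def)
next
  case (Suc k)
  interpret rauzy_step "DD k" by (rule step)
  from Suc obtain y m where y: "y \<in> base (DD k)"
    "\<bar>birkhoff_sum (iet D) g n x - birkhoff_sum (iet (DD k)) (tower_sum D g k) m y\<bar> \<le> 2 * (\<Sum>i<k. G i)"
    "birkhoff_sum (iet (DD k)) (tower_sum D (\<lambda>_. 1) k) m y \<le> real n" by blast
  have "\<exists>x'\<in>base (DD (Suc k)). \<exists>n'.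
    \<bar>birkhoff_sum (iet (DD k)) (tower_sum D g k) m y
       - birkhoff_sum (iet (DD (Suc k))) (tower_sum D g (Suc k)) n' x'\<bar> \<le> 2 * G k
    \<and> birkhoff_sum (iet (DD (Suc k))) (tower_sum D (\<lambda>_. 1) (Suc k)) n' x'
       \<le> birkhoff_sum (iet (DD k)) (tower_sum D (\<lambda>_. 1) k) m y"
  proof (rule birkhoff_sum_inducing[where J = "base (DD k)" and R = "exchanged (DD (Suc k)) l"])
    show "base (DD (Suc k)) \<subseteq> base (DD k)" using base_rauzy_subset by simp
    show "exchanged (DD (Suc k)) l \<subseteq> base (DD (Suc k))" by (rule exchanged_subset_base[OF adm_DD])
    show "iet (DD k) x \<in> base (DD k)" if "x \<in> base (DD k)" for x
      by (rule iet_maps_base[OF adm_DD that])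
    show "iet (DD (Suc k)) x \<in> base (DD (Suc k))" if "x \<in> base (DD (Suc k))" for x
      by (rule iet_maps_base[OF adm_DD that])
    show "iet (DD (Suc k)) x = iet (DD k) x" if x: "x \<in> base (DD (Suc k)) - exchanged (DD (Suc k)) l" for x
    proof -
      obtain a where a: "x \<in> exchanged (DD (Suc k)) a" using exchanged_cover[OF adm_DD] x by blast
      with x have "a \<noteq> l" by blast
      from stay(2)[OF this] a show ?thesis by simp
    qed
    show "iet (DD (Suc k)) x = iet (DD k) (iet (DD k) x)" if "x \<in> exchanged (DD (Suc k)) l" for x
      using two_steps_iet(2)[of x] that by simp
    show "iet (DD k) x \<in> base (DD (Suc k))" if "x \<in> base (DD k) - base (DD (Suc k))" for x
      using removed_part_returns[of x] that by simp
    show "\<bar>tower_sum D g k x\<bar> \<le> G k" if "x \<in> base (DD k)" for x by (rule G(1)[OF that])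
    show "0 \<le> tower_sum D (\<lambda>_. 1) k x" if x: "x \<in> base (DD k)" for x
    proof -
      obtain a where "x \<in> exchanged (DD k) a" using exchanged_cover[OF adm_DD x] .
      then show ?thesis by (simp add: tower_sum_one height_nonneg)
    qed
  qed (use G(2) y in auto)
  then obtain x' n' where "x' \<in> base (DD (Suc k))"
    "\<bar>birkhoff_sum (iet (DD k)) (tower_sum D g k) m y
       - birkhoff_sum (iet (DD (Suc k))) (tower_sum D g (Suc k)) n' x'\<bar> \<le> 2 * G k"
    "birkhoff_sum (iet (DD (Suc k))) (tower_sum D (\<lambda>_. 1) (Suc k)) n' x'
       \<le> birkhoff_sum (iet (DD k)) (tower_sum D (\<lambda>_. 1) k) m y" by blast
  then show ?case using y
    by (intro bexI[of _ x'] exI[of _ n']) (auto simp del: tower_sum.simps)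
qed

text \<open>
  Once every tower is taller than \<open>n\<close>, no full block fits into an orbit segment of length \<open>n\<close>, and
  only the values split off on the way remain.
\<close>
lemma birkhoff_sum_le_tower_bounds:
  assumes G: "\<And>k x. x \<in> base (DD k) \<Longrightarrow> \<bar>tower_sum D g k x\<bar> \<le> G k" "\<And>k. 0 \<le> G k"
    and x: "x \<in> base D" and n: "\<And>b. real n < height k $ b"
  shows "\<bar>birkhoff_sum (iet D) g n x\<bar> \<le> 2 * (\<Sum>i<k. G i)"
proof -
  from birkhoff_sum_tower_decomposition[of g G x k n, OF G x] obtain x' n' where x': "x' \<in> base (DD k)"
    "\<bar>birkhoff_sum (iet D) g n x - birkhoff_sum (iet (DD k)) (tower_sum D g k) n' x'\<bar> \<le> 2 * (\<Sum>i<k. G i)"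
    "birkhoff_sum (iet (DD k)) (tower_sum D (\<lambda>_. 1) k) n' x' \<le> real n" by blast
  have "n' = 0"
  proof (rule ccontr)
    assume "n' \<noteq> 0"
    have nn: "0 \<le> tower_sum D (\<lambda>_. 1) k ((iet (DD k) ^^ i) x')" for i
    proof -
      have "(iet (DD k) ^^ i) x' \<in> base (DD k)"
        by (induction i) (use x' iet_maps_base[OF adm_DD] in auto)
      then obtain a where "(iet (DD k) ^^ i) x' \<in> exchanged (DD k) a" using exchanged_cover[OF adm_DD] by blast
      then show ?thesis by (simp add: tower_sum_one height_nonneg)
    qed
    obtain a where "x' \<in> exchanged (DD k) a" using exchanged_cover[OF adm_DD x'(1)] .
    then have "real n < tower_sum D (\<lambda>_. 1) k ((iet (DD k) ^^ 0) x')" using n by (simp add: tower_sum_one)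
    also have "\<dots> \<le> birkhoff_sum (iet (DD k)) (tower_sum D (\<lambda>_. 1) k) n' x'"
      unfolding birkhoff_sum_def using \<open>n' \<noteq> 0\<close> nn by (intro member_le_sum) auto
    finally show False using x'(3) by simp
  qed
  then show ?thesis using x'(2) by simp
qed

end

text \<open>
  The length vector is an eigenvector \<open>u\<close> of the period matrix, because it has positive preimages
  of every order. The vectors of tower sums at multiples of the period evolve by the transposed
  period matrix up to bounded errors. Subtracting suitable multiples of the height vectors makes
  them orthogonal to \<open>u\<close>, where the growth is governed by the second exponent; the errors cost one
  further power of the number of periods. The multiples converge to the slope \<open>c\<close>, so fast that
  replacing them by \<open>c\<close> changes the tower sums by a bounded amount. Finally, an orbit segment of
  length \<open>n\<close> is exhausted after a number of Rauzy steps proportional to \<open>ln n\<close>, and summing over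
  these steps costs the last power of the logarithm.
\<close>
theorem birkhoff_deviation:
  fixes D :: "'a::finite iet_data"
  assumes "iet_valid D" and tl: "total_length D = 1" and per: "periodic_type D p"
    and \<theta>: "\<theta>1 = lyapunov_exponents D p ! 0" "\<theta>2 = lyapunov_exponents D p ! 1" "0 \<le> \<theta>2" "\<theta>2 < \<theta>1"
    and bv: "bounded_variation_on g {0..<1}"
  obtains c C where "0 < C" "\<And>n x. 2 \<le> n \<Longrightarrow> x \<in> {0..<1} \<Longrightarrow>
    \<bar>birkhoff_sum (iet D) g n x - real n * c\<bar> \<le> C * ln (real n) ^ CARD('a) * real n powr (\<theta>2 / \<theta>1)"
proof -
  interpret rauzy_iterates D
    using assms(1) per by unfold_locales (auto simp: iet_valid_imp_admissible periodic_type_def)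
  have p0: "0 < p" and Tper: "\<And>k. Theta (DD (k + p)) = Theta (DD k)"
    and Apos: "\<And>i j. 0 < Theta_prod D p $ i $ j"
    using per by (auto simp: periodic_type_def)
  define A where "A = Theta_prod D p"
  define B where "B = transpose A"
  define u where "u = lam D"
  have u0: "0 < u $ a" for a using adm0 by (simp add: u_def admissible_def)
  have u1: "(\<Sum>a\<in>UNIV. u $ a) = 1" using tl by (simp add: total_length_def u_def)
  have Tj: "Theta (DD (i + j * p)) = Theta (DD i)" for i j
  proof (induction j)
    case (Suc j)
    then show ?case using Tper[of "i + j * p"] by (simp add: algebra_simps)
  qed simp
  have Aj: "Theta_prod (DD (j * p)) p = A" for j
    unfolding A_def by (rule Theta_prod_DD) (rule Tj)
  have lamj: "lam (DD (j * p)) = A *v lam (DD (Suc j * p))" for j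
    using lam_DD[of "j * p" p] by (simp add: Aj add.commute)
  have lampos: "0 < lam (DD k) $ a" for k a using adm_DD by (simp add: admissible_def)
  \<comment> \<open>The lengths at multiples of the period are compared with the same sequence shifted by one period.\<close>
  have Apos': "0 < A $ i $ j" for i j by (simp add: A_def Apos)
  obtain \<rho> where \<rho>: "0 < \<rho>" "lam (DD (0 * p)) = \<rho> *s lam (DD (Suc 0 * p))"
    using positive_sequences_proportional[of A "\<lambda>j. lam (DD (j * p))" "\<lambda>j. lam (DD (Suc j * p))",
      OF Apos' lampos lamj lampos lamj] by blast
  have Au: "A *v u = \<rho> *s u"
  proof -
    have lD: "lam D = A *v lam (DD p)" using lamj[of 0] by simp
    have "A *v lam D = A *v (\<rho> *s lam (DD p))" using \<rho>(2) by simp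
    also have "\<dots> = \<rho> *s lam D" unfolding lD by (rule matrix_vector_scale)
    finally show ?thesis by (simp add: u_def)
  qed
  interpret perron A u \<rho>
    by unfold_locales (use Apos u0 Au in \<open>auto simp: A_def\<close>)
  define r where "r = exp \<theta>2"
  have L: "lyapunov_exponents D p
      = rev (sorted_list_of_multiset (image_mset (\<lambda>z. ln (cmod z)) (eigenvalues A)))"
    by (simp add: lyapunov_exponents_def A_def)
  have \<rho>\<theta>: "\<rho> = exp \<theta>1" using exponents_and_growth(1)[OF L] \<theta> by simp
  \<comment> \<open>The exponent of the number of periods is \<open>q\<close> here, \<open>q + 1\<close> for the tower sums and
    \<open>q + 2 = CARD('a)\<close> for arbitrary orbit segments.\<close>
  define q where "q = CARD('a) - 2"
  obtain K where K: "0 \<le> K" "\<And>w j. (\<Sum>a\<in>UNIV. u $ a * w $ a) = 0 \<Longrightarrow>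
      norm (((*v) B ^^ j) w) \<le> K * real (Suc j) ^ q * r ^ j * norm w"
    using exponents_and_growth(2)[OF L] \<theta> unfolding r_def q_def B_def by metis
  have r1: "1 \<le> r" using \<theta> by (simp add: r_def)
  have \<rho>1: "1 < \<rho>" using \<theta> by (simp add: \<rho>\<theta>)

  define dot where "dot w = (\<Sum>a\<in>UNIV. u $ a * w $ a)" for w :: "real ^ 'a"
  have dotB: "dot (B *v w) = \<rho> * dot w" for w
    using weighted_column_sum[of "\<lambda>a. w $ a"]
    by (simp add: dot_def B_def matrix_vector_mult_def transpose_def del: transpose_matrix_vector)
  have dot_add: "dot (w + w') = dot w + dot w'" for w w'
    by (simp add: dot_def algebra_simps sum.distrib)
  have dot_diff: "dot (w - w') = dot w - dot w'" for w w'
    by (simp add: dot_def algebra_simps sum_subtractf)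
  have dot_smult: "dot (s *s w) = s * dot w" for s w
    by (simp add: dot_def sum_distrib_left mult_ac)

  define H where "H j = height (j * p)" for j
  have H0: "H 0 = (\<chi> a. 1)" by (simp add: H_def height_def)
  have heightB: "height (k + m) = transpose (Theta_prod (DD k) m) *v height k" for k m
  proof (induction m)
    case (Suc m)
    have d: "(rauzy ^^ m) (DD k) = DD (k + m)" by (simp add: funpow_add add.commute[of k])
    show ?case using Suc
      by (simp add: height_Suc d matrix_transpose_mul matrix_vector_mul_assoc del: transpose_matrix_vector)
  qed simp
  have HS: "H (Suc j) = B *v H j" for j
    using heightB[of "j * p" p] by (simp add: H_def B_def Aj add.commute)
  have dotH: "dot (H j) = \<rho> ^ j" for j
    by (induction j) (use u1 in \<open>simp_all add: H0 HS dotB\<close>, simp add: dot_def)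
  have Hnn: "0 \<le> H j $ a" for j a by (simp add: H_def height_nonneg)
  define umin where "umin = Min (range (\<lambda>a. u $ a))"
  have umin: "0 < umin" "\<And>a. umin \<le> u $ a" using u0 by (auto simp: umin_def)
  define C1 where "C1 = 1 / umin"
  have C1: "0 < C1" using umin by (simp add: C1_def)
  have Hup: "H j $ a \<le> C1 * \<rho> ^ j" for j a
  proof -
    have "umin * H j $ a \<le> u $ a * H j $ a" by (intro mult_right_mono umin Hnn)
    also have "\<dots> \<le> dot (H j)" unfolding dot_def by (rule member_le_sum) (use u0 Hnn in \<open>auto simp: less_imp_le\<close>)
    finally show ?thesis using umin(1) by (simp add: C1_def dotH field_simps)
  qed
  define \<alpha> where "\<alpha> = Min (range (\<lambda>(i, j). A $ i $ j))"
  have "\<alpha> \<in> range (\<lambda>(i, j). A $ i $ j)" unfolding \<alpha>_def by (rule Min_in) auto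
  then have \<alpha>0: "0 < \<alpha>" using Apos by (auto simp: A_def)
  have \<alpha>: "\<alpha> \<le> A $ i $ j" for i j
    unfolding \<alpha>_def by (rule Min_le) (auto intro: image_eqI[of _ _ "(i, j)"])
  have ule1: "u $ a \<le> 1" for a
    unfolding u1[symmetric] by (rule member_le_sum) (use u0 in \<open>auto simp: less_imp_le\<close>)
  have Hlow: "\<alpha> * \<rho> ^ j \<le> H (Suc j) $ b" for j b
  proof -
    have "\<alpha> * \<rho> ^ j = (\<Sum>a\<in>UNIV. \<alpha> * (u $ a * H j $ a))"
      by (simp add: dotH[symmetric] dot_def sum_distrib_left)
    also have "\<dots> \<le> (\<Sum>a\<in>UNIV. A $ a $ b * (1 * H j $ a))"
      using \<alpha>0 u0 ule1 Hnn Apos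
      by (intro sum_mono mult_mono \<alpha> mult_right_mono) (auto simp: less_imp_le A_def)
    also have "\<dots> = H (Suc j) $ b"
      by (simp add: HS B_def matrix_vector_mult_def transpose_def del: transpose_matrix_vector)
    finally show ?thesis .
  qed

  obtain \<phi> V where
    dom: "\<And>x y. x \<in> base D \<Longrightarrow> y \<in> base D \<Longrightarrow> x \<le> y \<Longrightarrow> \<bar>g y - g x\<bar> \<le> \<phi> y - \<phi> x"
    and \<phi>V: "\<And>x. x \<in> base D \<Longrightarrow> 0 \<le> \<phi> x \<and> \<phi> x \<le> V"
    using bounded_variation_dominated[OF bv] unfolding tl by blast
  define V' where "V' = real CARD('a) * V"
  have osc: "\<bar>tower_sum D g k y - tower_sum D g k x\<bar> \<le> V'"
    if "x \<in> exchanged (DD k) a" "y \<in> exchanged (DD k) a" for k a x y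
    unfolding V'_def by (rule tower_sum_oscillation[OF dom \<phi>V that])
  have V'0: "0 \<le> V'" using osc[OF left_end_exchanged left_end_exchanged, of 0] by fastforce
  define v where "v k = (\<chi> a. tower_sum D g k (left_end (pi0 (DD k)) (lam (DD k)) a))" for k
  define E where "E = 2 * V' * (2 ^ p - 1)"
  have E0: "0 \<le> E" using V'0 by (simp add: E_def)
  define e where "e j = v (Suc j * p) - B *v v (j * p)" for j
  have vst: "\<bar>v (Suc k) $ b - (transpose (Theta (DD k)) *v v k) $ b\<bar> \<le> 2 * V'" for k b
    by (rule tower_values_step[OF osc v_def])
  have eE: "\<bar>e j $ b\<bar> \<le> E" for j b
    using tower_values_steps[of v V' "j * p" p b, OF vst]
    by (simp add: e_def E_def Aj B_def add.commute del: transpose_matrix_vector)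
  define c where "c j = dot (v (j * p)) / \<rho> ^ j" for j
  define \<delta> where "\<delta> j = dot (e j) / \<rho> ^ Suc j" for j
  have vS: "v (Suc j * p) = B *v v (j * p) + e j" for j by (simp add: e_def)
  have cS: "c (Suc j) = c j + \<delta> j" for j
    unfolding c_def vS dot_add dotB \<delta>_def using \<rho>(1) by (simp add: field_simps)
  have dote: "\<bar>dot (e j)\<bar> \<le> E" for j
  proof -
    have "\<bar>dot (e j)\<bar> \<le> (\<Sum>a\<in>UNIV. u $ a * E)"
      unfolding dot_def by (rule order_trans[OF sum_abs], rule sum_mono)
        (use u0 eE in \<open>auto simp: abs_mult less_imp_le intro!: mult_mono\<close>)
    then show ?thesis by (simp add: sum_distrib_right[symmetric] u1)
  qed
  have \<delta>E: "\<bar>\<delta> j\<bar> \<le> E / \<rho> * (1 / \<rho>) ^ j" for j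
    using dote[of j] \<rho>(1) by (simp add: \<delta>_def field_simps)
  \<comment> \<open>As the height vector has pairing \<open>\<rho> ^ j\<close> with \<open>u\<close>, this is the projection to the
    hyperplane orthogonal to \<open>u\<close> along the heights.\<close>
  define z where "z j = v (j * p) - c j *s H j" for j
  define e' where "e' j = e j - \<delta> j *s H (Suc j)" for j
  have zS: "z (Suc j) = B *v z j + e' j" for j
    unfolding z_def e'_def vS cS HS
    by (simp add: matrix_vector_mult_diff_distrib matrix_vector_scale vector_sadd_rdistrib)
  have dotz: "dot (z j) = 0" for j
    using \<rho>(1) by (simp add: z_def dot_diff dot_smult dotH c_def)
  have dote': "dot (e' j) = 0" for j
    using \<rho>(1) by (simp add: e'_def dot_diff dot_smult dotH \<delta>_def)
  define E' where "E' = real CARD('a) * (E + E * C1)"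
  have e'E: "norm (e' j) \<le> E'" for j
  proof -
    have "\<bar>e' j $ b\<bar> \<le> E + E * C1" for b
    proof -
      have "\<bar>\<delta> j * H (Suc j) $ b\<bar> \<le> (E / \<rho> * (1 / \<rho>) ^ j) * (C1 * \<rho> ^ Suc j)"
        unfolding abs_mult using \<delta>E[of j] Hup[of "Suc j" b] Hnn[of "Suc j" b] E0 \<rho>(1)
        by (intro mult_mono) auto
      also have "\<dots> = E * C1" using \<rho>(1) by (simp add: field_simps)
      finally show ?thesis using eE[of j b] by (simp add: e'_def)
    qed
    then have "(\<Sum>b\<in>UNIV. \<bar>e' j $ b\<bar>) \<le> (\<Sum>b\<in>(UNIV::'a set). E + E * C1)" by (rule sum_mono)
    then show ?thesis using norm_le_l1_cart[of "e' j"] by (simp add: E'_def)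
  qed
  have zb: "norm (z j) \<le> K * real (Suc j) ^ q * r ^ j * (norm (z 0) + real j * E')" for j
    by (rule perturbed_iteration_growth[where W = "{w. dot w = 0}" and B = B and e = e'])
      (use K dotz dote' e'E zS r1 in \<open>auto simp: dot_def\<close>)

  \<comment> \<open>The slopes \<open>c j\<close> converge geometrically, at the rate at which the heights grow.\<close>
  have sum\<delta>: "summable \<delta>"
    by (rule summable_comparison_test'[of "\<lambda>j. E / \<rho> * (1 / \<rho>) ^ j" 0])
      (use \<rho>1 \<delta>E in \<open>auto intro!: summable_mult summable_geometric\<close>)
  define cinf where "cinf = c 0 + suminf \<delta>"
  have cj: "c j = c 0 + (\<Sum>i<j. \<delta> i)" for j by (induction j) (simp_all add: cS)
  have ctail: "\<bar>cinf - c j\<bar> \<le> E / (\<rho> - 1) * (1 / \<rho>) ^ j" for j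
  proof -
    have "cinf - c j = (\<Sum>i. \<delta> (i + j))"
      unfolding cinf_def cj[of j] suminf_split_initial_segment[OF sum\<delta>, of j] by simp
    moreover have "\<bar>\<Sum>i. \<delta> (i + j)\<bar> \<le> (\<Sum>i. E / \<rho> * (1 / \<rho>) ^ j * (1 / \<rho>) ^ i)"
    proof (rule order_trans[OF summable_rabs suminf_le])
      have g: "summable (\<lambda>i. E / \<rho> * (1 / \<rho>) ^ j * (1 / \<rho>) ^ i)"
        using \<rho>1 by (intro summable_mult summable_geometric) auto
      have le: "\<bar>\<delta> (i + j)\<bar> \<le> E / \<rho> * (1 / \<rho>) ^ j * (1 / \<rho>) ^ i" for i
        using \<delta>E[of "i + j"] by (simp add: power_add mult_ac)
      show "summable (\<lambda>i. \<bar>\<delta> (i + j)\<bar>)"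
        by (rule summable_comparison_test'[OF g, of 0]) (use le in auto)
      then show "summable (\<lambda>i. \<bar>\<delta> (i + j)\<bar>)" .
      show "summable (\<lambda>i. E / \<rho> * (1 / \<rho>) ^ j * (1 / \<rho>) ^ i)" by (rule g)
      show "\<bar>\<delta> (i + j)\<bar> \<le> E / \<rho> * (1 / \<rho>) ^ j * (1 / \<rho>) ^ i" for i by (rule le)
    qed
    moreover have "(\<Sum>i. E / \<rho> * (1 / \<rho>) ^ j * (1 / \<rho>) ^ i) = E / (\<rho> - 1) * (1 / \<rho>) ^ j"
    proof -
      have "(\<Sum>i. (1 / \<rho>) ^ i) = 1 / (1 - 1 / \<rho>)" using \<rho>1 by (intro suminf_geometric) auto
      then have "(\<Sum>i. E / \<rho> * (1 / \<rho>) ^ j * (1 / \<rho>) ^ i) = E / \<rho> * (1 / \<rho>) ^ j * (1 / (1 - 1 / \<rho>))"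
        using \<rho>1 by (subst suminf_mult) (auto intro!: summable_geometric)
      also have "1 / (1 - 1 / \<rho>) = \<rho> / (\<rho> - 1)" using \<rho>1 by (simp add: field_simps)
      finally show ?thesis using \<rho>1 by simp
    qed
    ultimately show ?thesis by simp
  qed

  define g' where "g' x = g x - cinf * 1" for x
  define C2 where "C2 = K * (norm (z 0) + E') + V' + E / (\<rho> - 1) * C1"
  have E'0: "0 \<le> E'" using E0 C1 by (simp add: E'_def)
  have C2: "0 \<le> C2" using K(1) E'0 V'0 E0 C1 \<rho>1 by (simp add: C2_def)
  define \<Gamma> where "\<Gamma> j = C2 * real (Suc j) ^ Suc q * r ^ j" for j
  have \<Gamma>0: "0 \<le> \<Gamma> j" for j using C2 r1 by (simp add: \<Gamma>_def)
  have full: "\<bar>tower_sum D g' (j * p) x\<bar> \<le> \<Gamma> j" if x: "x \<in> base (DD (j * p))" for j x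
  proof -
    obtain b where b: "x \<in> exchanged (DD (j * p)) b" using exchanged_cover[OF adm_DD x] .
    have T: "tower_sum D g' (j * p) x = tower_sum D g (j * p) x - cinf * H j $ b"
      unfolding g'_def[abs_def] tower_sum_linear[of D g cinf "\<lambda>_. 1"] H_def tower_sum_one[OF b] ..
    have 1: "\<bar>tower_sum D g (j * p) x - v (j * p) $ b\<bar> \<le> V'"
      using osc[OF left_end_exchanged b] by (simp add: v_def)
    have 2: "\<bar>z j $ b\<bar> \<le> K * real (Suc j) ^ q * r ^ j * (norm (z 0) + real j * E')"
      using component_le_norm_cart[of "z j" b] zb[of j] by linarith
    have "\<bar>(cinf - c j) * H j $ b\<bar> \<le> (E / (\<rho> - 1) * (1 / \<rho>) ^ j) * (C1 * \<rho> ^ j)"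
      unfolding abs_mult using ctail[of j] Hup[of j b] Hnn[of j b] E0 \<rho>1
      by (intro mult_mono) auto
    also have "\<dots> = E / (\<rho> - 1) * C1" using \<rho>(1) by (simp add: power_one_over)
    finally have 3: "\<bar>(cinf - c j) * H j $ b\<bar> \<le> E / (\<rho> - 1) * C1" .
    have "tower_sum D g' (j * p) x = (tower_sum D g (j * p) x - v (j * p) $ b) + z j $ b - (cinf - c j) * H j $ b"
      unfolding T z_def by (simp add: algebra_simps)
    with 1 2 3 have le: "\<bar>tower_sum D g' (j * p) x\<bar>
       \<le> K * real (Suc j) ^ q * r ^ j * (norm (z 0) + real j * E') + (V' + E / (\<rho> - 1) * C1)" by linarith
    have "norm (z 0) + real j * E' \<le> real (Suc j) * (norm (z 0) + E')"
      using E'0 by (simp add: algebra_simps)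
    then have "K * real (Suc j) ^ q * r ^ j * (norm (z 0) + real j * E')
        \<le> K * real (Suc j) ^ q * r ^ j * (real (Suc j) * (norm (z 0) + E'))"
      using K(1) r1 by (intro mult_left_mono) auto
    also have "\<dots> = (K * (norm (z 0) + E')) * (real (Suc j) ^ Suc q * r ^ j)" by simp
    finally have 4: "K * real (Suc j) ^ q * r ^ j * (norm (z 0) + real j * E')
        \<le> (K * (norm (z 0) + E')) * (real (Suc j) ^ Suc q * r ^ j)" .
    have "1 * 1 \<le> real (Suc j) ^ Suc q * r ^ j"
      using r1 by (intro mult_mono one_le_power) auto
    then have "(V' + E / (\<rho> - 1) * C1) * 1 \<le> (V' + E / (\<rho> - 1) * C1) * (real (Suc j) ^ Suc q * r ^ j)"
      using V'0 E0 C1 \<rho>1 by (intro mult_left_mono) auto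
    with le 4 show ?thesis by (simp add: \<Gamma>_def C2_def algebra_simps)
  qed
  \<comment> \<open>Within a period each Rauzy step at most doubles the bound.\<close>
  have part: "\<bar>tower_sum D g' (j * p + m) x\<bar> \<le> 2 ^ m * \<Gamma> j" if "x \<in> base (DD (j * p + m))" for j m x
    using that
  proof (induction m arbitrary: x)
    case 0
    then show ?case using full by simp
  next
    case (Suc m)
    interpret st: rauzy_step "DD (j * p + m)" by (rule step)
    have x: "x \<in> base (DD (j * p + m))" using st.base_rauzy_subset Suc.prems by auto
    have "iet (DD (j * p + m)) x \<in> base (DD (j * p + m))" by (rule iet_maps_base[OF adm_DD x])
    from Suc.IH[OF x] Suc.IH[OF this] show ?case by auto
  qed
  define G where "G k = 2 ^ p * \<Gamma> (k div p)" for k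
  have G0: "0 \<le> G k" for k using \<Gamma>0 by (simp add: G_def)
  have G: "\<bar>tower_sum D g' k x\<bar> \<le> G k" if "x \<in> base (DD k)" for k x
  proof -
    have k: "k div p * p + k mod p = k" by simp
    have "\<bar>tower_sum D g' k x\<bar> \<le> 2 ^ (k mod p) * \<Gamma> (k div p)"
      using part[of x "k div p" "k mod p"] that unfolding k by simp
    also have "\<dots> \<le> G k"
      unfolding G_def using p0 \<Gamma>0 by (intro mult_right_mono power_increasing) (auto simp: less_imp_le)
    finally show ?thesis .
  qed
  have \<Gamma>mono: "\<Gamma> i \<le> \<Gamma> j" if "i \<le> j" for i j
    unfolding \<Gamma>_def using that C2 r1
    by (intro mult_mono power_mono power_increasing mult_nonneg_nonneg) auto
  define C3 where "C3 = 2 * real p * 2 ^ p * C2"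
  have C3: "0 \<le> C3" using C2 by (simp add: C3_def)
  have Msq: "Suc (Suc q) = CARD('a)" using two_symbols by (simp add: q_def)
  have bound: "\<bar>birkhoff_sum (iet D) g' n x\<bar> \<le> C3 * real (Suc (Suc j)) ^ CARD('a) * r ^ Suc j"
    if x: "x \<in> {0..<1}" and n: "real n < \<alpha> * \<rho> ^ j" for n x j
  proof -
    have n': "real n < height (Suc j * p) $ b" for b
      using n Hlow[of j b] by (simp add: H_def)
    have "\<bar>birkhoff_sum (iet D) g' n x\<bar> \<le> 2 * (\<Sum>i<Suc j * p. G i)"
      by (rule birkhoff_sum_le_tower_bounds[OF G G0 _ n']) (use x tl in auto)
    also have "(\<Sum>i<Suc j * p. G i) \<le> (\<Sum>i<Suc j * p. 2 ^ p * \<Gamma> (Suc j))"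
    proof (rule sum_mono)
      fix i assume "i \<in> {..<Suc j * p}"
      then have "i div p < Suc j" using p0 by (simp only: lessThan_iff less_mult_imp_div_less)
      then show "G i \<le> 2 ^ p * \<Gamma> (Suc j)" unfolding G_def by (intro mult_left_mono \<Gamma>mono) auto
    qed
    also have "2 * (\<Sum>i<Suc j * p. 2 ^ p * \<Gamma> (Suc j))
        = C3 * (real (Suc j) * real (Suc (Suc j)) ^ Suc q) * r ^ Suc j"
      by (simp add: C3_def \<Gamma>_def distrib_left)
    also have "\<dots> \<le> C3 * (real (Suc (Suc j)) * real (Suc (Suc j)) ^ Suc q) * r ^ Suc j"
      using C3 r1 by (intro mult_right_mono mult_left_mono) auto
    also have "real (Suc (Suc j)) * real (Suc (Suc j)) ^ Suc q = real (Suc (Suc j)) ^ CARD('a)"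
      by (simp flip: Msq)
    finally show ?thesis by simp
  qed
  \<comment> \<open>The heights after \<open>j + 1\<close> periods are at least \<open>\<alpha> * \<rho> ^ j\<close>. They exceed \<open>n\<close> as soon as
    \<open>j\<close> is at least \<open>ln n / \<theta>1 + a\<close>.\<close>
  define a where "a = max 0 (ln (2 / \<alpha>) / \<theta>1)"
  have \<theta>1: "0 < \<theta>1" using \<theta> by simp
  have a0: "0 \<le> a" by (simp add: a_def)
  have "ln (2 / \<alpha>) \<le> \<theta>1 * a" using \<theta>1 by (simp add: a_def field_simps max_def)
  then have "exp (ln (2 / \<alpha>)) \<le> exp (\<theta>1 * a)" by (subst exp_le_cancel_iff)
  then have a1: "2 \<le> \<alpha> * exp (\<theta>1 * a)" using \<alpha>0 by (simp add: field_simps)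
  define s where "s = 1 / \<theta>1 + (a + 3) / ln 2"
  have s0: "0 < s" using \<theta>1 a0 unfolding s_def by (intro add_pos_nonneg divide_pos_pos divide_nonneg_pos) auto
  define C where "C = C3 * s ^ CARD('a) * exp (\<theta>2 * (a + 2)) + 1"
  have final: "\<bar>birkhoff_sum (iet D) g n x - real n * cinf\<bar>
      \<le> C * ln (real n) ^ CARD('a) * real n powr (\<theta>2 / \<theta>1)"
    if n: "2 \<le> n" and x: "x \<in> {0..<1}" for n x
  proof -
    define t where "t = ln (real n) / \<theta>1"
    have t0: "0 \<le> t" using n \<theta>1 by (simp add: t_def)
    define j where "j = nat \<lceil>t + a\<rceil>"
    have j1: "t + a \<le> real j" unfolding j_def by (rule real_nat_ceiling_ge)
    have j2: "real j \<le> t + a + 1" unfolding j_def using t0 a0 by linarith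
    have nexp: "real n = exp (\<theta>1 * t)" using n \<theta>1 by (simp add: t_def)
    have "real n * 2 \<le> exp (\<theta>1 * t) * (\<alpha> * exp (\<theta>1 * a))"
      unfolding nexp using a1 by (intro mult_left_mono) auto
    also have "\<dots> = \<alpha> * exp (\<theta>1 * (t + a))" by (simp add: exp_add algebra_simps)
    also have "\<dots> \<le> \<alpha> * exp (\<theta>1 * real j)" using \<alpha>0 \<theta>1 j1 by simp
    also have "exp (\<theta>1 * real j) = \<rho> ^ j" by (simp add: \<rho>\<theta> exp_of_nat2_mult)
    finally have nj: "real n < \<alpha> * \<rho> ^ j" using n by simp
    have ln2: "ln 2 \<le> ln (real n)" using n by simp
    have "real (Suc (Suc j)) \<le> t + (a + 3)" using j2 by simp
    also have "\<dots> \<le> t + (a + 3) / ln 2 * ln (real n)"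
    proof -
      have "(a + 3) * ln 2 \<le> (a + 3) * ln (real n)" using a0 ln2 by (intro mult_left_mono) auto
      then show ?thesis by (simp add: field_simps)
    qed
    also have "\<dots> = s * ln (real n)" by (simp add: s_def t_def algebra_simps)
    finally have sj: "real (Suc (Suc j)) \<le> s * ln (real n)" .
    have "r ^ Suc j = exp (\<theta>2 * real (Suc j))" unfolding r_def by (rule exp_of_nat2_mult[symmetric])
    also have "\<dots> \<le> exp (\<theta>2 * (t + a + 2))" using \<theta>(3) j2 by (simp add: mult_left_mono)
    also have "\<dots> = exp (\<theta>2 * (a + 2)) * exp (\<theta>2 * t)" by (simp add: exp_add[symmetric] algebra_simps)
    also have "exp (\<theta>2 * t) = real n powr (\<theta>2 / \<theta>1)" using n by (simp add: powr_def t_def)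
    finally have rj: "r ^ Suc j \<le> exp (\<theta>2 * (a + 2)) * real n powr (\<theta>2 / \<theta>1)" .
    have "birkhoff_sum (iet D) g' n x = birkhoff_sum (iet D) g n x - real n * cinf"
      by (simp add: birkhoff_sum_def g'_def sum_subtractf)
    then have "\<bar>birkhoff_sum (iet D) g n x - real n * cinf\<bar> \<le> C3 * real (Suc (Suc j)) ^ CARD('a) * r ^ Suc j"
      using bound[OF x nj] by simp
    also have "\<dots> \<le> C3 * (s * ln (real n)) ^ CARD('a) * (exp (\<theta>2 * (a + 2)) * real n powr (\<theta>2 / \<theta>1))"
      using C3 sj rj r1 by (intro mult_mono power_mono mult_left_mono mult_nonneg_nonneg) auto
    also have "\<dots> = (C - 1) * (ln (real n) ^ CARD('a) * real n powr (\<theta>2 / \<theta>1))"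
      by (simp add: C_def power_mult_distrib)
    also have "\<dots> \<le> C * (ln (real n) ^ CARD('a) * real n powr (\<theta>2 / \<theta>1))"
      using n by (intro mult_right_mono) auto
    finally show ?thesis by simp
  qed
  have "0 < C" using C3 s0 by (auto simp: C_def intro!: add_nonneg_pos)
  with final show thesis by (rule that[rotated])
qed

section \<open>Recurrence of skew products with slowly growing cocycles\<close>

text \<open>
  Each visit between a late time and \<open>n\<close> weighs at least \<open>\<omega> n\<close>, so together these visits cost no more
  than the small tail of the convergent sum. The visits before that time are bounded in number, and
  \<open>\<omega> n\<close> tends to \<open>0\<close>.
\<close>

lemma visits_negligible_if_weights_summable:
  fixes \<omega> :: "real \<Rightarrow> real" and V :: "nat set"
  assumes \<omega>: "weight_from \<omega> m" and lim: "(\<lambda>n. \<omega> (real n)) \<longlonglongrightarrow> 0"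
    and fin: "(\<Sum>i. indicator V (m + i) * ennreal (\<omega> (real (m + i)))) \<noteq> \<infinity>" and \<epsilon>: "0 < \<epsilon>"
  shows "eventually (\<lambda>n. \<omega> (real n) * real (card (V \<inter> {..n})) < \<epsilon>) sequentially"
proof -
  define a where "a i = indicator V (m + i) * \<omega> (real (m + i))" for i
  have pos: "0 < \<omega> (real n)" if "m \<le> n" for n using \<omega> that by (simp add: weight_from_def)
  have mono: "\<omega> (real n) \<le> \<omega> (real i)" if "m \<le> i" "i \<le> n" for i n
    using \<omega> that by (auto simp: weight_from_def monotone_on_def)
  have a0: "0 \<le> a i" for i using pos[of "m + i"] by (simp add: a_def indicator_def less_imp_le)
  have "indicator V (m + i) * ennreal (\<omega> (real (m + i))) = ennreal (a i)" for i
    by (auto simp: a_def indicator_def)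
  then have sum: "summable a" using fin a0 by (intro summable_suminf_not_top) auto
  then obtain K where K: "\<And>k n. K \<le> k \<Longrightarrow> norm (sum a {k..<n}) < \<epsilon> / 2"
    unfolding summable_Cauchy using \<epsilon> by (metis half_gt_zero)
  have "(\<lambda>n. \<omega> (real n) * real (m + K)) \<longlonglongrightarrow> 0 * real (m + K)"
    by (intro tendsto_mult lim tendsto_const)
  then have "(\<lambda>n. \<omega> (real n) * real (m + K)) \<longlonglongrightarrow> 0" by simp
  then have "eventually (\<lambda>n. \<omega> (real n) * real (m + K) < \<epsilon> / 2) sequentially"
    using \<epsilon> by (intro order_tendstoD) auto
  then show ?thesis using eventually_ge_at_top[of "m + K"]
  proof eventually_elim
    case (elim n)
    let ?late = "V \<inter> {m + K..n}"
    have "V \<inter> {..n} \<subseteq> {..<m + K} \<union> ?late" by auto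
    then have "card (V \<inter> {..n}) \<le> card ({..<m + K} \<union> ?late)" by (rule card_mono[rotated]) auto
    also have "\<dots> \<le> (m + K) + card ?late" using card_Un_le[of "{..<m + K}" ?late] by simp
    finally have card: "real (card (V \<inter> {..n})) \<le> real (m + K) + real (card ?late)" by linarith
    have "\<omega> (real n) * real (card ?late) = (\<Sum>i\<in>?late. \<omega> (real n))" by simp
    also have "\<dots> \<le> (\<Sum>i\<in>?late. \<omega> (real i))" by (rule sum_mono) (rule mono, auto)
    also have "\<dots> = (\<Sum>i\<in>(\<lambda>i. i - m) ` ?late. a i)"
      by (subst sum.reindex) (auto simp: inj_on_def a_def indicator_def intro!: sum.cong)
    also have "\<dots> \<le> sum a {K..<Suc (n - m)}"
      by (rule sum_mono2) (use a0 in auto)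
    also have "\<dots> < \<epsilon> / 2" using K[of K "Suc (n - m)"] by simp
    finally have "\<omega> (real n) * real (card ?late) < \<epsilon> / 2" .
    moreover have "\<omega> (real n) * real (card (V \<inter> {..n})) \<le> \<omega> (real n) * (real (m + K) + real (card ?late))"
      using pos[of n] elim card by (intro mult_left_mono) auto
    ultimately show ?case using elim by (simp add: distrib_left)
  qed
qed

text \<open>
  The exceptional times at one level follow each other within the window of length \<open>n\<close>, so the first
  of them is followed by all the others; hence there are at most \<open>\<kappa> + 1\<close> of them. The bound on \<open>lev\<close>
  leaves at most \<open>2 * a + 1\<close> levels.
\<close>

lemma few_times_with_few_returns:
  fixes lev :: "nat \<Rightarrow> int" and X :: "nat set" and a \<kappa> :: real
  assumes lev: "\<And>i. i < n \<Longrightarrow> \<bar>real_of_int (lev i)\<bar> \<le> a" and a: "0 \<le> a" and \<kappa>: "0 \<le> \<kappa>"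
  shows "real (card {i. i < n \<and> i \<in> X \<and> real (card {j \<in> {i<..i + n}. j \<in> X \<and> lev j = lev i}) < \<kappa>})
     \<le> (2 * a + 1) * (\<kappa> + 1)"
proof -
  let ?ret = "\<lambda>i. {j \<in> {i<..i + n}. j \<in> X \<and> lev j = lev i}"
  let ?Bad = "{i. i < n \<and> i \<in> X \<and> real (card (?ret i)) < \<kappa>}"
  let ?I = "{-\<lfloor>a\<rfloor>..\<lfloor>a\<rfloor>}"
  define Bg where "Bg g = {i \<in> ?Bad. lev i = g}" for g
  have fin: "finite (Bg g)" for g unfolding Bg_def by simp
  have Bg: "real (card (Bg g)) \<le> \<kappa> + 1" for g
  proof (cases "Bg g = {}")
    case False
    define i where "i = Min (Bg g)"
    have i: "i \<in> Bg g" unfolding i_def by (rule Min_in[OF fin False])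
    have "Bg g - {i} \<subseteq> ?ret i"
    proof
      fix j assume j: "j \<in> Bg g - {i}"
      then have "i \<le> j" unfolding i_def using fin by (intro Min_le) auto
      with j i show "j \<in> ?ret i" by (auto simp: Bg_def)
    qed
    then have "card (Bg g - {i}) \<le> card (?ret i)" by (rule card_mono[rotated]) simp
    moreover have "real (card (?ret i)) < \<kappa>" using i unfolding Bg_def by blast
    moreover have "card (Bg g) = Suc (card (Bg g - {i}))" using i fin by (metis card.remove)
    ultimately show ?thesis by simp
  qed (use \<kappa> in simp)
  have "?Bad \<subseteq> (\<Union>g\<in>?I. Bg g)"
  proof
    fix i assume i: "i \<in> ?Bad"
    then have "\<bar>real_of_int (lev i)\<bar> \<le> a" using lev by blast
    then have "lev i \<in> ?I" by (auto simp: le_floor_iff abs_le_iff) linarith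
    with i show "i \<in> (\<Union>g\<in>?I. Bg g)" by (auto simp: Bg_def)
  qed
  then have "card ?Bad \<le> card (\<Union>g\<in>?I. Bg g)" by (rule card_mono[rotated]) (use fin in auto)
  also have "\<dots> \<le> (\<Sum>g\<in>?I. card (Bg g))" by (rule card_UN_le) simp
  finally have "real (card ?Bad) \<le> (\<Sum>g\<in>?I. real (card (Bg g)))" by (simp flip: of_nat_sum)
  also have "\<dots> \<le> (\<Sum>g\<in>?I. \<kappa> + 1)" by (rule sum_mono) (rule Bg)
  also have "\<dots> = real (card ?I) * (\<kappa> + 1)" by simp
  also have "\<dots> \<le> (2 * a + 1) * (\<kappa> + 1)"
  proof (rule mult_right_mono)
    have "0 \<le> \<lfloor>a\<rfloor>" using a by simp
    then have "real (card ?I) = 2 * real_of_int \<lfloor>a\<rfloor> + 1" by simp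
    then show "real (card ?I) \<le> 2 * a + 1" by linarith
  qed (use \<kappa> in simp)
  finally show ?thesis .
qed

lemma birkhoff_sum_add: "birkhoff_sum S g (i + j) x = birkhoff_sum S g i x + birkhoff_sum S g j ((S ^^ i) x)"
proof (induction i arbitrary: x)
  case (Suc i)
  then show ?case
    by (simp add: birkhoff_sum_Suc funpow_Suc_right add.assoc del: funpow.simps(2))
qed simp

lemma skew_product_funpow: "(skew_product S f ^^ n) (y, g) = ((S ^^ n) y, g + birkhoff_sum S f n y)"
proof (induction n arbitrary: y g)
  case (Suc n)
  then show ?case
    by (simp add: skew_product_def birkhoff_sum_Suc funpow_Suc_right add.assoc del: funpow.simps(2))
qed simp

lemma (in finite_measure) limsup_positive_measure:
  assumes G: "\<And>n. G n \<in> sets M" and \<beta>: "0 < \<beta>" and ge: "eventually (\<lambda>n. \<beta> \<le> measure M (G n)) sequentially"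
  shows "0 < measure M (\<Inter>n. \<Union>k\<in>{n..}. G k)"
proof -
  let ?E = "\<lambda>n. \<Union>k\<in>{n..}. G k"
  have "(\<lambda>n. measure M (?E n)) \<longlonglongrightarrow> measure M (\<Inter>n. ?E n)"
  proof (rule finite_Lim_measure_decseq)
    show "range ?E \<subseteq> sets M" using G by auto
    show "decseq ?E" unfolding decseq_def by (intro allI impI UN_mono) auto
  qed
  moreover have "eventually (\<lambda>n. \<beta> \<le> measure M (?E n)) sequentially"
    using ge
  proof eventually_elim
    case (elim n)
    also have "measure M (G n) \<le> measure M (?E n)" using G by (intro finite_measure_mono) auto
    finally show ?case .
  qed
  ultimately have "\<beta> \<le> measure M (\<Inter>n. ?E n)"
    by (rule tendsto_lowerbound) simp
  with \<beta> show ?thesis by linarith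
qed

locale ergodic_skew_product = prob: finite_measure M
  for M :: "'b measure" and S :: "'b \<Rightarrow> 'b" and f :: "'b \<Rightarrow> int" +
  assumes S_meas [measurable]: "S \<in> measurable M M"
    and S_pres: "\<And>A. A \<in> sets M \<Longrightarrow> emeasure M (S -` A \<inter> space M) = emeasure M A"
    and erg: "ergodic (M \<Otimes>\<^sub>M count_space UNIV) (skew_product S f)"
begin

abbreviation "N \<equiv> M \<Otimes>\<^sub>M (count_space UNIV :: int measure)"
abbreviation "T \<equiv> skew_product S f"

lemma T_meas [measurable]: "T \<in> measurable N N"
  using erg by (simp add: ergodic_def)

lemma f_meas [measurable]: "f \<in> measurable M (count_space UNIV)"
proof -
  have "(\<lambda>y. snd (T (y, 0))) \<in> measurable M (count_space UNIV)" by measurable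
  then show ?thesis by (simp add: skew_product_def)
qed

lemma S_funpow_meas [measurable]: "(S ^^ n) \<in> measurable M M"
  by (induction n) auto

lemma T_funpow_meas [measurable]: "(T ^^ n) \<in> measurable N N"
  by (induction n) auto

lemma birkhoff_meas [measurable]: "birkhoff_sum S f n \<in> measurable M (count_space UNIV)"
proof -
  have "(\<lambda>y. snd ((T ^^ n) (y, 0))) \<in> measurable M (count_space UNIV)" by measurable
  then show ?thesis by (simp add: skew_product_funpow)
qed

lemma S_space: "y \<in> space M \<Longrightarrow> (S ^^ n) y \<in> space M"
  using measurable_space[OF S_funpow_meas] .

lemma space_N: "space N = space M \<times> UNIV"
  by (simp add: space_pair_measure)

lemma S_funpow_pres:
  assumes "A \<in> sets M"
  shows "emeasure M ((S ^^ n) -` A \<inter> space M) = emeasure M A"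
  using assms
proof (induction n arbitrary: A)
  case 0
  then show ?case using sets.sets_into_space by (simp add: Int_absorb2)
next
  case (Suc n)
  have "(S ^^ Suc n) -` A \<inter> space M = (S ^^ n) -` (S -` A \<inter> space M) \<inter> space M"
    using S_space[of _ n] by auto
  then have "emeasure M ((S ^^ Suc n) -` A \<inter> space M) = emeasure M (S -` A \<inter> space M)"
    using Suc.IH[of "S -` A \<inter> space M"] measurable_sets[OF S_meas Suc.prems] by (simp only:)
  then show ?case using S_pres[OF Suc.prems] by (simp only:)
qed

lemma measure_S_funpow:
  "A \<in> sets M \<Longrightarrow> measure M ((S ^^ n) -` A \<inter> space M) = measure M A"
  using S_funpow_pres by (simp add: measure_def)

text \<open>
  Integrating the pigeonhole estimate along the orbit of \<open>S\<close>: the orbit visits \<open>A\<close> with frequency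
  \<open>measure M A\<close>, and apart from few exceptions each visit is followed by many
  simultaneous returns to \<open>A\<close> and to the same level. By invariance of the measure, the points of \<open>A\<close>
  with many returns have almost the full measure of \<open>A\<close>.
\<close>
lemma many_returns_measure:
  assumes A [measurable]: "A \<in> sets M" and a: "0 \<le> a" and \<kappa>: "0 \<le> \<kappa>"
    and bnd: "\<And>i y. i < n \<Longrightarrow> y \<in> space M \<Longrightarrow> \<bar>real_of_int (birkhoff_sum S f i y)\<bar> \<le> a"
  defines "G \<equiv> {y \<in> A. \<kappa> \<le> real (card {j \<in> {0<..n}. (S ^^ j) y \<in> A \<and> birkhoff_sum S f j y = 0})}"
  shows "G \<in> sets M"
    and "real n * measure M A \<le> real n * measure M G + (2 * a + 1) * (\<kappa> + 1) * measure M (space M)"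
proof -
  have As: "A \<subseteq> space M" using A by (rule sets.sets_into_space)
  have card_eq: "real (card {j \<in> {0<..n}. P j}) = (\<Sum>j\<in>{0<..n}. if P j then 1 else 0)" for P
    by (simp add: sum.If_cases Int_def)
  have "{y \<in> space M. y \<in> A \<and> \<kappa> \<le> (\<Sum>j\<in>{0<..n}. if (S ^^ j) y \<in> A \<and> birkhoff_sum S f j y = 0 then 1 else (0::real))} \<in> sets M"
    by measurable
  also have "{y \<in> space M. y \<in> A \<and> \<kappa> \<le> (\<Sum>j\<in>{0<..n}. if (S ^^ j) y \<in> A \<and> birkhoff_sum S f j y = 0 then 1 else (0::real))} = G"
    unfolding G_def card_eq using As by auto
  finally show G [measurable]: "G \<in> sets M" .
  let ?c = "(2 * a + 1) * (\<kappa> + 1)"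
  have pt: "(\<Sum>i<n. indicator A ((S ^^ i) y)) \<le> (\<Sum>i<n. indicator G ((S ^^ i) y)) + ?c"
    if y: "y \<in> space M" for y
  proof -
    let ?lev = "\<lambda>i. birkhoff_sum S f i y" and ?X = "{i. (S ^^ i) y \<in> A}"
    let ?Bad = "{i. i < n \<and> i \<in> ?X \<and> real (card {j \<in> {i<..i + n}. j \<in> ?X \<and> ?lev j = ?lev i}) < \<kappa>}"
    have ret: "card {j \<in> {i<..i + n}. j \<in> ?X \<and> ?lev j = ?lev i}
       = card {j \<in> {0<..n}. (S ^^ j) ((S ^^ i) y) \<in> A \<and> birkhoff_sum S f j ((S ^^ i) y) = 0}" for i
    proof -
      have "{j \<in> {i<..i + n}. j \<in> ?X \<and> ?lev j = ?lev i}
        = (\<lambda>j. i + j) ` {j \<in> {0<..n}. (S ^^ j) ((S ^^ i) y) \<in> A \<and> birkhoff_sum S f j ((S ^^ i) y) = 0}"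
      proof (intro set_eqI iffI)
        fix j assume j: "j \<in> {j \<in> {i<..i + n}. j \<in> ?X \<and> ?lev j = ?lev i}"
        then obtain k where k: "j = i + k" by (auto simp: less_iff_Suc_add)
        have "(S ^^ j) y = (S ^^ k) ((S ^^ i) y)" unfolding k by (metis add.commute comp_apply funpow_add)
        with j show "j \<in> (\<lambda>j. i + j) ` {j \<in> {0<..n}. (S ^^ j) ((S ^^ i) y) \<in> A \<and> birkhoff_sum S f j ((S ^^ i) y) = 0}"
          unfolding k by (intro image_eqI[of _ _ k]) (auto simp: birkhoff_sum_add)
      next
        fix j assume "j \<in> (\<lambda>j. i + j) ` {j \<in> {0<..n}. (S ^^ j) ((S ^^ i) y) \<in> A \<and> birkhoff_sum S f j ((S ^^ i) y) = 0}"
        then obtain k where k: "j = i + k" "k \<in> {0<..n}" "(S ^^ k) ((S ^^ i) y) \<in> A"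
          "birkhoff_sum S f k ((S ^^ i) y) = 0" by blast
        have "(S ^^ j) y = (S ^^ k) ((S ^^ i) y)" unfolding k(1) by (metis add.commute comp_apply funpow_add)
        then show "j \<in> {j \<in> {i<..i + n}. j \<in> ?X \<and> ?lev j = ?lev i}" using k by (auto simp: birkhoff_sum_add)
      qed
      then show ?thesis by (simp add: card_image)
    qed
    have "(\<Sum>i<n. indicator A ((S ^^ i) y)) \<le> (\<Sum>i<n. indicator G ((S ^^ i) y) + (if i \<in> ?Bad then 1 else (0::real)))"
    proof (rule sum_mono)
      fix i assume "i \<in> {..<n}"
      then show "indicator A ((S ^^ i) y) \<le> indicator G ((S ^^ i) y) + (if i \<in> ?Bad then 1 else (0::real))"
        using ret[of i] unfolding G_def by (auto simp: indicator_def not_le)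
    qed
    also have "\<dots> = (\<Sum>i<n. indicator G ((S ^^ i) y)) + (\<Sum>i<n. if i \<in> ?Bad then 1 else (0::real))"
      by (rule sum.distrib)
    also have "(\<Sum>i<n. if i \<in> ?Bad then 1 else (0::real)) = real (card ?Bad)"
      by (subst sum.inter_filter[symmetric]) (auto intro!: arg_cong[where f = card])
    also have "\<dots> \<le> ?c"
      by (rule few_times_with_few_returns) (use bnd y a \<kappa> in auto)
    finally show ?thesis by simp
  qed
  have int: "integrable M (\<lambda>y. indicator B ((S ^^ i) y) :: real)"
    and val: "(\<integral>y. indicator B ((S ^^ i) y) \<partial>M) = measure M B" if B [measurable]: "B \<in> sets M" for B i
  proof -
    have eq: "indicator B ((S ^^ i) y) = (indicator ((S ^^ i) -` B \<inter> space M) y :: real)" if "y \<in> space M" for y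
      using that by (simp add: indicator_def)
    show "integrable M (\<lambda>y. indicator B ((S ^^ i) y) :: real)"
      by (rule prob.integrable_const_bound[where B = 1]) auto
    have "(\<integral>y. indicator B ((S ^^ i) y) \<partial>M) = (\<integral>y. indicator ((S ^^ i) -` B \<inter> space M) y \<partial>M :: real)"
      by (rule Bochner_Integration.integral_cong) (use eq in auto)
    also have "\<dots> = measure M ((S ^^ i) -` B \<inter> space M)"
      by (simp add: Int_absorb1)
    finally show "(\<integral>y. indicator B ((S ^^ i) y) \<partial>M) = measure M B" by (simp add: measure_S_funpow)
  qed
  have "(\<integral>y. (\<Sum>i<n. indicator A ((S ^^ i) y)) \<partial>M) \<le> (\<integral>y. (\<Sum>i<n. indicator G ((S ^^ i) y)) + ?c \<partial>M)"
    using int pt by (intro integral_mono) auto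
  then show "real n * measure M A \<le> real n * measure M G + ?c * measure M (space M)"
    using int by (simp add: val mult_ac)
qed

text \<open>
  The set where \<open>\<zeta>\<close> diverges is strictly invariant, because consecutive weights are comparable; it
  therefore suffices to find it of positive measure.
\<close>

lemma zeta_infinite_AE:
  assumes A: "A \<in> sets N" and \<omega>: "weight_from \<omega> m"
    and comp: "\<And>n. m \<le> n \<Longrightarrow> \<omega> (real n) \<le> 2 * \<omega> (real (Suc n))"
    and Z: "Z \<in> sets M" "0 < measure M Z" "\<And>y. y \<in> Z \<Longrightarrow> zeta_sum T \<omega> A m (y, g) = \<infinity>"
  shows "AE x in N. zeta_sum T \<omega> A m x = \<infinity>"
proof -
  have [measurable]: "A \<in> sets N" by (rule A)
  have [measurable]: "Z \<in> sets M" by (rule Z)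
  have zm [measurable]: "zeta_sum T \<omega> A m \<in> borel_measurable N"
    unfolding zeta_sum_def[abs_def] by measurable
  define E where "E = {x \<in> space N. zeta_sum T \<omega> A m x = \<infinity>}"
  have Em: "E \<in> sets N" unfolding E_def by measurable
  have pos: "0 < \<omega> (real n)" if "m \<le> n" for n using \<omega> that by (simp add: weight_from_def)
  have mono: "\<omega> (real (Suc n)) \<le> \<omega> (real n)" if "m \<le> n" for n
    using \<omega> that by (auto simp: weight_from_def monotone_on_def)
  have inv: "zeta_sum T \<omega> A m (T x) = \<infinity> \<longleftrightarrow> zeta_sum T \<omega> A m x = \<infinity>" for x
  proof -
    define I where "I i = (indicator A ((T ^^ (m + i)) x) :: ennreal)" for i
    have I1: "I i \<le> 1" for i by (simp add: I_def indicator_def)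
    have sw: "(T ^^ n) (T x) = T ((T ^^ n) x)" for n by (simp add: funpow_swap1)
    have zT: "zeta_sum T \<omega> A m (T x) = (\<Sum>i. I (Suc i) * ennreal (\<omega> (real (m + i))))"
      unfolding zeta_sum_def I_def by (simp add: sw)
    have z: "zeta_sum T \<omega> A m x = I 0 * ennreal (\<omega> (real m)) + (\<Sum>i. I (Suc i) * ennreal (\<omega> (real (Suc (m + i)))))"
      unfolding zeta_sum_def I_def[symmetric] by (subst suminf_offset[of _ 1]) auto
    have fin: "I 0 * ennreal (\<omega> (real m)) \<noteq> \<infinity>"
      using I1[of 0] by (auto simp: I_def indicator_def)
    have le1: "(\<Sum>i. I (Suc i) * ennreal (\<omega> (real (Suc (m + i))))) \<le> (\<Sum>i. I (Suc i) * ennreal (\<omega> (real (m + i))))"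
      by (intro suminf_le mult_left_mono ennreal_leI mono) auto
    have le2: "(\<Sum>i. I (Suc i) * ennreal (\<omega> (real (m + i)))) \<le> 2 * (\<Sum>i. I (Suc i) * ennreal (\<omega> (real (Suc (m + i)))))"
    proof -
      have "ennreal (\<omega> (real (m + i))) \<le> 2 * ennreal (\<omega> (real (Suc (m + i))))" for i
        using ennreal_leI[OF comp[of "m + i"]] pos[of "Suc (m + i)"]
        by (simp add: ennreal_mult less_imp_le)
      then have "I (Suc i) * ennreal (\<omega> (real (m + i))) \<le> 2 * (I (Suc i) * ennreal (\<omega> (real (Suc (m + i)))))" for i
        using mult_left_mono[of "ennreal (\<omega> (real (m + i)))" _ "I (Suc i)"] by (simp add: mult.left_commute)
      then have "(\<Sum>i. I (Suc i) * ennreal (\<omega> (real (m + i)))) \<le> (\<Sum>i. 2 * (I (Suc i) * ennreal (\<omega> (real (Suc (m + i))))))"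
        by (intro suminf_le) auto
      then show ?thesis by simp
    qed
    show ?thesis
    proof
      assume "zeta_sum T \<omega> A m (T x) = \<infinity>"
      then have "2 * (\<Sum>i. I (Suc i) * ennreal (\<omega> (real (Suc (m + i))))) = \<infinity>"
        using le2 unfolding zT by (simp add: top_unique)
      then show "zeta_sum T \<omega> A m x = \<infinity>" unfolding z by (auto simp: ennreal_mult_eq_top_iff)
    next
      assume "zeta_sum T \<omega> A m x = \<infinity>"
      then have "(\<Sum>i. I (Suc i) * ennreal (\<omega> (real (Suc (m + i))))) = \<infinity>"
        using fin unfolding z by (auto simp: ennreal_add_eq_top)
      then show "zeta_sum T \<omega> A m (T x) = \<infinity>" using le1 unfolding zT by (simp add: top_unique)
    qed
  qed
  have "T -` E \<inter> space N = E"
    using inv measurable_space[OF T_meas] by (auto simp: E_def)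
  then have zo: "emeasure N E = 0 \<or> emeasure N (space N - E) = 0"
    using erg Em by (auto simp: ergodic_def)
  have sub: "Z \<times> {g} \<subseteq> E"
    using Z(3) sets.sets_into_space[OF Z(1)] by (auto simp: E_def space_N)
  interpret C: sigma_finite_measure "count_space (UNIV :: int set)"
    by (rule sigma_finite_measure_count_space)
  have "emeasure N (Z \<times> {g}) = emeasure M Z"
    by (subst C.emeasure_pair_measure_Times) auto
  also have "\<dots> > 0" using Z(2) by (simp add: prob.emeasure_eq_measure)
  finally have "0 < emeasure N E" using emeasure_mono[OF sub Em] by (simp add: less_le_trans)
  with zo have "emeasure N (space N - E) = 0" by (metis less_irrefl)
  then show ?thesis
    using Em by (intro AE_I[of _ _ "space N - E"]) (auto simp: E_def)
qed

text \<open>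
  For \<open>n * \<omega> n\<close> proportional to a bound for the cocycle up to time \<open>n\<close>, \<open>many_returns_measure\<close> gives,
  for every large \<open>n\<close>, a set of measure bounded below on which the number of returns up to time
  \<open>n\<close> is at least a constant divided by \<open>\<omega> n\<close>. On their upper limit this happens for infinitely many
  \<open>n\<close>, which forces the weighted sum to diverge. The level of \<open>A\<close> is immaterial, since the skew
  product commutes with translations of the levels.
\<close>
theorem omega_recurrence:
  assumes A: "A \<in> sets N" "0 < emeasure N A" and \<omega>: "weight_from \<omega> m"
    and comp: "\<And>n. m \<le> n \<Longrightarrow> \<omega> (real n) \<le> 2 * \<omega> (real (Suc n))"
    and lim: "(\<lambda>n. \<omega> (real n)) \<longlonglongrightarrow> 0"
    and C: "0 < C" and one: "eventually (\<lambda>n. 1 \<le> C * real n * \<omega> (real n)) sequentially"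
    and bnd: "eventually (\<lambda>n. \<forall>i<n. \<forall>y\<in>space M.
      \<bar>real_of_int (birkhoff_sum S f i y)\<bar> \<le> C * real n * \<omega> (real n)) sequentially"
  shows "AE x in N. zeta_sum T \<omega> A m x = \<infinity>"
proof -
  interpret Cs: sigma_finite_measure "count_space (UNIV :: int set)"
    by (rule sigma_finite_measure_count_space)
  have pos: "0 < \<omega> (real n)" if "m \<le> n" for n using \<omega> that by (simp add: weight_from_def)
  define sl where "sl g = (\<lambda>y. (y, g)) -` A \<inter> space M" for g :: int
  have sl [measurable]: "sl g \<in> sets M" for g
    unfolding sl_def by (rule measurable_sets[OF _ A(1)]) measurable
  have "\<exists>g. 0 < measure M (sl g)"
  proof (rule ccontr)
    assume "\<nexists>g. 0 < measure M (sl g)"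
    then have "measure M (sl g) = 0" for g using measure_nonneg[of M "sl g"] by (metis less_le)
    then have z: "emeasure M (sl g) = 0" for g by (simp add: prob.emeasure_eq_measure)
    have "A \<subseteq> (\<Union>g. sl g \<times> {g})"
      using sets.sets_into_space[OF A(1)] by (auto simp: sl_def space_N)
    then have "emeasure N A \<le> emeasure N (\<Union>g. sl g \<times> {g})"
      by (rule emeasure_mono) (intro sets.countable_UN', auto)
    also have "\<dots> = 0"
    proof -
      have "sl g \<times> {g} \<in> null_sets N" for g
        using z[of g] by (auto simp: null_sets_def Cs.emeasure_pair_measure_Times)
      then have "(\<Union>g. sl g \<times> {g}) \<in> null_sets N" by (intro null_sets_UN) auto
      then show ?thesis by auto
    qed
    finally show False using A(2) by simp
  qed
  then obtain g where g: "0 < measure M (sl g)" by blast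
  define A' where "A' = sl g"
  have A'm [measurable]: "A' \<in> sets M" by (simp add: A'_def)
  define \<beta> where "\<beta> = measure M A'"
  have \<beta>: "0 < \<beta>" using g by (simp add: \<beta>_def A'_def)
  define \<mu> where "\<mu> = measure M (space M)"
  have \<mu>: "0 < \<mu>" using \<beta> prob.bounded_measure[of A'] by (simp add: \<mu>_def \<beta>_def)
  \<comment> \<open>With \<open>b = C * n * \<omega> n\<close> the exceptional set costs at most \<open>3 * b * (\<kappa> + 1) * \<mu>\<close>. The choice
    \<open>\<kappa> = \<delta> * n / b\<close> and \<open>b \<le> \<delta> * n\<close> bound this by \<open>6 * \<delta> * \<mu> * n\<close>, which is half of \<open>\<beta> * n\<close>.\<close>
  define \<delta> where "\<delta> = \<beta> / (12 * \<mu>)"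
  have \<delta>: "0 < \<delta>" using \<beta> \<mu> by (simp add: \<delta>_def)
  define \<kappa> where "\<kappa> n = \<delta> / (C * \<omega> (real n))" for n
  define G where "G n = (if m \<le> n \<and> 0 < n \<and> 1 \<le> C * real n * \<omega> (real n) \<and>
      (\<forall>i<n. \<forall>y\<in>space M. \<bar>real_of_int (birkhoff_sum S f i y)\<bar> \<le> C * real n * \<omega> (real n))
    then {y \<in> A'. \<kappa> n \<le> real (card {j \<in> {0<..n}. (S ^^ j) y \<in> A' \<and> birkhoff_sum S f j y = 0})} else {})" for n
  have \<kappa>0: "0 \<le> \<kappa> n" if "m \<le> n" for n using pos[OF that] \<delta> C by (simp add: \<kappa>_def)
  have Gm: "G n \<in> sets M" for n
  proof (cases "m \<le> n \<and> 0 < n \<and> 1 \<le> C * real n * \<omega> (real n) \<and>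
      (\<forall>i<n. \<forall>y\<in>space M. \<bar>real_of_int (birkhoff_sum S f i y)\<bar> \<le> C * real n * \<omega> (real n))")
    case True
    then have "0 \<le> C * real n * \<omega> (real n)" "0 \<le> \<kappa> n" using \<kappa>0 by auto
    from many_returns_measure(1)[OF A'm this, of n] True show ?thesis by (simp add: G_def)
  qed (simp add: G_def)
  have "(\<lambda>n. C * \<omega> (real n)) \<longlonglongrightarrow> C * 0" by (intro tendsto_mult lim tendsto_const)
  then have "eventually (\<lambda>n. C * \<omega> (real n) < \<delta>) sequentially" using \<delta> by (intro order_tendstoD) auto
  then have "eventually (\<lambda>n. \<beta> / 2 \<le> measure M (G n)) sequentially"
    using one bnd eventually_ge_at_top[of "Suc m"]
  proof eventually_elim
    case (elim n)
    let ?b = "C * real n * \<omega> (real n)"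
    have nm: "m \<le> n" "0 < n" using elim by auto
    have b0: "0 \<le> ?b" using elim by linarith
    have "real n * \<beta> \<le> real n * measure M (G n) + (2 * ?b + 1) * (\<kappa> n + 1) * \<mu>"
      using many_returns_measure(2)[OF A'm b0 \<kappa>0[OF nm(1)], of n] elim nm
      by (simp add: G_def \<beta>_def \<mu>_def)
    also have "(2 * ?b + 1) * (\<kappa> n + 1) * \<mu> \<le> (3 * ?b) * (\<kappa> n + 1) * \<mu>"
      using elim \<kappa>0[OF nm(1)] \<mu> by (intro mult_right_mono) auto
    also have "\<dots> = (3 * \<delta> * real n + 3 * ?b) * \<mu>"
      using pos[OF nm(1)] C by (simp add: \<kappa>_def field_simps)
    also have "\<dots> \<le> (3 * \<delta> * real n + 3 * (\<delta> * real n)) * \<mu>"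
    proof -
      have "C * \<omega> (real n) * real n \<le> \<delta> * real n" using elim by (intro mult_right_mono) auto
      then show ?thesis using \<mu> by (intro mult_right_mono) (auto simp: mult_ac)
    qed
    also have "\<dots> = real n * (\<beta> / 2)" using \<mu> by (simp add: \<delta>_def field_simps)
    finally have "real n * (\<beta> / 2) \<le> real n * measure M (G n)" by (simp add: algebra_simps)
    then show ?case using nm by simp
  qed
  then have Z0: "0 < measure M (\<Inter>n. \<Union>k\<in>{n..}. G k)"
    using Gm \<beta> by (intro prob.limsup_positive_measure[of G "\<beta> / 2"]) auto
  have Zm: "(\<Inter>n. \<Union>k\<in>{n..}. G k) \<in> sets M" using Gm by auto
  have Zinf: "zeta_sum T \<omega> A m (y, g) = \<infinity>" if y: "y \<in> (\<Inter>n. \<Union>k\<in>{n..}. G k)" for y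
  proof (rule ccontr)
    assume ne: "zeta_sum T \<omega> A m (y, g) \<noteq> \<infinity>"
    define V where "V = {i. (T ^^ i) (y, g) \<in> A}"
    have "(\<Sum>i. indicator V (m + i) * ennreal (\<omega> (real (m + i)))) = zeta_sum T \<omega> A m (y, g)"
      by (simp add: zeta_sum_def V_def indicator_def)
    then have "(\<Sum>i. indicator V (m + i) * ennreal (\<omega> (real (m + i)))) \<noteq> \<infinity>" using ne by simp
    from visits_negligible_if_weights_summable[OF \<omega> lim this, of "\<delta> / C"] \<delta> C
    obtain n0 where n0: "\<And>n. n0 \<le> n \<Longrightarrow> \<omega> (real n) * real (card (V \<inter> {..n})) < \<delta> / C"
      by (auto simp: eventually_sequentially)
    from y obtain n where n: "n0 \<le> n" "y \<in> G n" by auto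
    have nm: "m \<le> n" and yn: "\<kappa> n \<le> real (card {j \<in> {0<..n}. (S ^^ j) y \<in> A' \<and> birkhoff_sum S f j y = 0})"
      using n(2) by (auto simp: G_def split: if_splits)
    have "{j \<in> {0<..n}. (S ^^ j) y \<in> A' \<and> birkhoff_sum S f j y = 0} \<subseteq> V \<inter> {..n}"
      by (auto simp: V_def skew_product_funpow A'_def sl_def)
    then have "real (card {j \<in> {0<..n}. (S ^^ j) y \<in> A' \<and> birkhoff_sum S f j y = 0}) \<le> real (card (V \<inter> {..n}))"
      by (intro of_nat_mono card_mono) auto
    with yn have "\<omega> (real n) * \<kappa> n \<le> \<omega> (real n) * real (card (V \<inter> {..n}))"
      using pos[OF nm] by (intro mult_left_mono) auto
    moreover have "\<omega> (real n) * \<kappa> n = \<delta> / C" using pos[OF nm] C by (simp add: \<kappa>_def)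
    ultimately show False using n0[OF n(1)] by linarith
  qed
  show ?thesis
    by (rule zeta_infinite_AE[OF A(1) \<omega> _ Zm Z0]) (erule comp, erule Zinf)
qed

end

text \<open>
  If the cocycle does not vanish after some time, every orbit that meets the level \<open>0\<close> does so for a last
  time. Splitting the set of these last points into two parts of positive measure, the full
  orbits through one part form an invariant set that avoids the other part. Invertibility of \<open>S\<close>
  makes the forward images measurable.
\<close>

lemma (in ergodic_skew_product) not_eventually_nonzero:
  assumes S' [measurable]: "S' \<in> measurable M M"
    and inv: "\<And>y. y \<in> space M \<Longrightarrow> S' (S y) = y" "\<And>y. y \<in> space M \<Longrightarrow> S (S' y) = y"
    and split: "\<And>W. W \<in> sets M \<Longrightarrow> 0 < measure M W \<Longrightarrow>
      \<exists>B\<in>sets M. B \<subseteq> W \<and> 0 < measure M B \<and> 0 < measure M (W - B)"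
    and ne: "0 < measure M (space M)"
    and nz: "\<And>n y. n0 \<le> n \<Longrightarrow> y \<in> space M \<Longrightarrow> birkhoff_sum S f n y \<noteq> 0"
  shows False
proof -
  interpret Cs: sigma_finite_measure "count_space (UNIV :: int set)"
    by (rule sigma_finite_measure_count_space)
  define W where "W = {y \<in> space M. \<forall>n. birkhoff_sum S f (Suc n) y \<noteq> 0}"
  have W: "W \<in> sets M" unfolding W_def by measurable
  have "0 < measure M W"
  proof (rule ccontr)
    assume "\<not> 0 < measure M W"
    then have W0: "measure M W = 0" using measure_nonneg[of M W] by linarith
    have "space M \<subseteq> (\<Union>j. (S ^^ j) -` W \<inter> space M)"
    proof
      fix y assume y: "y \<in> space M"
      define j where "j = (GREATEST j. birkhoff_sum S f j y = 0)"
      have bd: "birkhoff_sum S f k y = 0 \<Longrightarrow> k \<le> n0" for k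
        using nz[of k y] y by (meson nat_le_linear)
      have j: "birkhoff_sum S f j y = 0"
        unfolding j_def by (rule GreatestI_nat[of _ 0 n0]) (use bd in auto)
      have "birkhoff_sum S f (Suc n) ((S ^^ j) y) \<noteq> 0" for n
      proof
        assume "birkhoff_sum S f (Suc n) ((S ^^ j) y) = 0"
        then have "birkhoff_sum S f (j + Suc n) y = 0" using j by (simp only: birkhoff_sum_add)
        then have "j + Suc n \<le> j" unfolding j_def by (rule Greatest_le_nat[of _ _ n0]) (use bd in auto)
        then show False by simp
      qed
      then show "y \<in> (\<Union>j. (S ^^ j) -` W \<inter> space M)" using y S_space[OF y, of j] by (auto simp: W_def)
    qed
    moreover have "(\<Union>j. (S ^^ j) -` W \<inter> space M) \<in> null_sets M"
      by (intro null_sets_UN null_setsI)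
        (use W W0 measure_S_funpow[OF W] in \<open>auto simp: prob.emeasure_eq_measure\<close>)
    ultimately have "emeasure M (space M) = 0"
      by (metis emeasure_eq_0 null_setsD1 null_setsD2)
    with ne show False by (simp add: prob.emeasure_eq_measure)
  qed
  then obtain B where B: "B \<in> sets M" "B \<subseteq> W" "0 < measure M B" "0 < measure M (W - B)"
    using split[OF W] by blast
  have [measurable]: "B \<in> sets M" "W \<in> sets M" by (fact B W)+
  define T' where "T' = (\<lambda>(y, g). (S' y, g - f (S' y)))"
  have T'm [measurable]: "T' \<in> measurable N N"
    unfolding T'_def by measurable
  have Tsp: "T x \<in> space N" "T' x \<in> space N" if "x \<in> space N" for x
    using that measurable_space[OF T_meas] measurable_space[OF T'm] by blast+
  have T'T: "T' (T x) = x" "T (T' x) = x" if "x \<in> space N" for x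
    using that inv by (auto simp: T'_def skew_product_def space_N)
  have Tnsp: "(T ^^ n) x \<in> space N" if "x \<in> space N" for x n
    using that by (induction n) (auto intro: Tsp)
  have cancel: "x = z" if "(T ^^ n) x = (T ^^ n) z" "x \<in> space N" "z \<in> space N" for n x z
    using that(1)
  proof (induction n)
    case (Suc n)
    from Suc.prems have "T ((T ^^ n) x) = T ((T ^^ n) z)" by simp
    from arg_cong[OF this, of T'] have "(T ^^ n) x = (T ^^ n) z"
      by (simp only: T'T(1)[OF Tnsp[OF that(2)]] T'T(1)[OF Tnsp[OF that(3)]])
    then show ?case by (rule Suc.IH)
  qed simp
  have image: "T ` Z \<in> sets N" if Z: "Z \<in> sets N" for Z
  proof -
    have "T ` Z = T' -` Z \<inter> space N"
    proof (intro set_eqI iffI)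
      fix x assume "x \<in> T ` Z"
      then obtain z where "x = T z" "z \<in> Z" by blast
      moreover from this have "z \<in> space N" using sets.sets_into_space[OF Z] by blast
      ultimately show "x \<in> T' -` Z \<inter> space N" using T'T(1) Tsp(1) by simp
    next
      fix x assume "x \<in> T' -` Z \<inter> space N"
      then show "x \<in> T ` Z" using T'T(2)[of x] by (intro image_eqI[of _ _ "T' x"]) auto
    qed
    then show ?thesis using measurable_sets[OF T'm Z] by simp
  qed
  define Z where "Z = B \<times> {0 :: int}"
  have Zm: "Z \<in> sets N" unfolding Z_def by auto
  have Zn: "(T ^^ n) ` Z \<in> sets N" for n
  proof (induction n)
    case (Suc n)
    have "(T ^^ Suc n) ` Z = T ` ((T ^^ n) ` Z)" by (auto simp: image_iff)
    then show ?case using image[OF Suc] by simp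
  qed (use Zm in simp)
  define E where "E = (\<Union>n. \<Union>k. (T ^^ n) -` ((T ^^ k) ` Z) \<inter> space N)"
  have Em: "E \<in> sets N"
    unfolding E_def by (intro sets.countable_UN'' measurable_sets[OF T_funpow_meas Zn]) auto
  have "T -` E \<inter> space N = E"
  proof (intro set_eqI iffI)
    fix x assume "x \<in> T -` E \<inter> space N"
    then obtain n k where "(T ^^ n) (T x) \<in> (T ^^ k) ` Z" "x \<in> space N" by (auto simp: E_def)
    then have "x \<in> (T ^^ Suc n) -` ((T ^^ k) ` Z) \<inter> space N"
      by (simp add: funpow_Suc_right del: funpow.simps(2))
    then show "x \<in> E" unfolding E_def by blast
  next
    fix x assume "x \<in> E"
    then obtain n k where nk: "(T ^^ n) x \<in> (T ^^ k) ` Z" "x \<in> space N" by (auto simp: E_def)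
    have "(T ^^ n) (T x) = T ((T ^^ n) x)" by (simp add: funpow_swap1)
    with nk(1) have "(T ^^ n) (T x) \<in> (T ^^ Suc k) ` Z" by auto
    then show "x \<in> T -` E \<inter> space N" using nk(2) Tsp(1)[OF nk(2)] unfolding E_def by blast
  qed
  then have zo: "emeasure N E = 0 \<or> emeasure N (space N - E) = 0"
    using erg Em by (auto simp: ergodic_def)
  have ZE: "Z \<subseteq> E"
  proof
    fix x assume x: "x \<in> Z"
    then have "x \<in> (T ^^ 0) -` ((T ^^ 0) ` Z) \<inter> space N"
      using sets.sets_into_space[OF Zm] by auto
    then show "x \<in> E" unfolding E_def by blast
  qed
  have "emeasure N Z = emeasure M B"
    unfolding Z_def by (subst Cs.emeasure_pair_measure_Times) auto
  also have "\<dots> > 0" using B(3) by (simp add: prob.emeasure_eq_measure)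
  finally have 1: "0 < emeasure N E" using emeasure_mono[OF ZE Em] by (simp add: less_le_trans)
  have leave: "snd ((T ^^ Suc k) (y, 0)) \<noteq> 0" if "y \<in> W" for y k
    using that by (simp only: skew_product_funpow W_def) simp
  have "(W - B) \<times> {0} \<subseteq> space N - E"
  proof
    fix x assume x: "x \<in> (W - B) \<times> {0 :: int}"
    then have xs: "x \<in> space N" using sets.sets_into_space[OF W] by (auto simp: space_N)
    have "x \<notin> E"
    proof
      assume "x \<in> E"
      then obtain n k z where nk: "(T ^^ n) x = (T ^^ k) z" and z: "z \<in> Z" by (auto simp: E_def)
      have zs: "z \<in> space N" using z sets.sets_into_space[OF Zm] by blast
      obtain y where y: "z = (y, 0)" "y \<in> B" using z by (auto simp: Z_def)
      obtain w where w: "x = (w, 0)" "w \<in> W" "w \<notin> B" using x by auto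
      consider "n = k" | d where "k = n + Suc d" | d where "n = k + Suc d"
        by (cases n k rule: linorder_cases) (auto simp: less_iff_Suc_add)
      then show False
      proof cases
        case 1
        then show False using cancel[of n x z] nk xs zs y w by auto
      next
        case (2 d)
        then have "(T ^^ n) x = (T ^^ n) ((T ^^ Suc d) z)" using nk by (simp only: funpow_add comp_apply)
        then have "x = (T ^^ Suc d) z" by (rule cancel[OF _ xs Tnsp[OF zs]])
        then have "snd ((T ^^ Suc d) (y, 0)) = 0" by (metis w(1) y(1) snd_conv)
        moreover have "y \<in> W" using y(2) B(2) by blast
        ultimately show False using leave by blast
      next
        case (3 d)
        then have "(T ^^ k) ((T ^^ Suc d) x) = (T ^^ k) z" using nk by (simp only: funpow_add comp_apply)
        then have "(T ^^ Suc d) x = z" by (rule cancel[OF _ Tnsp[OF xs] zs])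
        then have "snd ((T ^^ Suc d) (w, 0)) = 0" by (simp only: w(1) y(1) snd_conv)
        then show False using leave w(2) by blast
      qed
    qed
    with xs show "x \<in> space N - E" by blast
  qed
  then have "emeasure N ((W - B) \<times> {0}) \<le> emeasure N (space N - E)"
    using Em by (intro emeasure_mono) auto
  moreover have "emeasure N ((W - B) \<times> {0 :: int}) = emeasure M (W - B)"
    by (subst Cs.emeasure_pair_measure_Times) auto
  moreover have "0 < emeasure M (W - B)" using B(4) by (simp add: prob.emeasure_eq_measure)
  ultimately have "0 < emeasure N (space N - E)" by (simp add: less_le_trans)
  with 1 zo show False by (metis less_irrefl)
qed

section \<open>Interval exchanges as measurable maps\<close>

lemma sets_lebesgue_on_iff:
  "\<Omega> \<in> sets lebesgue \<Longrightarrow> A \<in> sets (lebesgue_on \<Omega>) \<longleftrightarrow> A \<in> sets lebesgue \<and> A \<subseteq> \<Omega>"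
  by (subst sets_restrict_space_iff) auto

lemma iet_measurable:
  assumes adm: "admissible D"
  shows "iet D \<in> measurable (lebesgue_on (base D)) (lebesgue_on (base D))"
proof (rule measurableI)
  fix x assume "x \<in> space (lebesgue_on (base D))"
  then show "iet D x \<in> space (lebesgue_on (base D))" using iet_maps_base[OF adm, of x] by simp
next
  fix A assume "A \<in> sets (lebesgue_on (base D))"
  then have A: "A \<in> sets lebesgue" by (simp add: sets_lebesgue_on_iff)
  define t where "t a = left_end (pi1 D) (lam D) a - left_end (pi0 D) (lam D) a" for a
  have eq: "iet D x = x + t a" if "x \<in> exchanged D a" for x a
    using admissible_iet_eq[OF adm that] by (simp add: t_def)
  have "iet D -` A \<inter> base D = (\<Union>a. exchanged D a \<inter> (\<lambda>x. - t a + x) ` A)"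
  proof (intro set_eqI iffI)
    fix x assume x: "x \<in> iet D -` A \<inter> base D"
    then obtain a where a: "x \<in> exchanged D a" using exchanged_cover[OF adm] by blast
    then have "x = - t a + iet D x" by (simp add: eq)
    with x a show "x \<in> (\<Union>a. exchanged D a \<inter> (\<lambda>x. - t a + x) ` A)" by blast
  next
    fix x assume "x \<in> (\<Union>a. exchanged D a \<inter> (\<lambda>x. - t a + x) ` A)"
    then obtain a y where a: "x \<in> exchanged D a" "y \<in> A" "x = - t a + y" by blast
    then have "iet D x = y" by (simp add: eq)
    then show "x \<in> iet D -` A \<inter> base D" using a exchanged_subset_base[OF adm, of a] by auto
  qed
  also have "\<dots> \<in> sets lebesgue"
    by (intro sets.finite_UN sets.Int lebesgue_sets_translation A) (auto simp: subinterval_def)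
  finally show "iet D -` A \<inter> space (lebesgue_on (base D)) \<in> sets (lebesgue_on (base D))"
    by (simp add: sets_lebesgue_on_iff)
qed

text \<open>
  Exchanging the two rows gives the inverse map.
\<close>
definition reverse_iet_data :: "'a::finite iet_data \<Rightarrow> 'a iet_data" where
  "reverse_iet_data D = \<lparr>pi0 = pi1 D, pi1 = pi0 D, lam = lam D\<rparr>"

lemma reverse_iet_data_simps [simp]:
  "pi0 (reverse_iet_data D) = pi1 D" "pi1 (reverse_iet_data D) = pi0 D" "lam (reverse_iet_data D) = lam D"
  "total_length (reverse_iet_data D) = total_length D" "admissible (reverse_iet_data D) = admissible D"
  "reverse_iet_data (reverse_iet_data D) = D"
  by (auto simp: reverse_iet_data_def total_length_def admissible_def)

lemma iet_reverse:
  assumes adm: "admissible D" and x: "x \<in> base D"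
  shows "iet (reverse_iet_data D) (iet D x) = x"
proof -
  obtain a where a: "x \<in> exchanged D a" using exchanged_cover[OF adm x] .
  have "iet D x \<in> exchanged (reverse_iet_data D) a" using iet_in_image_interval[OF adm a] by simp
  from admissible_iet_eq[OF _ this] show ?thesis using adm admissible_iet_eq[OF adm a] by simp
qed

text \<open>
  Among finitely many intervals shorter than the measure of \<open>W\<close> that cover the unit interval, one
  meets \<open>W\<close> in positive measure, and it cannot contain almost all of \<open>W\<close>.
\<close>
lemma lebesgue_unit_interval_split:
  assumes W: "W \<in> sets (lebesgue_on {0..<1::real})" and pos: "0 < measure (lebesgue_on {0..<1}) W"
  shows "\<exists>B\<in>sets (lebesgue_on {0..<1}). B \<subseteq> W \<and> 0 < measure (lebesgue_on {0..<1}) B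
    \<and> 0 < measure (lebesgue_on {0..<1}) (W - B)"
proof -
  let ?M = "lebesgue_on {0..<1::real}"
  interpret finite_measure ?M by (rule finite_measureI) (simp add: emeasure_restrict_space)
  obtain n where n: "inverse (real (Suc n)) < measure ?M W" using reals_Archimedean[OF pos] by blast
  define I where "I i = {real i / real (Suc n)..<(real i + 1) / real (Suc n)}" for i
  have WI: "W \<inter> I i \<in> sets ?M" for i using W by (auto simp: sets_lebesgue_on_iff I_def)
  have cover: "W \<subseteq> (\<Union>i<Suc n. W \<inter> I i)"
  proof
    fix x assume x: "x \<in> W"
    then have x01: "0 \<le> x" "x < 1" using W by (auto simp: sets_lebesgue_on_iff)
    define i where "i = nat \<lfloor>x * real (Suc n)\<rfloor>"
    have "0 \<le> \<lfloor>x * real (Suc n)\<rfloor>" using x01 by simp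
    then have ri: "real i = real_of_int \<lfloor>x * real (Suc n)\<rfloor>" unfolding i_def by simp
    have b: "real i \<le> x * real (Suc n)" "x * real (Suc n) < real i + 1" unfolding ri by linarith+
    have "x * real (Suc n) < 1 * real (Suc n)" using x01 by (intro mult_strict_right_mono) auto
    from le_less_trans[OF b(1) this] have "real i < real (Suc n)" by (simp only: mult_1)
    then have "i < Suc n" by (simp only: of_nat_less_iff)
    moreover have "x \<in> I i" using b unfolding I_def
      by (auto simp: pos_divide_le_eq pos_less_divide_eq simp del: of_nat_Suc)
    ultimately show "x \<in> (\<Union>i<Suc n. W \<inter> I i)" using x by blast
  qed
  have "\<exists>i. 0 < measure ?M (W \<inter> I i)"
  proof (rule ccontr)
    assume "\<nexists>i. 0 < measure ?M (W \<inter> I i)"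
    then have z: "measure ?M (W \<inter> I i) = 0" for i using measure_nonneg[of ?M "W \<inter> I i"] by (metis less_le)
    have "measure ?M W \<le> measure ?M (\<Union>i<Suc n. W \<inter> I i)"
      using cover WI by (intro finite_measure_mono sets.finite_UN) auto
    also have "\<dots> \<le> (\<Sum>i<Suc n. measure ?M (W \<inter> I i))"
      using WI by (intro measure_UNION_le) auto
    finally show False using pos z by simp
  qed
  then obtain i where i: "0 < measure ?M (W \<inter> I i)" by blast
  have "measure ?M (W \<inter> I i) = measure lebesgue (W \<inter> I i)"
    using WI[of i] by (intro measure_restrict_space) (auto simp: sets_lebesgue_on_iff)
  also have "\<dots> \<le> measure lebesgue (I i)"
  proof (rule measure_mono_fmeasurable)
    have "I i \<in> sets lebesgue" unfolding I_def by simp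
    moreover have "bounded (I i)"
      by (rule bounded_subset[OF bounded_closed_interval[of "real i / real (Suc n)" "(real i + 1) / real (Suc n)"]])
        (auto simp: I_def)
    ultimately show "I i \<in> lmeasurable" by (intro bounded_set_imp_lmeasurable)
  qed (use WI[of i] in \<open>auto simp: sets_lebesgue_on_iff\<close>)
  also have "\<dots> = inverse (real (Suc n))"
    by (simp add: I_def field_simps)
  finally have "measure ?M (W \<inter> I i) < measure ?M W" using n by simp
  moreover have "measure ?M (W - W \<inter> I i) = measure ?M W - measure ?M (W \<inter> I i)"
    using W WI[of i] by (intro finite_measure_Diff) auto
  ultimately show ?thesis using i WI[of i] by (intro bexI[of _ "W \<inter> I i"]) auto
qed

section \<open>The weight\<close>

locale log_power_weight =
  fixes s :: real and k :: nat and \<omega> :: "real \<Rightarrow> real"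
  assumes s: "0 \<le> s" "s < 1" and k: "0 < k" and \<omega>: "\<omega> = (\<lambda>x. ln x ^ k * x powr (s - 1))"
begin

lemma pos: "1 < x \<Longrightarrow> 0 < \<omega> x"
  by (simp add: \<omega>)

text \<open>
  The weight is the \<open>k\<close>-th power of \<open>ln x * x powr - t\<close>, and in terms of \<open>ln x\<close> the latter is
  \<open>y * exp (- t * y)\<close>, which decreases for \<open>y \<ge> 1 / t\<close>.
\<close>
lemma eventually_weight: "\<exists>m. weight_from \<omega> m"
proof -
  define t where "t = (1 - s) / real k"
  have t: "0 < t" using s k by (simp add: t_def)
  define h where "h x = ln x * x powr - t" for x
  have \<omega>h: "\<omega> x = h x ^ k" if "0 < x" for x
  proof -
    have "(x powr - t) ^ k = x powr (s - 1)"
      using that k by (simp add: powr_power t_def)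
    then show ?thesis by (simp add: \<omega> h_def power_mult_distrib)
  qed
  have hmono: "h y \<le> h x" if x: "exp (1 / t) \<le> x" and xy: "x \<le> y" for x y
  proof -
    have x0: "0 < x" using x less_le_trans[OF exp_gt_zero] by blast
    have "ln (exp (1 / t)) \<le> ln x" using x x0 by (subst ln_le_cancel_iff) auto
    then have lx: "1 / t \<le> ln x" by simp
    have lx0: "0 < ln x" using lx t by (meson divide_pos_pos less_le_trans zero_less_one)
    have lxy: "ln x \<le> ln y" using xy x0 by simp
    have "ln y / ln x = 1 + (ln y - ln x) / ln x" using lx0 by (simp add: field_simps)
    also have "\<dots> \<le> 1 + t * (ln y - ln x)"
    proof -
      have "1 / ln x \<le> t" using lx lx0 t by (simp add: field_simps)
      then have "(ln y - ln x) * (1 / ln x) \<le> (ln y - ln x) * t" using lxy by (intro mult_left_mono) auto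
      then show ?thesis by (simp add: mult.commute)
    qed
    also have "\<dots> \<le> exp (t * (ln y - ln x))" by (rule exp_ge_add_one_self)
    finally have "ln y \<le> ln x * exp (t * (ln y - ln x))" using lx0 by (simp add: field_simps)
    then have "ln y * exp (- t * ln y) \<le> ln x * exp (t * (ln y - ln x)) * exp (- t * ln y)"
      by (intro mult_right_mono) auto
    also have "\<dots> = ln x * exp (- t * ln x)"
      by (simp add: mult.assoc exp_add[symmetric] algebra_simps)
    finally show ?thesis using x0 xy by (simp add: h_def powr_def)
  qed
  define m where "m = max 2 (nat \<lceil>exp (1 / t)\<rceil>)"
  have m: "2 \<le> real m" "exp (1 / t) \<le> real m" unfolding m_def by linarith+
  have "weight_from \<omega> m"
    unfolding weight_from_def
  proof (intro conjI allI impI)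
    show "0 < \<omega> x" if "real m \<le> x" for x using that m by (intro pos) linarith
    show "antimono_on {real m..} \<omega>"
    proof (rule monotone_onI)
      fix x y assume "x \<in> {real m..}" "y \<in> {real m..}" "x \<le> y"
      then have xy: "real m \<le> x" "x \<le> y" by auto
      then have "1 < y" "1 < x" using m by linarith+
      then have "0 \<le> h y" by (simp add: h_def)
      moreover have "h y \<le> h x" using xy m by (intro hmono) auto
      ultimately have "h y ^ k \<le> h x ^ k" by (intro power_mono)
      then show "\<omega> y \<le> \<omega> x" using \<open>1 < y\<close> \<open>1 < x\<close> by (simp add: \<omega>h)
    qed
  qed
  then show ?thesis by blast
qed

lemma regular: "regularly_varying \<omega>"
  unfolding regularly_varying_def
proof (intro allI impI)
  fix c :: real assume c: "0 < c"
  have "((\<lambda>x. ln c / ln x + 1) \<longlongrightarrow> 0 + 1) at_top"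
    by (intro tendsto_add tendsto_const real_tendsto_divide_at_top[OF tendsto_const ln_at_top])
  moreover have "eventually (\<lambda>x. ln c / ln x + 1 = ln (c * x) / ln x) at_top"
    using eventually_gt_at_top[of 1]
  proof eventually_elim
    case (elim x)
    then have "0 < ln x" by simp
    then show ?case using c elim by (simp add: ln_mult field_simps)
  qed
  ultimately have "((\<lambda>x. ln (c * x) / ln x) \<longlongrightarrow> 1) at_top"
    by (simp add: Lim_transform_eventually)
  then have "((\<lambda>x. (ln (c * x) / ln x) ^ k * c powr (s - 1)) \<longlongrightarrow> 1 ^ k * c powr (s - 1)) at_top"
    by (intro tendsto_mult tendsto_power tendsto_const)
  moreover have "eventually (\<lambda>x. (ln (c * x) / ln x) ^ k * c powr (s - 1) = \<omega> (c * x) / \<omega> x) at_top"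
    using eventually_gt_at_top[of 1]
  proof eventually_elim
    case (elim x)
    then show ?case using c by (simp add: \<omega> power_divide powr_mult)
  qed
  ultimately have "((\<lambda>x. \<omega> (c * x) / \<omega> x) \<longlongrightarrow> c powr (s - 1)) at_top"
    by (simp add: Lim_transform_eventually)
  then have "((\<lambda>x. norm (\<omega> (c * x) / \<omega> x)) \<longlongrightarrow> norm (c powr (s - 1))) at_top" by (rule tendsto_norm)
  then show "(\<lambda>x. \<omega> (c * x)) \<in> \<Theta>(\<omega>)" using c by (intro bigthetaI_tendsto_norm) auto
qed

lemma weight_from_ge_2:
  assumes "weight_from \<omega> m"
  shows "2 \<le> m"
proof (rule ccontr)
  assume "\<not> 2 \<le> m"
  then have "m = 0 \<or> m = 1" by auto
  then have "\<omega> (real m) = 0" using k by (auto simp: \<omega>)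
  moreover have "0 < \<omega> (real m)" using assms by (simp add: weight_from_def)
  ultimately show False by simp
qed

lemma times_weight: "0 < x \<Longrightarrow> x * \<omega> x = ln x ^ k * x powr s"
  by (simp add: \<omega> powr_diff)

lemma times_weight_mono:
  assumes "1 \<le> x" "x \<le> y"
  shows "x * \<omega> x \<le> y * \<omega> y"
  using assms s by (simp add: times_weight) (intro mult_mono power_mono powr_mono2, auto)

lemma weight_Suc:
  assumes "2 \<le> n"
  shows "\<omega> (real n) \<le> 2 * \<omega> (real (Suc n))"
proof -
  have "real n * \<omega> (real n) \<le> real (Suc n) * \<omega> (real (Suc n))"
    using assms by (intro times_weight_mono) auto
  also have "\<dots> \<le> (2 * real n) * \<omega> (real (Suc n))"
    using assms pos[of "real (Suc n)"] by (intro mult_right_mono) auto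
  finally show ?thesis using assms by simp
qed

lemma weight_tendsto_0: "(\<lambda>n. \<omega> (real n)) \<longlonglongrightarrow> 0"
proof -
  define t where "t = (1 - s) / real k"
  have t: "0 < t" using s k by (simp add: t_def)
  have "(\<lambda>n. (ln (real n) / real n powr t) ^ k) \<longlonglongrightarrow> 0 ^ k"
    by (intro tendsto_power lim_ln_over_power t)
  moreover have "eventually (\<lambda>n. (ln (real n) / real n powr t) ^ k = \<omega> (real n)) sequentially"
    using eventually_gt_at_top[of 0]
  proof eventually_elim
    case (elim n)
    have "(real n powr t) ^ k = real n powr (1 - s)" using elim k by (simp add: powr_power t_def)
    then show ?case by (simp add: \<omega> power_divide powr_diff field_simps)
  qed
  ultimately have "(\<lambda>n. \<omega> (real n)) \<longlonglongrightarrow> 0 ^ k" by (rule Lim_transform_eventually)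
  then show ?thesis using k by (simp add: zero_power)
qed

end

section \<open>Recurrence of skew products over interval exchanges of periodic type\<close>

theorem theorem3p4:
  fixes D :: "'a::finite iet_data"
    and p :: nat
    and \<theta>1 \<theta>2 :: real
    and f :: "real \<Rightarrow> int"
  assumes "iet_valid D" and "total_length D = 1"
    and "periodic_type D p"
    and "ergodic (lebesgue_on {0..<1}) (iet D)"
    and "\<theta>1 = lyapunov_exponents D p ! 0" and "\<theta>2 = lyapunov_exponents D p ! 1"
    and "0 \<le> \<theta>2" and "\<theta>2 < \<theta>1"
    and "bounded_variation_on (\<lambda>x. real_of_int (f x)) {0..<1}"
    and "ergodic (lebesgue_on {0..<1} \<Otimes>\<^sub>M count_space UNIV) (skew_product (iet D) f)"
  shows "omega_recurrent (lebesgue_on {0..<1} \<Otimes>\<^sub>M count_space UNIV) (skew_product (iet D) f)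
    (\<lambda>x. ln x ^ CARD('a) * x powr (\<theta>2 / \<theta>1 - 1))"
proof -
  let ?M = "lebesgue_on {0..<1::real}"
  define \<omega> where "\<omega> = (\<lambda>x::real. ln x ^ CARD('a) * x powr (\<theta>2 / \<theta>1 - 1))"
  interpret weight: log_power_weight "\<theta>2 / \<theta>1" "CARD('a)" \<omega>
    by unfold_locales (use assms(7,8) in \<open>auto simp: \<omega>_def\<close>)
  have adm: "admissible D" by (rule iet_valid_imp_admissible[OF assms(1)])
  have base: "base D = {0..<1}" by (simp add: assms(2))
  have fin: "finite_measure ?M" by (rule finite_measureI) (simp add: emeasure_restrict_space)
  have esp: "ergodic_skew_product ?M (iet D) f"
  proof (intro ergodic_skew_product.intro ergodic_skew_product_axioms.intro)
    show "finite_measure ?M" by (rule fin)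
    show "iet D \<in> measurable ?M ?M" using assms(4) unfolding ergodic_def by blast
    show "emeasure ?M (iet D -` A \<inter> space ?M) = emeasure ?M A" if "A \<in> sets ?M" for A
      using assms(4) that unfolding ergodic_def by blast
    show "ergodic (?M \<Otimes>\<^sub>M count_space UNIV) (skew_product (iet D) f)" by (rule assms(10))
  qed
  obtain c C where C: "0 < C" and dev: "\<And>n x. 2 \<le> n \<Longrightarrow> x \<in> {0..<1} \<Longrightarrow>
      \<bar>birkhoff_sum (iet D) (\<lambda>x. real_of_int (f x)) n x - real n * c\<bar>
      \<le> C * ln (real n) ^ CARD('a) * real n powr (\<theta>2 / \<theta>1)"
    by (rule birkhoff_deviation[OF assms(1,2,3,5,6,7,8,9)]) (rule that)
  have dev: "\<bar>real_of_int (birkhoff_sum (iet D) f n x) - real n * c\<bar> \<le> C * (real n * \<omega> (real n))"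
    if "2 \<le> n" "x \<in> {0..<1}" for n x
    using dev[OF that] that by (simp add: birkhoff_sum_def weight.times_weight mult.assoc)
  \<comment> \<open>The mean is zero: otherwise the Birkhoff sums would be nonzero from some time on, at all
    points alike.\<close>
  have "c = 0"
  proof (rule ccontr)
    assume c: "c \<noteq> 0"
    have "(\<lambda>n. C * \<omega> (real n)) \<longlonglongrightarrow> C * 0" by (intro tendsto_mult weight.weight_tendsto_0 tendsto_const)
    then have "eventually (\<lambda>n. C * \<omega> (real n) < \<bar>c\<bar>) sequentially" using c by (intro order_tendstoD) auto
    then obtain n0 where n0: "\<And>n. n0 \<le> n \<Longrightarrow> C * \<omega> (real n) < \<bar>c\<bar>" by (auto simp: eventually_sequentially)
    have nz: "birkhoff_sum (iet D) f n x \<noteq> 0" if n: "max 2 n0 \<le> n" and x: "x \<in> space ?M" for n x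
    proof
      assume "birkhoff_sum (iet D) f n x = 0"
      then have "real n * \<bar>c\<bar> \<le> real n * (C * \<omega> (real n))"
        using dev[of n x] n x by (simp add: abs_mult mult_ac)
      also have "\<dots> < real n * \<bar>c\<bar>" using n n0[of n] by (intro mult_strict_left_mono) auto
      finally show False by simp
    qed
    show False
    proof (rule ergodic_skew_product.not_eventually_nonzero[OF esp, where S' = "iet (reverse_iet_data D)" and ?n0.0 = "max 2 n0"])
      show "iet (reverse_iet_data D) \<in> measurable ?M ?M"
        using iet_measurable[of "reverse_iet_data D"] adm base by simp
      show "iet (reverse_iet_data D) (iet D y) = y" if "y \<in> space ?M" for y
        using that by (intro iet_reverse[OF adm]) (simp add: base)
      show "iet D (iet (reverse_iet_data D) y) = y" if "y \<in> space ?M" for y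
        using iet_reverse[of "reverse_iet_data D" y] that adm base by simp
      show "0 < measure ?M (space ?M)" by (simp add: measure_restrict_space)
      show "\<exists>B\<in>sets ?M. B \<subseteq> W \<and> 0 < measure ?M B \<and> 0 < measure ?M (W - B)"
        if "W \<in> sets ?M" "0 < measure ?M W" for W
        by (rule lebesgue_unit_interval_split[OF that])
    qed (rule nz)
  qed
  then have dev0: "\<bar>real_of_int (birkhoff_sum (iet D) f n x)\<bar> \<le> C * (real n * \<omega> (real n))"
    if "2 \<le> n" "x \<in> {0..<1}" for n x
    using dev[OF that] by simp
  have w2: "0 < real n * \<omega> (real n)" if "2 \<le> n" for n using that weight.pos[of "real n"] by simp
  \<comment> \<open>The factor \<open>2\<close> covers \<open>f\<close> itself, which is the difference of two Birkhoff sums of length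
    \<open>3\<close> and \<open>2\<close>. The second term makes the bound at least \<open>1\<close> from \<open>n = 2\<close> on.\<close>
  define C' where "C' = max (2 * C) (1 / (2 * \<omega> 2))"
  have C'0: "0 < C'" using C by (simp add: C'_def)
  have C'ge: "2 * C \<le> C'" "1 / (2 * \<omega> 2) \<le> C'" by (auto simp: C'_def)
  have one: "1 \<le> C' * real n * \<omega> (real n)" if n: "2 \<le> n" for n
  proof -
    have "1 = 1 / (2 * \<omega> 2) * (2 * \<omega> 2)" using w2[of 2] by simp
    also have "\<dots> \<le> C' * (real n * \<omega> (real n))"
    proof (rule mult_mono)
      show "2 * \<omega> 2 \<le> real n * \<omega> (real n)" using n weight.times_weight_mono[of 2 "real n"] by simp
    qed (use C'ge C'0 w2[of 2] in auto)
    finally show ?thesis by (simp add: mult.assoc)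
  qed
  have bnd: "\<bar>real_of_int (birkhoff_sum (iet D) f i y)\<bar> \<le> C' * real n * \<omega> (real n)"
    if n: "3 \<le> n" and i: "i < n" and y: "y \<in> space ?M" for n i y
  proof -
    have y01: "y \<in> {0..<1}" using y by simp
    have Sy: "iet D y \<in> {0..<1}" using iet_maps_base[OF adm, of y] y01 base by simp
    have mono: "C * (real j * \<omega> (real j)) \<le> C * (real n * \<omega> (real n))" if "2 \<le> j" "j \<le> n" for j
      using that C by (intro mult_left_mono weight.times_weight_mono) auto
    have "\<bar>real_of_int (birkhoff_sum (iet D) f i y)\<bar> \<le> 2 * (C * (real n * \<omega> (real n)))"
    proof -
      consider "i = 0" | "i = 1" | "2 \<le> i" by linarith
      then show ?thesis
      proof cases
        case 1
        then show ?thesis using C w2[of n] n by simp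
      next
        case 2
        have "birkhoff_sum (iet D) f 3 y = birkhoff_sum (iet D) f 1 y + birkhoff_sum (iet D) f 2 (iet D y)"
          using birkhoff_sum_add[of "iet D" f 1 2 y] by (simp add: numeral_3_eq_3)
        then show ?thesis
          using dev0[of 3 y] dev0[of 2 "iet D y"] y01 Sy mono[of 2] mono[of 3] n 2 by simp
      next
        case 3
        have "0 < C * (real n * \<omega> (real n))" using mult_pos_pos[OF C w2[of n]] n by simp
        then show ?thesis using dev0[OF 3 y01] mono[OF 3] i by linarith
      qed
    qed
    also have "\<dots> \<le> C' * (real n * \<omega> (real n))"
      unfolding mult.assoc[symmetric, of 2 C] using C'ge(1) w2[of n] n by (intro mult_right_mono) auto
    finally show ?thesis by (simp add: mult.assoc)
  qed
  let ?N = "?M \<Otimes>\<^sub>M (count_space UNIV :: int measure)" and ?T = "skew_product (iet D) f"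
  have "AE x in ?N. zeta_sum ?T \<omega> A m x = \<infinity>"
    if A: "A \<in> sets ?N" "0 < emeasure ?N A" and m: "weight_from \<omega> m" for A m
  proof (rule ergodic_skew_product.omega_recurrence[OF esp A m _ weight.weight_tendsto_0 C'0])
    show "\<omega> (real n) \<le> 2 * \<omega> (real (Suc n))" if "m \<le> n" for n
      using weight.weight_Suc[of n] weight.weight_from_ge_2[OF m] that by simp
    show "eventually (\<lambda>n. 1 \<le> C' * real n * \<omega> (real n)) sequentially"
      using eventually_ge_at_top[of 2] by eventually_elim (rule one)
    show "eventually (\<lambda>n. \<forall>i<n. \<forall>y\<in>space ?M.
        \<bar>real_of_int (birkhoff_sum (iet D) f i y)\<bar> \<le> C' * real n * \<omega> (real n)) sequentially"
      using eventually_ge_at_top[of 3] by eventually_elim (use bnd in blast)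
  qed
  then have "omega_recurrent ?N ?T \<omega>"
    using weight.eventually_weight weight.regular by (simp add: omega_recurrent_def)
  then show ?thesis by (simp only: \<omega>_def)
qed

end
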